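(* Let $\{(N_j,B_j)\}_{j=1}^m$ be finitely many admissible pairs, let $\{n_k\}_{k=1}^\infty$ be a sequence of positive integers, and let $\Omega=\{1,2,\ldots,m\}^{\mathbb{N}}$. For $\omega=(\omega_k)_{k=1}^\infty\in\Omega$ let $$\mu_{\omega,\{n_k\}} = \delta_{ N_{\omega_1}^{-n_1} B_{\omega_1} } * \delta_{ N_{\omega_1}^{-n_1} N_{\omega_2}^{-n_2} B_{\omega_2} } * \cdots * \delta_{ N_{\omega_1}^{-n_1} N_{\omega_2}^{-n_2} \cdots N_{\omega_k}^{-n_k} B_{\omega_k} } * \cdots$$ and let $\mu_\omega$ denote $\mu_{\omega,\{n_k\}}$ in the case $n_k=1$ for all $k\ge 1$. Then for every Bernoulli measure $\mathbb{P}$ on $\Omega$, the infinite convolution $\mu_{\omega,\{n_k\}}$ is a spectral measure for $\mathbb{P}$-a.e. $\omega\in\Omega$. In particular, $\mu_\omega$ is a spectral measure for $\mathbb{P}$-a.e. $\omega\in\Omega$.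
   Context: For a finite nonempty set $A\subset\mathbb{R}$, $\delta_A=\frac{1}{\#A}\sum_{a\in A}\delta_a$, where $\delta_a$ is the Dirac measure at $a$; $cA=\{ca: a\in A\}$. A Borel probability measure $\mu$ on $\mathbb{R}$ is a spectral measure if there is a set $\Lambda\subset\mathbb{R}$, called a spectrum of $\mu$, such that $\{e^{2\pi i\lambda x}:\lambda\in\Lambda\}$ is an orthonormal basis of $L^2(\mu)$. Given an integer $N$ with $|N|\ge 2$ and a finite set $B\subset\mathbb{Z}$ with $\#B\ge 2$, $(N,B)$ is an admissible pair if the discrete measure $\delta_{N^{-1}B}$ admits a spectrum $L\subset\mathbb{Z}$, i.e. the matrix $\left(\frac{1}{\sqrt{\#B}}e^{-2\pi i b\ell/N}\right)_{b\in B,\ell\in L}$ is unitary. Infinite convolutions are understood as weak limits (against bounded continuous functions) of their finite partial convolutions. A Bernoulli measure on $\Omega$ is the Borel probability measure $\mathbb{P}$ associated with a probability vector $(p_1,\ldots,p_m)$ (with $p_j\ge 0$, $\sum_j p_j=1$) by $\mathbb{P}([i_1i_2\cdots i_n])=p_{i_1}p_{i_2}\cdots p_{i_n}$ for all cylinders $[i_1\cdots i_n]=\{(\omega_k)_{k=1}^\infty\in\Omega:\omega_j=i_j,\ 1\le j\le n\}$. *)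

theory Defs
  imports "HOL-Probability.Probability"
begin

text \<open>The uniform measure \<open>\<delta>\<^sub>A\<close> on a finite nonempty \<open>A\<close>, as a measure on the Borel sets of the line.\<close>

definition uniform_dirac :: "real set \<Rightarrow> real measure" where
  "uniform_dirac A = distr (measure_pmf (pmf_of_set A)) borel (\<lambda>x. x)"

definition square_integrable :: "real measure \<Rightarrow> (real \<Rightarrow> complex) \<Rightarrow> bool" where
  "square_integrable \<mu> f \<longleftrightarrow>
     f \<in> borel_measurable \<mu> \<and> integrable \<mu> (\<lambda>x. (cmod (f x))\<^sup>2)"

definition L2_inner :: "real measure \<Rightarrow> (real \<Rightarrow> complex) \<Rightarrow> (real \<Rightarrow> complex) \<Rightarrow> complex" where
  "L2_inner \<mu> f g = (\<integral>x. f x * cnj (g x) \<partial>\<mu>)"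

definition L2_dist :: "real measure \<Rightarrow> (real \<Rightarrow> complex) \<Rightarrow> (real \<Rightarrow> complex) \<Rightarrow> real" where
  "L2_dist \<mu> f g = sqrt (\<integral>x. (cmod (f x - g x))\<^sup>2 \<partial>\<mu>)"

text \<open>An indexed family is an orthonormal basis of \<open>L\<^sup>2(\<mu>)\<close> if it is orthonormal and its
  finite linear combinations are dense. Elements of \<open>L\<^sup>2(\<mu>)\<close> are represented by
  square-integrable functions rather than classes modulo null sets.\<close>

definition orthonormal_basis_L2 ::
    "real measure \<Rightarrow> 'i set \<Rightarrow> ('i \<Rightarrow> real \<Rightarrow> complex) \<Rightarrow> bool" where
  "orthonormal_basis_L2 \<mu> I e \<longleftrightarrow>
     (\<forall>i\<in>I. square_integrable \<mu> (e i)) \<and>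
     (\<forall>i\<in>I. \<forall>j\<in>I. L2_inner \<mu> (e i) (e j) = (if i = j then 1 else 0)) \<and>
     (\<forall>f. square_integrable \<mu> f \<longrightarrow>
        (\<forall>\<epsilon>>0. \<exists>F c. finite F \<and> F \<subseteq> I \<and>
           L2_dist \<mu> f (\<lambda>x. \<Sum>i\<in>F. c i * e i x) < \<epsilon>))"

definition exponential :: "real \<Rightarrow> real \<Rightarrow> complex" where
  "exponential t x = exp (2 * complex_of_real pi * \<i> * complex_of_real t * complex_of_real x)"

definition is_spectrum :: "real measure \<Rightarrow> real set \<Rightarrow> bool" where
  "is_spectrum \<mu> \<Lambda> \<longleftrightarrow> orthonormal_basis_L2 \<mu> \<Lambda> exponential"

text \<open>\<^locale>\<open>real_distribution\<close> says that \<open>\<mu>\<close> is a Borel probability measure on the line.\<close>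

definition spectral_measure :: "real measure \<Rightarrow> bool" where
  "spectral_measure \<mu> \<longleftrightarrow> real_distribution \<mu> \<and> (\<exists>\<Lambda>. is_spectrum \<mu> \<Lambda>)"

definition admissible_pair :: "int \<Rightarrow> int set \<Rightarrow> bool" where
  "admissible_pair N B \<longleftrightarrow>
     \<bar>N\<bar> \<ge> 2 \<and> finite B \<and> card B \<ge> 2 \<and>
     (\<exists>L. L \<subseteq> \<int> \<and>
        is_spectrum (uniform_dirac ((*) (inverse (real_of_int N)) ` real_of_int ` B)) L)"

text \<open>\<open>partial_convolution \<nu> k\<close> is the convolution of \<open>\<nu> 0, \<dots>, \<nu> (k - 1)\<close>;
  the empty convolution is the unit, the Dirac measure at \<open>0\<close>.\<close>

primrec partial_convolution :: "(nat \<Rightarrow> real measure) \<Rightarrow> nat \<Rightarrow> real measure" where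
  "partial_convolution \<nu> 0 = return borel 0"
| "partial_convolution \<nu> (Suc k) = (partial_convolution \<nu> k \<star> \<nu> k)"

text \<open>Weak convergence tested against bounded continuous functions
  (\<^const>\<open>weak_conv_m\<close> is instead phrased through distribution functions).\<close>

definition weak_limit :: "(nat \<Rightarrow> real measure) \<Rightarrow> real measure \<Rightarrow> bool" where
  "weak_limit M \<mu> \<longleftrightarrow>
     real_distribution \<mu> \<and>
     (\<forall>f :: real \<Rightarrow> real. continuous_on UNIV f \<and> bounded (range f) \<longrightarrow>
        (\<lambda>k. \<integral>x. f x \<partial>M k) \<longlonglongrightarrow> (\<integral>x. f x \<partial>\<mu>))"

definition infinite_convolution :: "(nat \<Rightarrow> real measure) \<Rightarrow> real measure \<Rightarrow> bool" where
  "infinite_convolution \<nu> \<mu> \<longleftrightarrow> weak_limit (partial_convolution \<nu>) \<mu>"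

text \<open>All sequences are indexed from \<open>0\<close>: \<open>\<omega> k\<close> and \<open>n k\<close> are the mathematical
  \<open>\<omega>\<^bsub>k+1\<^esub>\<close> and \<open>n\<^bsub>k+1\<^esub>\<close>. The symbols themselves range over \<open>{1..m}\<close>.\<close>

definition symbol_space :: "nat \<Rightarrow> (nat \<Rightarrow> nat) set" where
  "symbol_space m = {\<omega>. \<forall>k. \<omega> k \<in> {1..m}}"

definition cylinder :: "nat \<Rightarrow> nat \<Rightarrow> (nat \<Rightarrow> nat) \<Rightarrow> (nat \<Rightarrow> nat) set" where
  "cylinder m l i = {\<omega> \<in> symbol_space m. \<forall>j<l. \<omega> j = i j}"

text \<open>The topology on \<^typ>\<open>nat \<Rightarrow> nat\<close> is the product of the discrete topologies, so
  \<open>restrict_space borel (symbol_space m)\<close> carries the Borel sets of the sequence space.\<close>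

definition bernoulli_measure :: "nat \<Rightarrow> (nat \<Rightarrow> nat) measure \<Rightarrow> bool" where
  "bernoulli_measure m P \<longleftrightarrow>
     prob_space P \<and>
     sets P = sets (restrict_space borel (symbol_space m)) \<and>
     (\<exists>p :: nat \<Rightarrow> real.
        (\<forall>j\<in>{1..m}. p j \<ge> 0) \<and> (\<Sum>j\<in>{1..m}. p j) = 1 \<and>
        (\<forall>l i. (\<forall>j<l. i j \<in> {1..m}) \<longrightarrow>
           measure P (cylinder m l i) = (\<Prod>j<l. p (i j))))"

text \<open>The \<open>k\<close>-th factor is uniform on
  \<open>N\<^bsub>\<omega> 0\<^esub>\<^bsup>- n 0\<^esup> \<cdots> N\<^bsub>\<omega> k\<^esub>\<^bsup>- n k\<^esup> B\<^bsub>\<omega> k\<^esub>\<close>.\<close>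

definition factor_measure ::
    "(nat \<Rightarrow> int) \<Rightarrow> (nat \<Rightarrow> int set) \<Rightarrow> (nat \<Rightarrow> nat) \<Rightarrow> (nat \<Rightarrow> nat) \<Rightarrow> nat \<Rightarrow> real measure" where
  "factor_measure N B n \<omega> k =
     uniform_dirac
       ((*) (\<Prod>i\<le>k. real_of_int (N (\<omega> i)) powi (- int (n i))) ` real_of_int ` B (\<omega> k))"

end

theory Submission
  imports Defs "HOL-Complex_Analysis.Complex_Analysis"
begin

text \<open>
  Write the Fourier transform of the tail of the convolution after \<open>k\<close> factors as the infinite product
  \<open>\<phi> k\<close> of trigonometric masks. If for some \<open>e > 0\<close> and infinitely many \<open>k\<close> every \<open>x\<close> has a
  shift \<open>g\<close> in a fixed group of periods of the masks' moduli with \<open>\<bar>\<phi> k (x + g)\<bar> \<ge> e\<close>, then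
  spectra of the partial convolutions can be chosen nested, with every new frequency shifted to a place where the tail is not small. The union
  of these spectra satisfies the Parseval identity for exponentials and is therefore a spectrum.

  If the exponents \<open>n k\<close> are unbounded, tails with large \<open>n k\<close> are close to a Dirac measure and the
  condition is immediate. If they are bounded, some sequence \<open>n'\<close> has all its prefixes occurring
  infinitely often in \<open>n\<close>; pair it with a sequence \<open>\<eta>\<close> in which every symbol of positive probability
  recurs. For this pair no \<open>x\<close> is a zero of all translates of the product: the numbers of such \<open>x\<close> in
  the unit interval do not decrease along the tails and are bounded by a Jensen type estimate; once they are
  constant, the masks have modulus 1 at these points, which forces the points into that
  group, where the product does not vanish. By compactness the condition holds uniformly for the
  pair, and almost surely arbitrarily late blocks of \<open>\<omega>\<close> agree with a long prefix of \<open>\<eta>\<close>.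
\<close>

section \<open>Masks and Hadamard pairs\<close>

text \<open>Each partial convolution satisfies Parseval exactly, but in the limit mass may escape to
  ever larger frequencies. A lower bound on the tails at the frequencies in use prevents this.
  Shifts supply it: adding \<open>D 0 k * g\<close> with \<open>g\<close> in \<open>G\<close> to a
  frequency keeps the moduli of the first \<open>k\<close> masks and moves the argument of the tail
  by \<open>g\<close>. One \<open>e\<close> has to serve infinitely many tails, and the tails of a
  given \<omega> offer no such uniformity by themselves. Hence the comparison with a fixed model
  (\<open>n'\<close>, \<eta>): compactness produces \<open>e\<close> for the model, and finitely
  many matching letters carry it over to a tail of \<omega>. Recurrence in \<eta> matters because a
  constant zero count speaks only about late digit sets, while membership in \<open>G\<close> is a
  condition on all of them. The positions where \<open>n\<close> follows \<open>n'\<close> are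
  deterministic; chance only has to make \<omega> follow \<eta> at some of infinitely many
  prescribed positions.\<close>

definition digit_mask :: "int set \<Rightarrow> real \<Rightarrow> complex" where
  "digit_mask B x = (\<Sum>b\<in>B. cis (2 * pi * b * x)) / card B"

lemma cmod_cis_diff_le: "cmod (cis a - cis b) \<le> \<bar>a - b\<bar>"
proof -
  have "cis a - cis b = cis b * (cis (a - b) - 1)"
    by (simp add: algebra_simps cis_mult)
  then have "cmod (cis a - cis b) = cmod (iexp (a - b) - 1)"
    by (simp add: norm_mult cis_conv_exp)
  also have "\<dots> \<le> \<bar>a - b\<bar>"
    using iexp_approx1[of "a - b" 0] by simp
  finally show ?thesis .
qed

lemma digit_mask_0: "finite B \<Longrightarrow> B \<noteq> {} \<Longrightarrow> digit_mask B 0 = 1"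
  by (simp add: digit_mask_def)

lemma norm_digit_mask_le_1: "norm (digit_mask B x) \<le> 1"
proof (cases "card B = 0")
  case True
  then show ?thesis by (simp add: digit_mask_def)
next
  case False
  have "norm (\<Sum>b\<in>B. cis (2 * pi * b * x)) \<le> (\<Sum>b\<in>B. 1)"
    by (rule order_trans[OF norm_sum]) simp
  then show ?thesis using False
    by (simp add: digit_mask_def norm_divide field_simps)
qed

lemma digit_mask_lipschitz:
  assumes "finite B" "B \<noteq> {}" and C: "\<And>b. b \<in> B \<Longrightarrow> \<bar>real_of_int b\<bar> \<le> C"
  shows "norm (digit_mask B x - digit_mask B y) \<le> 2 * pi * C * \<bar>x - y\<bar>"
proof -
  have c: "card B > 0" using assms by (simp add: card_gt_0_iff)
  have "norm ((\<Sum>b\<in>B. cis (2 * pi * b * x)) - (\<Sum>b\<in>B. cis (2 * pi * b * y)))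
      \<le> (\<Sum>b\<in>B. 2 * pi * C * \<bar>x - y\<bar>)"
    unfolding sum_subtractf[symmetric]
  proof (rule order_trans[OF norm_sum], rule sum_mono)
    fix b assume b: "b \<in> B"
    have "cmod (cis (2 * pi * b * x) - cis (2 * pi * b * y)) \<le> \<bar>2 * pi * b * x - 2 * pi * b * y\<bar>"
      by (rule cmod_cis_diff_le)
    also have "\<dots> = 2 * pi * \<bar>real_of_int b\<bar> * \<bar>x - y\<bar>"
      by (simp add: abs_mult flip: right_diff_distrib)
    also have "\<dots> \<le> 2 * pi * C * \<bar>x - y\<bar>"
      using C[OF b] by (intro mult_right_mono mult_left_mono) auto
    finally show "cmod (cis (2 * pi * b * x) - cis (2 * pi * b * y)) \<le> 2 * pi * C * \<bar>x - y\<bar>" .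
  qed
  then show ?thesis using c
    by (simp add: digit_mask_def norm_divide field_simps flip: diff_divide_distrib)
qed

lemma cis_2pi_eq_1_iff: "cis (2 * pi * t) = 1 \<longleftrightarrow> t \<in> \<int>"
proof
  assume "cis (2 * pi * t) = 1"
  then have "cos (2 * pi * t) = 1" by (simp add: complex_eq_iff)
  then obtain n :: int where "2 * pi * t = n * 2 * pi" by (auto simp: cos_one_2pi_int)
  then have "t = n" by simp
  then show "t \<in> \<int>" by simp
next
  assume "t \<in> \<int>"
  then obtain n :: int where "t = n" by (auto elim: Ints_cases)
  then show "cis (2 * pi * t) = 1"
    using cis_multiple_2pi[of n] by simp
qed

text \<open>Only differences of digits enter the modulus: the shift multiplies all terms by the same
  unimodular number, read off at an arbitrary digit \<open>b0\<close>.\<close>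

lemma norm_digit_mask_periodic:
  assumes "\<And>b b'. b \<in> B \<Longrightarrow> b' \<in> B \<Longrightarrow> real_of_int (b - b') * g \<in> \<int>"
  shows "norm (digit_mask B (x + g)) = norm (digit_mask B x)"
proof (cases "B = {}")
  case True
  then show ?thesis by (simp add: digit_mask_def)
next
  case False
  then obtain b0 where b0: "b0 \<in> B" by auto
  have "cis (2 * pi * b * (x + g)) = cis (2 * pi * b0 * g) * cis (2 * pi * b * x)" if "b \<in> B" for b
  proof -
    have "2 * pi * b * (x + g) = 2 * pi * b0 * g + 2 * pi * b * x + 2 * pi * (real_of_int (b - b0) * g)"
      by (simp add: algebra_simps)
    then have "cis (2 * pi * b * (x + g))
        = cis (2 * pi * b0 * g) * cis (2 * pi * b * x) * cis (2 * pi * (real_of_int (b - b0) * g))"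
      by (simp only: cis_mult)
    moreover have "cis (2 * pi * (real_of_int (b - b0) * g)) = 1"
      using assms[OF that b0] by (simp only: cis_2pi_eq_1_iff)
    ultimately show ?thesis by simp
  qed
  then have "digit_mask B (x + g) = cis (2 * pi * b0 * g) * digit_mask B x"
    by (simp add: digit_mask_def sum_distrib_left)
  then show ?thesis by (simp add: norm_mult)
qed

text \<open>Equality case of the triangle inequality: an average of unit complex numbers has modulus
  1 only if they all coincide.\<close>

lemma norm_digit_mask_eq_1_imp_Ints:
  assumes "norm (digit_mask B x) = 1" "b \<in> B" "b' \<in> B"
  shows "real_of_int (b - b') * x \<in> \<int>"
proof -
  define u where "u = digit_mask B x"
  have nu: "u * cnj u = 1" using assms(1) by (simp add: u_def complex_norm_square[symmetric])
  have c: "card B > 0"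
    using assms(1) by (auto simp: digit_mask_def intro: gr0I)
  then have fin: "finite B" by (rule card_ge_0_finite)
  have "(\<Sum>b\<in>B. cis (2 * pi * b * x)) = card B * u"
    using c by (simp add: u_def digit_mask_def)
  then have "(\<Sum>b\<in>B. cis (2 * pi * b * x) * cnj u) = card B"
    using nu by (simp add: sum_distrib_right[symmetric] mult.assoc)
  then have "Re (\<Sum>b\<in>B. cis (2 * pi * b * x) * cnj u) = card B"
    by simp
  then have "(\<Sum>b\<in>B. 1 - Re (cis (2 * pi * b * x) * cnj u)) = 0"
    unfolding sum_subtractf Re_sum by simp
  moreover have le: "Re (cis (2 * pi * b * x) * cnj u) \<le> 1" for b
    using complex_Re_le_cmod[of "cis (2 * pi * b * x) * cnj u"] assms(1)
    by (simp add: norm_mult u_def)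
  ultimately have re1: "Re (cis (2 * pi * b * x) * cnj u) = 1" if "b \<in> B" for b
    using fin that by (subst (asm) sum_nonneg_eq_0_iff) auto
  have eq: "cis (2 * pi * b * x) = u" if "b \<in> B" for b
  proof -
    define z where "z = cis (2 * pi * b * x) * cnj u"
    have "cmod z = 1" using assms(1) by (simp add: z_def norm_mult u_def)
    moreover have "Re z = 1" using re1[OF that] by (simp add: z_def)
    ultimately have "Im z = 0" by (simp add: cmod_def)
    with \<open>Re z = 1\<close> have "z = 1" by (simp add: complex_eq_iff)
    have "cis (2 * pi * b * x) = cis (2 * pi * b * x) * (u * cnj u)" by (simp only: nu mult_1_right)
    also have "\<dots> = z * u" by (simp only: z_def mult_ac)
    finally show ?thesis using \<open>z = 1\<close> by simp
  qed
  have "cis (2 * pi * (real_of_int (b - b') * x)) = cis (2 * pi * b * x - 2 * pi * b' * x)"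
    by (rule arg_cong[of _ _ cis]) (simp add: algebra_simps)
  also have "\<dots> = cis (2 * pi * b * x) / cis (2 * pi * b' * x)"
    by (simp add: cis_divide)
  also have "\<dots> = 1" using eq[OF assms(2)] eq[OF assms(3)]
    by (metis cis_neq_zero divide_self)
  finally show ?thesis by (simp only: cis_2pi_eq_1_iff)
qed

text \<open>Unitarity in Parseval form. Orthogonality is included: at \<open>x = - l'\<close> with \<open>l' \<in> L\<close> the term
  \<open>l = l'\<close> already equals 1.\<close>

definition hadamard :: "int \<Rightarrow> int set \<Rightarrow> int set \<Rightarrow> bool" where
  "hadamard M B L \<longleftrightarrow> finite L \<and> 0 \<in> L \<and>
     (\<forall>x. (\<Sum>l\<in>L. (norm (digit_mask B ((x + real_of_int l) / real_of_int M)))\<^sup>2) = 1)"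

text \<open>The digits stay the same while the frequencies are dilated by \<open>c\<close>; the
  identity for \<open>M ^ n\<close> at \<open>x\<close> is then the one for \<open>M\<close> at
  \<open>x / c\<close>. This absorbs the exponents \<open>n k\<close> into the bases.\<close>

lemma hadamard_power:
  assumes "hadamard M B L" "n \<ge> 1" "M \<noteq> 0"
  shows "\<exists>L'. hadamard (M ^ n) B L'"
proof -
  define c where "c = M ^ (n - 1)"
  have c0: "c \<noteq> 0" using assms by (simp add: c_def)
  have Mn: "M ^ n = c * M" using assms(2) by (cases n) (auto simp: c_def mult.commute)
  have inj: "inj_on ((*) c) L" using c0 by (auto simp: inj_on_def)
  have "(\<Sum>l\<in>(*) c ` L. (norm (digit_mask B ((x + real_of_int l) / real_of_int (M ^ n))))\<^sup>2) = 1" for x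
  proof -
    have "(x + real_of_int (c * l)) / real_of_int (M ^ n) = (x / c + real_of_int l) / real_of_int M" for l
      using c0 assms(3) by (simp add: Mn field_simps)
    then show ?thesis using assms(1)
      by (simp add: sum.reindex[OF inj] hadamard_def o_def)
  qed
  then have "hadamard (M ^ n) B ((*) c ` L)"
    using assms(1) by (force simp: hadamard_def)
  then show ?thesis by blast
qed

text \<open>Dividing out the zeros: each zero in the unit disc gains a factor 2 on the circle \<open>|z| = 3\<close>.\<close>

lemma norm_0_times_power_card_zeros_le:
  assumes "finite S" "f holomorphic_on UNIV"
    and "\<And>z. z \<in> S \<Longrightarrow> f z = 0 \<and> norm z \<le> 1 \<and> z \<noteq> 0"
    and "\<And>z. norm z = 3 \<Longrightarrow> norm (f z) \<le> K"
  shows "norm (f 0) * 2 ^ card S \<le> K"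
  using assms
proof (induction S arbitrary: f K rule: finite_induct)
  case empty
  have "norm ((deriv ^^ 0) f 0) \<le> fact 0 * K / 3 ^ 0"
    by (rule Cauchy_inequality[where r = 3])
       (use empty in \<open>auto intro: holomorphic_on_subset holomorphic_on_imp_continuous_on\<close>)
  then show ?case by simp
next
  case (insert a S)
  have a: "f a = 0" "norm a \<le> 1" "a \<noteq> 0" using insert.prems(2) by auto
  define g where "g z = (if z = a then deriv f a else (f z - f a) / (z - a))" for z
  have holg: "g holomorphic_on UNIV"
    unfolding g_def by (rule pole_lemma_open) (use insert.prems in auto)
  \<comment> \<open>Dividing by \<open>z - a\<close> multiplies the value at 0 by
    \<open>- 1 / a\<close>; the factor \<open>- a\<close> restores it.\<close>
  define h where "h z = - a * g z" for z
  have "norm (h 0) * 2 ^ card S \<le> K / 2"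
  proof (rule insert.IH)
    show "h holomorphic_on UNIV" unfolding h_def using holg by (intro holomorphic_intros)
    show "h z = 0 \<and> norm z \<le> 1 \<and> z \<noteq> 0" if "z \<in> S" for z
      using that insert.hyps insert.prems(2)[of z] a by (auto simp: h_def g_def)
    show "norm (h z) \<le> K / 2" if z: "norm z = 3" for z
    proof -
      have za: "z \<noteq> a" using z a by auto
      have "norm (z - a) \<ge> 2 * norm a"
        using norm_triangle_ineq2[of z a] z a by simp
      moreover have "norm (h z) = norm a * norm (f z) / norm (z - a)"
        using za a by (simp add: h_def g_def norm_mult norm_divide)
      ultimately have "norm (h z) \<le> norm a * norm (f z) / (2 * norm a)"
        using a za by (simp only:, intro divide_left_mono) auto
      also have "\<dots> = norm (f z) / 2" using a by simp
      also have "\<dots> \<le> K / 2" using insert.prems(3)[OF z] by simp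
      finally show ?thesis .
    qed
  qed
  moreover have "h 0 = f 0" using a by (simp add: h_def g_def)
  ultimately show ?case using insert.hyps by simp
qed

section \<open>Infinite products of masks\<close>

locale digits =
  fixes M :: "nat \<Rightarrow> int" and B :: "nat \<Rightarrow> int set" and C :: real
  assumes M_ge: "\<bar>M i\<bar> \<ge> 2"
    and B_fin: "finite (B i)" and B_ne: "B i \<noteq> {}"
    and B_bound: "b \<in> B i \<Longrightarrow> \<bar>real_of_int b\<bar> \<le> C"
begin

definition D :: "nat \<Rightarrow> nat \<Rightarrow> int" where
  "D a b = (\<Prod>i\<in>{a..<b}. M i)"

text \<open>The Fourier transform of the convolution of the factors \<open>a\<close>, ...,
  \<open>b - 1\<close>, rescaled as if the construction started at \<open>a\<close>. Every tail is
  thus an object of the same kind as the whole product.\<close>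

definition pr :: "nat \<Rightarrow> nat \<Rightarrow> real \<Rightarrow> complex" where
  "pr a b x = (\<Prod>i\<in>{a..<b}. digit_mask (B i) (x / D a (Suc i)))"

definition \<phi> :: "nat \<Rightarrow> real \<Rightarrow> complex" where
  "\<phi> a x = lim (\<lambda>b. pr a b x)"

lemma C_nonneg: "C \<ge> 0"
  using B_ne[of 0] B_bound[of _ 0] by (metis abs_ge_zero all_not_in_conv order_trans)

lemma D_same [simp]: "D a a = 1"
  by (simp add: D_def)

lemma D_Suc: "a \<le> b \<Longrightarrow> D a (Suc b) = D a b * M b"
  by (simp add: D_def)

lemma D_Suc_same [simp]: "D a (Suc a) = M a"
  by (simp add: D_def)

lemma D_split: "a \<le> b \<Longrightarrow> b \<le> c \<Longrightarrow> D a c = D a b * D b c"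
  by (simp add: D_def prod.atLeastLessThan_concat)

lemma D_ge:
  assumes "a \<le> b"
  shows "\<bar>real_of_int (D a b)\<bar> \<ge> 2 ^ (b - a)"
  using assms
proof (induction b rule: dec_induct)
  case base
  then show ?case by simp
next
  case (step b)
  have "\<bar>real_of_int (M b)\<bar> \<ge> 2" using M_ge[of b] by linarith
  then have "2 ^ (b - a) * 2 \<le> \<bar>real_of_int (D a b)\<bar> * \<bar>real_of_int (M b)\<bar>"
    using step by (intro mult_mono) auto
  then show ?case using step by (simp add: D_Suc Suc_diff_le abs_mult mult.commute)
qed

lemma D_nonzero: "a \<le> b \<Longrightarrow> D a b \<noteq> 0"
  using D_ge[of a b] by (metis abs_zero not_le of_int_0 zero_less_numeral zero_less_power)

lemma abs_div_D_le:
  assumes "a \<le> b"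
  shows "\<bar>x / D a b\<bar> \<le> \<bar>x\<bar> / 2 ^ (b - a)"
  unfolding abs_divide
  by (rule divide_left_mono[OF D_ge[OF assms]]) (use D_nonzero[OF assms] in auto)

text \<open>Comparison with 1/2 + 1/4 + ... . Summing to at most 1 is why the constants
  \<open>2 * pi * C\<close> and \<open>6 * pi * C\<close> below carry no further factor.\<close>

lemma sum_inverse_D_le: "(\<Sum>i\<in>{a..<b}. 1 / \<bar>real_of_int (D a (Suc i))\<bar>) \<le> 1"
proof (cases "a \<le> b")
  case True
  have "(\<Sum>i\<in>{a..<b}. 1 / \<bar>real_of_int (D a (Suc i))\<bar>) \<le> (\<Sum>i\<in>{a..<b}. 1 / 2 ^ (Suc i - a))"
  proof (rule sum_mono)
    fix i assume "i \<in> {a..<b}"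
    then show "1 / \<bar>real_of_int (D a (Suc i))\<bar> \<le> 1 / 2 ^ (Suc i - a)"
      using D_ge[of a "Suc i"] by (intro divide_left_mono mult_pos_pos) (auto simp: D_nonzero)
  qed
  also have "\<dots> = 1 - 1 / 2 ^ (b - a)"
    using True
  proof (induction b rule: dec_induct)
    case (step b)
    then show ?case by (simp add: Suc_diff_le field_simps)
  qed simp
  finally show ?thesis by (smt (verit) zero_less_divide_1_iff zero_less_power)
qed simp

section \<open>Finite products of masks and their limits\<close>

lemma pr_same [simp]: "pr a a x = 1"
  by (simp add: pr_def)

lemma pr_0 [simp]: "pr a b 0 = 1"
  by (simp add: pr_def digit_mask_0 B_fin B_ne)

lemma pr_Suc: "a \<le> b \<Longrightarrow> pr a (Suc b) x = pr a b x * digit_mask (B b) (x / D a (Suc b))"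
  by (simp add: pr_def)

lemma pr_split:
  assumes "a \<le> b" "b \<le> c"
  shows "pr a c x = pr a b x * pr b c (x / D a b)"
proof -
  have "pr b c (x / D a b) = (\<Prod>i\<in>{b..<c}. digit_mask (B i) (x / D a (Suc i)))"
    unfolding pr_def
  proof (rule prod.cong[OF refl])
    fix i assume "i \<in> {b..<c}"
    then have "D a (Suc i) = D a b * D b (Suc i)" using assms by (intro D_split) auto
    then show "digit_mask (B i) (x / D a b / D b (Suc i)) = digit_mask (B i) (x / D a (Suc i))"
      by simp
  qed
  then show ?thesis using assms by (simp add: pr_def prod.atLeastLessThan_concat)
qed

lemma norm_pr_le_1: "norm (pr a b x) \<le> 1"
  unfolding pr_def by (simp add: prod_norm[symmetric] norm_digit_mask_le_1 prod_le_1)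

text \<open>For factors of modulus at most 1, the difference of products is bounded by the sum of
  the differences. The constant depends on neither \<open>a\<close> nor \<open>b\<close>, so the
  same estimate serves all tails.\<close>

lemma pr_lipschitz: "norm (pr a b x - pr a b y) \<le> 2 * pi * C * \<bar>x - y\<bar>"
proof -
  have "norm (pr a b x - pr a b y)
      \<le> (\<Sum>i\<in>{a..<b}. norm (digit_mask (B i) (x / D a (Suc i)) - digit_mask (B i) (y / D a (Suc i))))"
    unfolding pr_def by (rule norm_prod_diff) (auto simp: norm_digit_mask_le_1)
  also have "\<dots> \<le> (\<Sum>i\<in>{a..<b}. 2 * pi * C * \<bar>x - y\<bar> * (1 / \<bar>real_of_int (D a (Suc i))\<bar>))"
  proof (rule sum_mono)
    fix i assume "i \<in> {a..<b}"
    have "norm (digit_mask (B i) (x / D a (Suc i)) - digit_mask (B i) (y / D a (Suc i)))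
        \<le> 2 * pi * C * \<bar>x / D a (Suc i) - y / D a (Suc i)\<bar>"
      by (rule digit_mask_lipschitz) (auto simp: B_fin B_ne B_bound)
    also have "\<dots> = 2 * pi * C * \<bar>x - y\<bar> * (1 / \<bar>real_of_int (D a (Suc i))\<bar>)"
      by (simp add: abs_divide flip: diff_divide_distrib)
    finally show "norm (digit_mask (B i) (x / D a (Suc i)) - digit_mask (B i) (y / D a (Suc i)))
        \<le> 2 * pi * C * \<bar>x - y\<bar> * (1 / \<bar>real_of_int (D a (Suc i))\<bar>)" .
  qed
  also have "\<dots> = 2 * pi * C * \<bar>x - y\<bar> * (\<Sum>i\<in>{a..<b}. 1 / \<bar>real_of_int (D a (Suc i))\<bar>)"
    by (simp only: sum_distrib_left)
  also have "\<dots> \<le> 2 * pi * C * \<bar>x - y\<bar> * 1"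
    using C_nonneg by (intro mult_left_mono sum_inverse_D_le) auto
  finally show ?thesis by simp
qed

lemma pr_tail:
  assumes "a \<le> b" "b \<le> c"
  shows "norm (pr a c x - pr a b x) \<le> 2 * pi * C * \<bar>x\<bar> / 2 ^ (b - a)"
proof -
  \<comment> \<open>After the common factor \<open>pr a b x\<close> is taken out, the remaining
    product is compared with its value 1 at 0.\<close>
  have "norm (pr a c x - pr a b x) = norm (pr a b x) * norm (pr b c (x / D a b) - pr b c 0)"
    by (simp add: pr_split[OF assms] right_diff_distrib flip: norm_mult)
  also have "\<dots> \<le> 1 * (2 * pi * C * \<bar>x / D a b - 0\<bar>)"
    by (intro mult_mono norm_pr_le_1 pr_lipschitz) auto
  also have "\<dots> \<le> 2 * pi * C * (\<bar>x\<bar> / 2 ^ (b - a))"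
    using C_nonneg abs_div_D_le[OF assms(1), of x] by (simp only: mult_1 diff_0_right mult_left_mono pi_ge_zero mult_nonneg_nonneg zero_le_numeral)
  finally show ?thesis by simp
qed

lemma pr_tendsto: "(\<lambda>b. pr a b x) \<longlonglongrightarrow> \<phi> a x"
proof -
  have "Cauchy (\<lambda>b. pr a b x)"
  proof (rule CauchyI')
    fix e :: real assume "e > 0"
    have "(\<lambda>n. 2 * pi * C * \<bar>x\<bar> * (1 / 2) ^ n) \<longlonglongrightarrow> 2 * pi * C * \<bar>x\<bar> * 0"
      by (intro tendsto_intros LIMSEQ_power_zero) auto
    then have "\<forall>\<^sub>F n in sequentially. 2 * pi * C * \<bar>x\<bar> * (1 / 2) ^ n < e"
      using \<open>e > 0\<close> by (intro order_tendstoD(2)[where y = "2 * pi * C * \<bar>x\<bar> * 0"]) auto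
    then obtain n where n: "2 * pi * C * \<bar>x\<bar> * (1 / 2) ^ n < e"
      by (auto simp: eventually_sequentially)
    have n': "2 * pi * C * \<bar>x\<bar> / 2 ^ n < e" using n by (simp add: power_divide)
    have "norm (pr a m x - pr a k x) < e" if "m \<ge> a + n" "k > m" for m k
    proof -
      have "norm (pr a k x - pr a m x) \<le> 2 * pi * C * \<bar>x\<bar> / 2 ^ (m - a)"
        using that by (intro pr_tail) auto
      also have "\<dots> \<le> 2 * pi * C * \<bar>x\<bar> / 2 ^ n"
        using that C_nonneg by (intro divide_left_mono power_increasing) auto
      finally show ?thesis using n' by (simp add: norm_minus_commute)
    qed
    then show "\<exists>N. \<forall>m\<ge>N. \<forall>k>m. dist (pr a m x) (pr a k x) < e"
      unfolding dist_norm by blast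
  qed
  then show ?thesis unfolding \<phi>_def by (simp add: Cauchy_convergent_iff convergent_LIMSEQ_iff)
qed

lemma \<phi>_0 [simp]: "\<phi> a 0 = 1"
  using LIMSEQ_unique[OF pr_tendsto[of a 0]] by simp

lemma norm_\<phi>_le_1: "norm (\<phi> a x) \<le> 1"
  by (rule LIMSEQ_le_const2[OF tendsto_norm[OF pr_tendsto]]) (auto simp: norm_pr_le_1)

lemma \<phi>_lipschitz: "norm (\<phi> a x - \<phi> a y) \<le> 2 * pi * C * \<bar>x - y\<bar>"
  by (rule LIMSEQ_le_const2[OF tendsto_norm[OF tendsto_diff[OF pr_tendsto pr_tendsto]]])
     (use pr_lipschitz in blast)

lemma \<phi>_tail:
  assumes "a \<le> b"
  shows "norm (\<phi> a x - pr a b x) \<le> 2 * pi * C * \<bar>x\<bar> / 2 ^ (b - a)"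
  using pr_tail[OF assms]
  by (intro LIMSEQ_le_const2[OF tendsto_norm[OF tendsto_diff[OF pr_tendsto tendsto_const]]]) blast

lemma \<phi>_split:
  assumes "a \<le> b"
  shows "\<phi> a x = pr a b x * \<phi> b (x / D a b)"
proof (rule LIMSEQ_unique[OF pr_tendsto])
  have "(\<lambda>c. pr a b x * pr b c (x / D a b)) \<longlonglongrightarrow> pr a b x * \<phi> b (x / D a b)"
    by (intro tendsto_intros pr_tendsto)
  moreover have "\<forall>\<^sub>F c in sequentially. pr a b x * pr b c (x / D a b) = pr a c x"
    using eventually_ge_at_top[of b] by eventually_elim (rule pr_split[OF assms, symmetric])
  ultimately show "(\<lambda>c. pr a c x) \<longlonglongrightarrow> pr a b x * \<phi> b (x / D a b)"
    by (rule Lim_transform_eventually)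
qed

lemma \<phi>_step: "\<phi> a x = digit_mask (B a) (x / M a) * \<phi> (Suc a) (x / M a)"
  using \<phi>_split[of a "Suc a" x] by (simp add: pr_def)

lemma \<phi>_near_0: "norm (\<phi> a x) \<ge> 1 - 2 * pi * C * \<bar>x\<bar>"
  using \<phi>_lipschitz[of a x 0] norm_triangle_ineq2[of 1 "\<phi> a x"]
  by (simp add: norm_minus_commute)

text \<open>The part of the product beyond a late index is evaluated near 0, where it is close to 1,
  so a zero must come from finitely many masks. Zeros can therefore be counted in finite products,
  which extend to entire functions.\<close>

lemma \<phi>_zero_imp_pr_zero:
  assumes "\<phi> a x = 0"
  shows "\<exists>b0\<ge>a. \<forall>b\<ge>b0. pr a b x = 0"
proof -
  have "(\<lambda>n. 2 * pi * C * \<bar>x\<bar> * (1 / 2) ^ n) \<longlonglongrightarrow> 2 * pi * C * \<bar>x\<bar> * 0"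
    by (intro tendsto_intros LIMSEQ_power_zero) auto
  then have "\<forall>\<^sub>F n in sequentially. 2 * pi * C * \<bar>x\<bar> * (1 / 2) ^ n < 1"
    by (intro order_tendstoD(2)[where y = "2 * pi * C * \<bar>x\<bar> * 0"]) auto
  then obtain n0 where n: "\<And>n. n \<ge> n0 \<Longrightarrow> 2 * pi * C * \<bar>x\<bar> * (1 / 2) ^ n < 1"
    by (auto simp: eventually_sequentially)
  have "pr a b x = 0" if "b \<ge> a + n0" for b
  proof -
    have "2 * pi * C * \<bar>x / D a b\<bar> \<le> 2 * pi * C * (\<bar>x\<bar> / 2 ^ (b - a))"
      using that C_nonneg by (intro mult_left_mono abs_div_D_le) auto
    also have "\<dots> < 1" using n[of "b - a"] that by (simp add: power_divide)
    finally have "\<phi> b (x / D a b) \<noteq> 0" using \<phi>_near_0[where a = b and x = "x / D a b"] by auto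
    then show ?thesis using \<phi>_split[of a b x] that assms by auto
  qed
  then show ?thesis by (intro exI[of _ "a + n0"]) auto
qed

text \<open>The exponential bounds a finite product on the circle of radius 3: there a digit
  \<open>d\<close> contributes at most
  \<open>exp (2 * pi * 3 * \<bar>d\<bar> / \<bar>D\<bar>)\<close>, and the reciprocals of the
  \<open>\<bar>D\<bar>\<close> sum to at most 1.\<close>

definition zero_bound :: nat where
  "zero_bound = nat \<lceil>exp (6 * pi * C)\<rceil>"

lemma card_zeros_\<phi>:
  assumes "finite S" and S: "\<And>x. x \<in> S \<Longrightarrow> 0 \<le> x \<and> x < 1 \<and> \<phi> a x = 0"
  shows "card S \<le> zero_bound"
proof -
  have "\<exists>b0. \<forall>x\<in>S. \<forall>b\<ge>b0. pr a b x = 0"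
    using assms
  proof (induction S rule: finite_induct)
    case (insert y S)
    then obtain b1 where b1: "\<forall>x\<in>S. \<forall>b\<ge>b1. pr a b x = 0" by auto
    obtain b2 where b2: "\<forall>b\<ge>b2. pr a b y = 0"
      using \<phi>_zero_imp_pr_zero[of a y] insert.prems by auto
    show ?case using b1 b2 by (intro exI[of _ "max b1 b2"]) auto
  qed auto
  then obtain b where b: "\<And>x. x \<in> S \<Longrightarrow> pr a b x = 0" by auto
  \<comment> \<open>The entire extension of the \<open>i\<close>-th mask; a finite product of these
    vanishes on all of \<open>S\<close> at once.\<close>
  define g where "g i z = (\<Sum>d\<in>B i. exp (2 * pi * \<i> * d * (z / D a (Suc i)))) / card (B i)"
    for i and z :: complex
  define f where "f z = (\<Prod>i\<in>{a..<b}. g i z)" for z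
  have gr: "g i (of_real x) = digit_mask (B i) (x / D a (Suc i))" for i x
    by (simp add: g_def digit_mask_def cis_conv_exp mult_ac)
  have fr: "f (of_real x) = pr a b x" for x
    by (simp add: f_def pr_def gr)
  have "norm (f 0) * 2 ^ card (of_real ` S :: complex set) \<le> exp (6 * pi * C)"
  proof (rule norm_0_times_power_card_zeros_le)
    show "finite (of_real ` S :: complex set)" using assms by simp
    show "f holomorphic_on UNIV" unfolding f_def g_def
      by (intro holomorphic_intros) (auto simp: D_nonzero B_fin B_ne)
    fix z :: complex assume "z \<in> of_real ` S"
    then obtain x where x: "z = of_real x" "x \<in> S" by auto
    have "x \<noteq> 0" using S[OF x(2)] by auto
    then show "f z = 0 \<and> norm z \<le> 1 \<and> z \<noteq> 0"
      using x S[of x] b[of x] by (simp add: fr)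
  next
    fix z :: complex assume z: "norm z = 3"
    have gb: "norm (g i z) \<le> exp (6 * pi * C * (1 / \<bar>real_of_int (D a (Suc i))\<bar>))" for i
    proof -
      have c: "card (B i) > 0" using B_fin B_ne by (simp add: card_gt_0_iff)
      have "norm (\<Sum>d\<in>B i. exp (2 * pi * \<i> * d * (z / D a (Suc i))))
          \<le> (\<Sum>d\<in>B i. exp (6 * pi * C * (1 / \<bar>real_of_int (D a (Suc i))\<bar>)))"
      proof (rule order_trans[OF norm_sum], rule sum_mono)
        fix d assume d: "d \<in> B i"
        have "norm (exp (2 * pi * \<i> * d * (z / D a (Suc i)))) \<le> exp (norm (2 * pi * \<i> * d * (z / D a (Suc i))))"
          by (rule norm_exp)
        also have "norm (2 * pi * \<i> * d * (z / D a (Suc i))) = 6 * pi * (\<bar>real_of_int d\<bar> / \<bar>real_of_int (D a (Suc i))\<bar>)"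
          by (simp add: norm_mult norm_divide z)
        also have "exp \<dots> \<le> exp (6 * pi * (C / \<bar>real_of_int (D a (Suc i))\<bar>))"
          using B_bound[OF d] by (simp add: divide_right_mono)
        finally show "norm (exp (2 * pi * \<i> * d * (z / D a (Suc i))))
            \<le> exp (6 * pi * C * (1 / \<bar>real_of_int (D a (Suc i))\<bar>))" by simp
      qed
      then show ?thesis using c by (simp add: g_def norm_divide field_simps)
    qed
    have "norm (f z) \<le> (\<Prod>i\<in>{a..<b}. exp (6 * pi * C * (1 / \<bar>real_of_int (D a (Suc i))\<bar>)))"
      unfolding f_def prod_norm[symmetric] by (rule prod_mono, rule conjI[OF norm_ge_zero gb])
    also have "\<dots> = exp (6 * pi * C * (\<Sum>i\<in>{a..<b}. 1 / \<bar>real_of_int (D a (Suc i))\<bar>))"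
      by (simp only: exp_sum[symmetric] finite_atLeastLessThan sum_distrib_left)
    also have "\<dots> \<le> exp (6 * pi * C * 1)"
      unfolding exp_le_cancel_iff using C_nonneg by (intro mult_left_mono sum_inverse_D_le) auto
    finally show "norm (f z) \<le> exp (6 * pi * C)" by simp
  qed
  moreover have "f 0 = 1" using fr[of 0] by simp
  moreover have "card (of_real ` S :: complex set) = card S"
    by (rule card_image) (auto simp: inj_on_def)
  ultimately have "2 ^ card S \<le> exp (6 * pi * C)" by simp
  then have "real (card S) \<le> exp (6 * pi * C)"
    using of_nat_less_two_power[of "card S", where 'a = real] by linarith
  then show ?thesis unfolding zero_bound_def by linarith
qed

text \<open>All moduli below are periodic under this group, which contains the integers but may be larger.
  Shifting frequencies by \<open>G\<close> instead of the integers replaces the reduction to digit sets whose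
  differences have greatest common divisor 1.\<close>

definition G :: "real set" where
  "G = {g. \<forall>i. \<forall>b\<in>B i. \<forall>b'\<in>B i. real_of_int (b - b') * g \<in> \<int>}"

section \<open>Shifts by common periods\<close>

lemma G_add: "g \<in> G \<Longrightarrow> h \<in> G \<Longrightarrow> g + h \<in> G"
  by (simp add: G_def distrib_left)

lemma G_mult_int: "g \<in> G \<Longrightarrow> real_of_int k * g \<in> G"
  unfolding G_def by (auto simp only: mem_Collect_eq Ints_of_int Ints_mult mult.left_commute[of _ "real_of_int k"])

lemma of_int_in_G: "real_of_int k \<in> G"
  unfolding G_def by (auto simp only: mem_Collect_eq Ints_of_int Ints_mult)

lemma G_uminus: "g \<in> G \<Longrightarrow> - g \<in> G"
  using G_mult_int[of g "-1"] by simp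

lemma G_diff: "g \<in> G \<Longrightarrow> h \<in> G \<Longrightarrow> g - h \<in> G"
  using G_add[of g "- h"] G_uminus by simp

lemma norm_digit_mask_add_G: "g \<in> G \<Longrightarrow> norm (digit_mask (B i) (x + g)) = norm (digit_mask (B i) x)"
  by (rule norm_digit_mask_periodic) (auto simp: G_def)

text \<open>For each mask in the product \<open>D a b\<close> is an integer multiple of its scale
  \<open>D a (Suc i)\<close>, so the mask sees a shift by an integer multiple of \<open>g\<close>,
  again in \<open>G\<close>. Frequencies can thus be moved without disturbing the masks already
  used.\<close>

lemma norm_pr_add_G:
  fixes g x :: real
  assumes "g \<in> G" "a \<le> b"
  shows "norm (pr a b (x + D a b * g)) = norm (pr a b x)"
proof -
  have "norm (digit_mask (B i) ((x + D a b * g) / D a (Suc i))) = norm (digit_mask (B i) (x / D a (Suc i)))"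
    if "i \<in> {a..<b}" for i
  proof -
    have "D a b = D a (Suc i) * D (Suc i) b" using that by (intro D_split) auto
    moreover have "D a (Suc i) \<noteq> 0" using that by (intro D_nonzero) auto
    ultimately have "(x + D a b * g) / D a (Suc i) = x / D a (Suc i) + D (Suc i) b * g"
      by (simp add: field_simps)
    then show ?thesis using norm_digit_mask_add_G[OF G_mult_int[OF assms(1)]] by simp
  qed
  then show ?thesis by (simp add: pr_def flip: prod_norm)
qed

end

section \<open>Common zeros of translates\<close>

locale hadamard_digits = digits +
  assumes had: "\<exists>L. hadamard (M i) (B i) L"
begin

text \<open>The obstruction to moving a frequency off the zeros of the tail: at these points no
  shift in \<open>G\<close> helps.\<close>

definition orbit_zeros :: "nat \<Rightarrow> real set" where
  "orbit_zeros k = {x. \<forall>g\<in>G. \<phi> k (x + g) = 0}"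

definition W :: "nat \<Rightarrow> real set" where
  "W k = orbit_zeros k \<inter> {0..<1}"

text \<open>Multiplication by \<open>M k\<close> on the circle of reals modulo 1, in the coordinate
  [0,1).\<close>

definition \<psi> :: "nat \<Rightarrow> real \<Rightarrow> real" where
  "\<psi> k y = frac (real_of_int (M k) * y)"

lemma M_nonzero: "real_of_int (M k) \<noteq> 0"
  using M_ge[of k] by auto

lemma orbit_zeros_add_G: "x \<in> orbit_zeros k \<Longrightarrow> g \<in> G \<Longrightarrow> x + g \<in> orbit_zeros k"
  unfolding orbit_zeros_def using G_add by (simp add: add.assoc)

lemma frac_in_W:
  assumes "x \<in> orbit_zeros k"
  shows "frac x \<in> W k"
proof -
  have "x + real_of_int (- \<lfloor>x\<rfloor>) \<in> orbit_zeros k" by (rule orbit_zeros_add_G[OF assms of_int_in_G])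
  then show ?thesis by (simp add: W_def frac_def frac_lt_1[unfolded frac_def])
qed

lemma W_finite: "finite (W k)" and W_card: "card (W k) \<le> zero_bound"
proof -
  have "card S \<le> zero_bound" if "S \<subseteq> W k" "finite S" for S
  proof (rule card_zeros_\<phi>[of S k])
    show "0 \<le> x \<and> x < 1 \<and> \<phi> k x = 0" if x: "x \<in> S" for x
    proof -
      have "x \<in> W k" using x \<open>S \<subseteq> W k\<close> by auto
      then show ?thesis using of_int_in_G[of 0] by (force simp: W_def orbit_zeros_def)
    qed
  qed (use that in auto)
  then have "finite (W k) \<and> card (W k) \<le> zero_bound"
    by (rule finite_if_finite_subsets_card_bdd)
  then show "finite (W k)" "card (W k) \<le> zero_bound" by auto
qed

text \<open>All translates of \<open>x\<close> by \<open>l + M k * g\<close> are zeros of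
  \<open>\<phi> k\<close>. The modulus of the mask does not change along the coset, so a mask
  nonzero at one point of it leaves only the factor \<open>\<phi> (Suc k)\<close> to vanish.\<close>

lemma orbit_zeros_preimage:
  assumes "x \<in> orbit_zeros k" "digit_mask (B k) ((x + real_of_int l) / M k) \<noteq> 0"
  shows "(x + real_of_int l) / M k \<in> orbit_zeros (Suc k)"
  unfolding orbit_zeros_def
proof safe
  fix g assume g: "g \<in> G"
  have "real_of_int l + M k * g \<in> G" by (intro G_add G_mult_int g of_int_in_G)
  then have "\<phi> k (x + (real_of_int l + M k * g)) = 0" using assms(1) by (auto simp: orbit_zeros_def)
  moreover have "(x + (real_of_int l + M k * g)) / M k = (x + real_of_int l) / M k + g"
    using M_nonzero[of k] by (simp add: field_simps)
  ultimately have "digit_mask (B k) ((x + real_of_int l) / M k + g) * \<phi> (Suc k) ((x + real_of_int l) / M k + g) = 0"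
    by (simp add: \<phi>_step[of k])
  moreover have "norm (digit_mask (B k) ((x + real_of_int l) / M k + g)) \<noteq> 0"
    using norm_digit_mask_add_G[OF g] assms(2) by simp
  ultimately show "\<phi> (Suc k) ((x + real_of_int l) / M k + g) = 0" by auto
qed

text \<open>The Hadamard identity keeps the mask from vanishing at all preimages
  simultaneously.\<close>

lemma orbit_zeros_preimage_exists:
  assumes "x \<in> orbit_zeros k"
  shows "\<exists>l. (x + real_of_int l) / M k \<in> orbit_zeros (Suc k)"
proof -
  obtain L where L: "hadamard (M k) (B k) L" using had by blast
  then have "(\<Sum>l\<in>L. (norm (digit_mask (B k) ((x + real_of_int l) / M k)))\<^sup>2) \<noteq> 0"
    by (simp add: hadamard_def)
  then obtain l where "(norm (digit_mask (B k) ((x + real_of_int l) / M k)))\<^sup>2 \<noteq> 0"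
    by (rule sum.not_neutral_contains_not_neutral)
  then have "digit_mask (B k) ((x + real_of_int l) / M k) \<noteq> 0" by simp
  then show ?thesis using orbit_zeros_preimage[OF assms] by blast
qed

lemma \<psi>_frac_preimage:
  assumes "x \<in> {0..<1}"
  shows "\<psi> k (frac ((x + real_of_int l) / M k)) = x"
proof -
  define z where "z = (x + real_of_int l) / M k"
  have "M k * frac z - x = real_of_int (l - M k * \<lfloor>z\<rfloor>)"
    using M_nonzero[of k] by (simp add: frac_def right_diff_distrib) (simp add: z_def)
  then have "M k * frac z - x \<in> \<int>" by (simp only: Ints_of_int)
  then show ?thesis using assms by (simp add: \<psi>_def frac_unique_iff z_def)
qed

lemma W_subset_image: "W k \<subseteq> \<psi> k ` W (Suc k)"
proof
  fix x assume x: "x \<in> W k"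
  then obtain l where "(x + real_of_int l) / M k \<in> orbit_zeros (Suc k)"
    using orbit_zeros_preimage_exists by (auto simp: W_def)
  from frac_in_W[OF this] show "x \<in> \<psi> k ` W (Suc k)"
    using \<psi>_frac_preimage[of x k l] x by (force simp: W_def)
qed

lemma card_W_Suc: "card (W k) \<le> card (W (Suc k))"
  using surj_card_le[OF W_finite W_subset_image] .

text \<open>At \<open>x = - l'\<close> two congruent frequencies would contribute two terms equal to
  1 to a sum whose total is 1.\<close>

lemma hadamard_incongruent:
  assumes L: "hadamard (M k) (B k) L" and "l \<in> L" "l' \<in> L" "l \<noteq> l'"
    and "(real_of_int l - real_of_int l') / M k \<in> \<int>"
  shows False
proof -
  obtain j :: int where j: "(real_of_int l - real_of_int l') / M k = real_of_int j"
    using assms(5) by (auto elim: Ints_cases)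
  have "norm (digit_mask (B k) (0 + real_of_int j)) = norm (digit_mask (B k) 0)"
    by (rule norm_digit_mask_add_G[OF of_int_in_G])
  then have 1: "norm (digit_mask (B k) ((- real_of_int l' + real_of_int l) / M k)) = 1"
    using j by (simp add: digit_mask_0 B_fin B_ne)
  have "(\<Sum>i\<in>{l, l'}. (norm (digit_mask (B k) ((- real_of_int l' + real_of_int i) / M k)))\<^sup>2)
      \<le> (\<Sum>i\<in>L. (norm (digit_mask (B k) ((- real_of_int l' + real_of_int i) / M k)))\<^sup>2)"
    using L assms by (intro sum_mono2) (auto simp: hadamard_def)
  also have "\<dots> = 1" using L unfolding hadamard_def by blast
  finally show False using assms(4) 1 by (simp add: digit_mask_0 B_fin B_ne)
qed

text \<open>Multiplication by \<open>M k\<close> modulo 1 maps \<open>W (Suc k)\<close> onto a superset of \<open>W k\<close>. If the two sets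
  have the same size it is injective there, so the Hadamard identity over each point of \<open>W k\<close> has a
  single nonzero term.\<close>

lemma norm_digit_mask_eq_1_on_W:
  assumes "card (W k) = card (W (Suc k))" "y \<in> W (Suc k)"
  shows "norm (digit_mask (B k) y) = 1"
proof -
  have "card (W k) \<le> card (\<psi> k ` W (Suc k))"
    by (rule card_mono[OF finite_imageI[OF W_finite] W_subset_image])
  then have card_eq: "card (\<psi> k ` W (Suc k)) = card (W (Suc k))"
    using card_image_le[OF W_finite, of "\<psi> k" "Suc k"] assms(1) by linarith
  then have inj: "inj_on (\<psi> k) (W (Suc k))" by (rule eq_card_imp_inj_on[OF W_finite])
  have img: "W k = \<psi> k ` W (Suc k)"
    by (rule card_subset_eq[OF finite_imageI[OF W_finite] W_subset_image]) (use card_eq assms in simp)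
  define x where "x = \<psi> k y"
  have x: "x \<in> W k" using assms(2) img by (auto simp: x_def)
  obtain L where L: "hadamard (M k) (B k) L" using had by blast
  have frac_eq: "frac ((x + real_of_int l) / M k) = y"
    if "digit_mask (B k) ((x + real_of_int l) / M k) \<noteq> 0" for l
  proof -
    have "frac ((x + real_of_int l) / M k) \<in> W (Suc k)"
      using x that by (intro frac_in_W orbit_zeros_preimage) (auto simp: W_def)
    moreover have "\<psi> k (frac ((x + real_of_int l) / M k)) = \<psi> k y"
      using \<psi>_frac_preimage[of x k l] x by (simp add: W_def x_def)
    ultimately show ?thesis using inj assms(2) by (auto dest: inj_onD)
  qed
  have sum1: "(\<Sum>l\<in>L. (norm (digit_mask (B k) ((x + real_of_int l) / M k)))\<^sup>2) = 1"
    using L by (simp add: hadamard_def)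
  obtain l0 where l0: "l0 \<in> L" "digit_mask (B k) ((x + real_of_int l0) / M k) \<noteq> 0"
  proof (rule ccontr)
    assume "\<not> thesis"
    then have "(\<Sum>l\<in>L. (norm (digit_mask (B k) ((x + real_of_int l) / M k)))\<^sup>2) = 0"
      using that by (intro sum.neutral) auto
    with sum1 show False by simp
  qed
  \<comment> \<open>Two nonzero terms would have the same fractional part \<open>y\<close>, making
    \<open>l\<close> and \<open>l0\<close> congruent modulo \<open>M k\<close>.\<close>
  have "digit_mask (B k) ((x + real_of_int l) / M k) = 0" if l: "l \<in> L" "l \<noteq> l0" for l
  proof (rule ccontr)
    assume "digit_mask (B k) ((x + real_of_int l) / M k) \<noteq> 0"
    then have "frac ((x + real_of_int l) / M k) = frac ((x + real_of_int l0) / M k)"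
      using frac_eq l0 by simp
    then have "(x + real_of_int l) / M k - (x + real_of_int l0) / M k
        = real_of_int (\<lfloor>(x + real_of_int l) / M k\<rfloor> - \<lfloor>(x + real_of_int l0) / M k\<rfloor>)"
      by (simp add: frac_def)
    then have "(real_of_int l - real_of_int l0) / M k
        = real_of_int (\<lfloor>(x + real_of_int l) / M k\<rfloor> - \<lfloor>(x + real_of_int l0) / M k\<rfloor>)"
      by (simp add: add_divide_distrib diff_divide_distrib)
    then have "(real_of_int l - real_of_int l0) / M k \<in> \<int>" by (simp only: Ints_of_int)
    then show False using hadamard_incongruent[OF L l(1) l0(1) l(2)] by blast
  qed
  then have "(\<Sum>l\<in>L. (norm (digit_mask (B k) ((x + real_of_int l) / M k)))\<^sup>2)
      = (\<Sum>l\<in>{l0}. (norm (digit_mask (B k) ((x + real_of_int l) / M k)))\<^sup>2)"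
    using L l0 by (intro sum.mono_neutral_right) (auto simp: hadamard_def)
  then have "norm (digit_mask (B k) ((x + real_of_int l0) / M k)) = 1"
    using sum1 norm_ge_zero[of "digit_mask (B k) ((x + real_of_int l0) / M k)"]
    by (auto simp: power2_eq_1_iff)
  moreover have "(x + real_of_int l0) / M k = y + real_of_int \<lfloor>(x + real_of_int l0) / M k\<rfloor>"
    using frac_eq[OF l0(2)] by (simp add: frac_def)
  ultimately show ?thesis using norm_digit_mask_add_G[OF of_int_in_G] by metis
qed

lemma card_W_stabilizes: "\<exists>K. \<forall>k\<ge>K. card (W k) = card (W (Suc k))"
proof -
  have fin: "finite (range (\<lambda>k. card (W k)))"
    by (rule finite_subset[of _ "{..zero_bound}"]) (auto simp: W_card)
  then have "Max (range (\<lambda>k. card (W k))) \<in> range (\<lambda>k. card (W k))" by (intro Max_in) auto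
  then obtain K where K: "card (W K) = Max (range (\<lambda>k. card (W k)))" by auto
  have "card (W k) = card (W K)" if "k \<ge> K" for k
  proof (rule antisym)
    show "card (W k) \<le> card (W K)" using fin by (simp add: K)
    show "card (W K) \<le> card (W k)" by (rule lift_Suc_mono_le[where f = "\<lambda>k. card (W k)", OF card_W_Suc that])
  qed
  then show ?thesis by (metis le_SucI)
qed

lemma exists_nonzero_shift:
  assumes rec: "\<And>i k. \<exists>i'\<ge>k. B i' = B i"
  shows "\<exists>g\<in>G. \<phi> 0 (x + g) \<noteq> 0"
proof -
  obtain K where K: "\<And>k. k \<ge> K \<Longrightarrow> card (W k) = card (W (Suc k))"
    using card_W_stabilizes by blast
  have base: "real_of_int (b - b') * y \<in> \<int>"
    if "k \<ge> K" "y \<in> orbit_zeros (Suc k)" "b \<in> B k" "b' \<in> B k" for k y b b'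
  proof (rule norm_digit_mask_eq_1_imp_Ints[OF _ that(3,4)])
    have "norm (digit_mask (B k) (frac y)) = 1"
      by (rule norm_digit_mask_eq_1_on_W[OF K[OF that(1)] frac_in_W[OF that(2)]])
    moreover have "y = frac y + real_of_int \<lfloor>y\<rfloor>" by (simp add: frac_def)
    ultimately show "norm (digit_mask (B k) y) = 1" using norm_digit_mask_add_G[OF of_int_in_G] by metis
  qed
  \<comment> \<open>A point is pushed to the next level as \<open>(y + l) / M (Suc k)\<close>, and
    integrality is pulled back by multiplying with \<open>M (Suc k)\<close>: the extra summand
    \<open>(b - b') * l\<close> is an integer. So one point inherits the conditions of every later
    digit set.\<close>
  have later: "\<forall>y\<in>orbit_zeros (Suc k). \<forall>b\<in>B (k + d). \<forall>b'\<in>B (k + d). real_of_int (b - b') * y \<in> \<int>"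
    if "k \<ge> K" for k d
    using that
  proof (induction d arbitrary: k)
    case 0
    then show ?case using base by simp
  next
    case (Suc d)
    show ?case
    proof safe
      fix y b b' assume y: "y \<in> orbit_zeros (Suc k)" and b: "b \<in> B (k + Suc d)" "b' \<in> B (k + Suc d)"
      obtain l where "(y + real_of_int l) / M (Suc k) \<in> orbit_zeros (Suc (Suc k))"
        using orbit_zeros_preimage_exists[OF y] by blast
      then have "real_of_int (b - b') * ((y + real_of_int l) / M (Suc k)) \<in> \<int>"
        using Suc.IH[of "Suc k"] Suc.prems b by auto
      then have "real_of_int (M (Suc k)) * (real_of_int (b - b') * ((y + real_of_int l) / M (Suc k)))
          - real_of_int ((b - b') * l) \<in> \<int>"
        by (rule Ints_diff[OF Ints_mult[OF Ints_of_int] Ints_of_int])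
      moreover have "real_of_int (M (Suc k)) * (real_of_int (b - b') * ((y + real_of_int l) / M (Suc k)))
          - real_of_int ((b - b') * l) = real_of_int (b - b') * y"
        using M_nonzero[of "Suc k"] by (simp add: field_simps)
      ultimately show "real_of_int (b - b') * y \<in> \<int>" by (simp only:)
    qed
  qed
  have "orbit_zeros (Suc K) = {}"
  proof (rule ccontr)
    assume "orbit_zeros (Suc K) \<noteq> {}"
    then obtain y where y: "y \<in> orbit_zeros (Suc K)" by auto
    have "y \<in> G" unfolding G_def
    proof safe
      fix i b b' assume b: "b \<in> B i" "b' \<in> B i"
      obtain i' where i': "i' \<ge> K" "B i' = B i" using rec by blast
      then have "B (K + (i' - K)) = B i" by simp
      then show "real_of_int (b - b') * y \<in> \<int>" using later[of K "i' - K"] y b by blast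
    qed
    then have "\<phi> (Suc K) (y + - y) = 0" using y G_uminus unfolding orbit_zeros_def by blast
    then show False by simp
  qed
  then have "card (W (Suc K)) = 0" by (simp add: W_def)
  \<comment> \<open>The sizes do not decrease with the level, so emptiness at \<open>Suc K\<close>
    descends to level 0.\<close>
  moreover have "card (W 0) \<le> card (W (Suc K))" by (rule lift_Suc_mono_le[where f = "\<lambda>k. card (W k)", OF card_W_Suc]) auto
  ultimately have "W 0 = {}" using W_finite by simp
  then have "x \<notin> orbit_zeros 0" using frac_in_W by blast
  then show ?thesis by (auto simp: orbit_zeros_def)
qed

text \<open>Besides a uniform lower bound, the shifts themselves must be bounded, because the error
  of truncating the product grows with \<open>\<bar>x + g\<bar>\<close>. A sequence of
  counterexamples with shifts up to \<open>n\<close> and bound \<open>1 / (n + 1)\<close>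
  accumulates at a point where every shift fails.\<close>

lemma exists_uniform_nonzero_shift:
  assumes rec: "\<And>i k. \<exists>i'\<ge>k. B i' = B i"
  shows "\<exists>e>0. \<exists>R. \<forall>x\<in>{0..1}. \<exists>g\<in>G. \<bar>g\<bar> \<le> R \<and> norm (\<phi> 0 (x + g)) \<ge> e"
proof (rule ccontr)
  assume neg: "\<not> ?thesis"
  have "\<exists>x\<in>{0..1}. \<forall>g\<in>G. \<bar>g\<bar> \<le> real n \<longrightarrow> norm (\<phi> 0 (x + g)) < inverse (Suc n)" for n
    using neg by (meson inverse_positive_iff_positive not_le of_nat_0_less_iff zero_less_Suc)
  then obtain x where x: "\<And>n. x n \<in> {0..1}"
    "\<And>n g. g \<in> G \<Longrightarrow> \<bar>g\<bar> \<le> real n \<Longrightarrow> norm (\<phi> 0 (x n + g)) < inverse (Suc n)"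
    by metis
  have "compact {0..1::real}" by simp
  then obtain l r where lr: "strict_mono r" "(x \<circ> r) \<longlonglongrightarrow> l"
    using x(1) unfolding compact_def by (metis (no_types, lifting))
  obtain g where g: "g \<in> G" "\<phi> 0 (l + g) \<noteq> 0" using exists_nonzero_shift[OF rec] by blast
  have cont: "isCont (\<phi> 0) t" for t
  proof -
    have "(\<lambda>s. norm (\<phi> 0 s - \<phi> 0 t)) \<midarrow>t\<rightarrow> 0"
    proof (rule tendsto_sandwich[OF _ _ tendsto_const])
      have "(\<lambda>s. 2 * pi * C * \<bar>s - t\<bar>) \<midarrow>t\<rightarrow> 2 * pi * C * \<bar>t - t\<bar>" by (intro tendsto_intros)
      then show "(\<lambda>s. 2 * pi * C * \<bar>s - t\<bar>) \<midarrow>t\<rightarrow> 0" by simp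
    qed (auto simp: \<phi>_lipschitz intro!: always_eventually)
    then show ?thesis unfolding isCont_def by (simp only: tendsto_norm_zero_iff LIM_zero_iff)
  qed
  have "(\<lambda>n. x (r n) + g) \<longlonglongrightarrow> l + g" using lr(2) by (intro tendsto_intros) (simp add: o_def)
  then have lim: "(\<lambda>n. norm (\<phi> 0 (x (r n) + g))) \<longlonglongrightarrow> norm (\<phi> 0 (l + g))"
    by (intro tendsto_norm isCont_tendsto_compose[OF cont])
  have "(\<lambda>n. norm (\<phi> 0 (x (r n) + g))) \<longlonglongrightarrow> 0"
  proof (rule tendsto_sandwich[OF _ _ tendsto_const])
    show "(\<lambda>n. inverse (real (Suc n))) \<longlonglongrightarrow> 0" by (rule LIMSEQ_inverse_real_of_nat)
    show "\<forall>\<^sub>F n in sequentially. norm (\<phi> 0 (x (r n) + g)) \<le> inverse (real (Suc n))"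
      using eventually_ge_at_top[of "nat \<lceil>\<bar>g\<bar>\<rceil>"]
    proof eventually_elim
      case (elim n)
      have rn: "r n \<ge> n" using lr(1) by (rule seq_suble)
      have "norm (\<phi> 0 (x (r n) + g)) < inverse (Suc (r n))"
        using elim rn by (intro x(2) g(1)) linarith
      also have "\<dots> \<le> inverse (real (Suc n))" using rn by (intro le_imp_inverse_le) auto
      finally show ?case by simp
    qed
  qed auto
  then show False using LIMSEQ_unique[OF lim, of 0] g by auto
qed

end

section \<open>Construction of the spectrum\<close>

text \<open>If \<open>f i = f j\<close>, evaluation at \<open>x = - f i\<close> produces two terms
  equal to 1. This lets a sum over indices be read as a sum over the set of frequencies.\<close>

lemma inj_on_of_sum_translates:
  fixes F :: "real \<Rightarrow> complex" and f :: "'a \<Rightarrow> real"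
  assumes "finite I" "F 0 = 1" and sum1: "\<And>x. (\<Sum>i\<in>I. (norm (F (x + f i)))\<^sup>2) = 1"
  shows "inj_on f I"
proof (rule inj_onI, rule ccontr)
  fix i j assume ij: "i \<in> I" "j \<in> I" "f i = f j" "i \<noteq> j"
  have "(\<Sum>k\<in>{i, j}. (norm (F (- f i + f k)))\<^sup>2) \<le> (\<Sum>k\<in>I. (norm (F (- f i + f k)))\<^sup>2)"
    using assms(1) ij by (intro sum_mono2) auto
  then show False using ij sum1[of "- f i"] assms(2) by simp
qed

context hadamard_digits
begin

text \<open>For a \<open>k\<close>-good set, orthonormality of the exponentials in \<open>L\<^sup>2\<close> of the \<open>k\<close>-th partial convolution
  is implied: take \<open>x\<close> to be the negative of a frequency.\<close>

definition good :: "nat \<Rightarrow> real set \<Rightarrow> bool" where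
  "good k \<Lambda> \<longleftrightarrow> finite \<Lambda> \<and> (\<forall>x. (\<Sum>\<xi>\<in>\<Lambda>. (norm (pr 0 k (x + \<xi>)))\<^sup>2) = 1)"

lemma good_0: "good 0 {0}"
  by (simp add: good_def)

lemma good_image:
  assumes "finite I" "\<And>x. (\<Sum>i\<in>I. (norm (pr 0 k (x + f i)))\<^sup>2) = 1"
  shows "good k (f ` I)"
  using assms inj_on_of_sum_translates[OF assms(1) pr_0 assms(2)]
  by (simp add: good_def sum.reindex)

text \<open>The new frequencies are \<open>\<xi> + D 0 k * l\<close>. The summand
  \<open>D 0 k * l\<close> is invisible to the moduli of the first \<open>k\<close> masks, so
  summing over \<open>l\<close> first gives the Hadamard identity, and then goodness of \<Lambda>
  remains. The choice \<open>l = 0\<close> keeps the old frequencies.\<close>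

lemma good_Suc:
  assumes "good k \<Lambda>"
  shows "\<exists>\<Lambda>'. \<Lambda> \<subseteq> \<Lambda>' \<and> good (Suc k) \<Lambda>'"
proof -
  obtain L where L: "hadamard (M k) (B k) L" using had by blast
  define f where "f p = fst p + D 0 k * real_of_int (snd p)" for p :: "real \<times> int"
  have fin: "finite \<Lambda>" "finite L" using assms L by (auto simp: good_def hadamard_def)
  have "(\<Sum>p\<in>\<Lambda> \<times> L. (norm (pr 0 (Suc k) (x + f p)))\<^sup>2) = 1" for x
  proof -
    have eq: "(norm (pr 0 (Suc k) (x + f (\<xi>, l))))\<^sup>2
        = (norm (pr 0 k (x + \<xi>)))\<^sup>2 * (norm (digit_mask (B k) (((x + \<xi>) / D 0 k + real_of_int l) / M k)))\<^sup>2"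
      for \<xi> l
    proof -
      have "(x + f (\<xi>, l)) / D 0 (Suc k) = ((x + \<xi>) / D 0 k + real_of_int l) / M k"
        using D_nonzero[of 0 k] M_nonzero[of k] by (simp add: f_def D_Suc field_simps)
      moreover have "norm (pr 0 k (x + f (\<xi>, l))) = norm (pr 0 k (x + \<xi>))"
        using norm_pr_add_G[OF of_int_in_G[of l], where a = 0 and b = k and x = "x + \<xi>"] by (simp add: f_def add.assoc)
      ultimately show ?thesis by (simp add: pr_Suc norm_mult power_mult_distrib)
    qed
    have "(\<Sum>p\<in>\<Lambda> \<times> L. (norm (pr 0 (Suc k) (x + f p)))\<^sup>2)
        = (\<Sum>\<xi>\<in>\<Lambda>. \<Sum>l\<in>L. (norm (pr 0 (Suc k) (x + f (\<xi>, l))))\<^sup>2)"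
      by (simp add: sum.cartesian_product)
    also have "\<dots> = (\<Sum>\<xi>\<in>\<Lambda>. (norm (pr 0 k (x + \<xi>)))\<^sup>2 *
        (\<Sum>l\<in>L. (norm (digit_mask (B k) (((x + \<xi>) / D 0 k + real_of_int l) / M k)))\<^sup>2))"
      by (simp only: eq sum_distrib_left)
    also have "\<dots> = (\<Sum>\<xi>\<in>\<Lambda>. (norm (pr 0 k (x + \<xi>)))\<^sup>2 * 1)"
      using L unfolding hadamard_def by metis
    also have "\<dots> = 1" using assms by (simp add: good_def)
    finally show ?thesis .
  qed
  then have "good (Suc k) (f ` (\<Lambda> \<times> L))" using fin by (intro good_image) auto
  moreover have "\<Lambda> \<subseteq> f ` (\<Lambda> \<times> L)"
  proof
    fix \<xi> assume "\<xi> \<in> \<Lambda>"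
    then show "\<xi> \<in> f ` (\<Lambda> \<times> L)"
      using L by (intro image_eqI[of _ _ "(\<xi>, 0)"]) (auto simp: f_def hadamard_def)
  qed
  ultimately show ?thesis by blast
qed

lemma good_mono:
  assumes "k \<le> k'" "good k \<Lambda>"
  shows "\<exists>\<Lambda>'. \<Lambda> \<subseteq> \<Lambda>' \<and> good k' \<Lambda>'"
  using assms(1)
proof (induction k' rule: dec_induct)
  case base
  then show ?case using assms(2) by blast
next
  case (step k')
  then show ?case using good_Suc by (meson order_trans)
qed

section \<open>Nested spectra along nonvanishing tails\<close>

definition nonvanishing :: "real \<Rightarrow> nat \<Rightarrow> bool" where
  "nonvanishing e k \<longleftrightarrow> (\<forall>x. \<exists>g\<in>G. norm (\<phi> k (x + g)) \<ge> e)"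

text \<open>Old frequencies are left in place: \<open>small\<close> puts their tail argument so near
  0 that the tail is at least 1/2 there, which is where \<open>e \<le> 1 / 2\<close> comes from.
  Only the others are moved, by \<open>D 0 k' * s\<close>, to a place where the tail is at least
  \<open>e\<close>.\<close>

lemma good_extend:
  assumes "nonvanishing e k'" "e \<le> 1 / 2" "good k \<Lambda>" "k \<le> k'"
    and small: "\<And>\<xi>. \<xi> \<in> \<Lambda> \<Longrightarrow> 2 * pi * C * \<bar>\<xi> / D 0 k'\<bar> \<le> 1 / 2"
  shows "\<exists>\<Lambda>'. \<Lambda> \<subseteq> \<Lambda>' \<and> good k' \<Lambda>' \<and> (\<forall>\<xi>\<in>\<Lambda>'. norm (\<phi> k' (\<xi> / D 0 k')) \<ge> e)"
proof -
  obtain \<Lambda>1 where \<Lambda>1: "\<Lambda> \<subseteq> \<Lambda>1" "good k' \<Lambda>1" using good_mono assms by blast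
  obtain s where s: "\<And>x. s x \<in> G" "\<And>x. norm (\<phi> k' (x + s x)) \<ge> e"
    using assms(1) unfolding nonvanishing_def by metis
  define f where "f \<xi> = (if \<xi> \<in> \<Lambda> then \<xi> else \<xi> + D 0 k' * s (\<xi> / D 0 k'))" for \<xi>
  have f_pr: "norm (pr 0 k' (x + f \<xi>)) = norm (pr 0 k' (x + \<xi>))" for x \<xi>
    using norm_pr_add_G[OF s(1), where a = 0 and b = k' and x = "x + \<xi>"] by (simp add: f_def add.assoc)
  have "good k' (f ` \<Lambda>1)"
    using \<Lambda>1 by (intro good_image) (auto simp: good_def f_pr)
  moreover have "\<Lambda> \<subseteq> f ` \<Lambda>1"
  proof
    fix \<xi> assume "\<xi> \<in> \<Lambda>"
    then show "\<xi> \<in> f ` \<Lambda>1" using \<Lambda>1 by (intro image_eqI[of _ _ \<xi>]) (auto simp: f_def)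
  qed
  moreover have "norm (\<phi> k' (f \<xi> / D 0 k')) \<ge> e" for \<xi>
  proof (cases "\<xi> \<in> \<Lambda>")
    case True
    then show ?thesis
      using \<phi>_near_0[where a = k' and x = "\<xi> / D 0 k'"] small[OF True] assms(2) by (simp add: f_def)
  next
    case False
    have "f \<xi> / D 0 k' = \<xi> / D 0 k' + s (\<xi> / D 0 k')"
      using False D_nonzero[of 0 k'] by (simp add: f_def field_simps)
    then show ?thesis using s(2) by simp
  qed
  ultimately show ?thesis by blast
qed

lemma exists_small_div_D:
  "\<exists>k0. \<forall>k\<ge>k0. \<forall>x. \<bar>x\<bar> \<le> R \<longrightarrow> 2 * pi * C * \<bar>x / D 0 k\<bar> \<le> e" if "e > 0"
proof (intro exI allI impI)
  fix k x assume k: "k \<ge> nat \<lceil>2 * pi * C * \<bar>R\<bar> / e\<rceil>" and x: "\<bar>x\<bar> \<le> R"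
  have "2 * pi * C * \<bar>R\<bar> / e \<le> k" using k by linarith
  also have "\<dots> \<le> 2 ^ k" using of_nat_less_two_power[of k, where 'a = real] by linarith
  finally have "2 * pi * C * (\<bar>R\<bar> / 2 ^ k) \<le> e" using that by (simp add: field_simps)
  moreover have "2 * pi * C * \<bar>x / D 0 k\<bar> \<le> 2 * pi * C * (\<bar>R\<bar> / 2 ^ k)"
  proof (rule mult_left_mono)
    have "\<bar>x / D 0 k\<bar> \<le> \<bar>x\<bar> / 2 ^ k" using abs_div_D_le[of 0 k x] by simp
    also have "\<dots> \<le> \<bar>R\<bar> / 2 ^ k" using x by (intro divide_right_mono) auto
    finally show "\<bar>x / D 0 k\<bar> \<le> \<bar>R\<bar> / 2 ^ k" .
  qed (use C_nonneg in auto)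
  ultimately show "2 * pi * C * \<bar>x / D 0 k\<bar> \<le> e" by linarith
qed

lemma good_chain:
  assumes "0 < e" "e \<le> 1 / 2" and inf: "\<And>k0. \<exists>k\<ge>k0. nonvanishing e k"
  obtains k \<Lambda> where "strict_mono k" "\<And>j. good (k j) (\<Lambda> j)" "\<And>j. \<Lambda> j \<subseteq> \<Lambda> (Suc j)"
    "\<And>j \<xi>. \<xi> \<in> \<Lambda> j \<Longrightarrow> norm (\<phi> (k j) (\<xi> / D 0 (k j))) \<ge> e"
proof -
  define P where "P p \<longleftrightarrow> good (fst p) (snd p) \<and> (\<forall>\<xi>\<in>snd p. norm (\<phi> (fst p) (\<xi> / D 0 (fst p))) \<ge> e)"
    for p :: "nat \<times> real set"
  have ext: "\<exists>k' \<Lambda>'. k < k' \<and> \<Lambda> \<subseteq> \<Lambda>' \<and> P (k', \<Lambda>')" if gd: "good k \<Lambda>" for k \<Lambda>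
  proof -
    have "finite (abs ` \<Lambda>)" using gd by (simp add: good_def)
    then obtain R where R: "\<And>\<xi>. \<xi> \<in> \<Lambda> \<Longrightarrow> \<bar>\<xi>\<bar> \<le> R"
      using bdd_above_finite[of "abs ` \<Lambda>"] by (auto simp: bdd_above_def)
    obtain k0 where k0: "\<And>k x. k \<ge> k0 \<Longrightarrow> \<bar>x\<bar> \<le> R \<Longrightarrow> 2 * pi * C * \<bar>x / D 0 k\<bar> \<le> 1 / 2"
      using exists_small_div_D[of "1 / 2" R] by auto
    \<comment> \<open>\<open>k0\<close> makes the old frequencies small at the new scale;
      \<open>Suc k\<close> forces strict growth.\<close>
    obtain k' where k': "k' \<ge> max k0 (Suc k)" "nonvanishing e k'" using inf by blast
    have "k \<le> k'" using k' by auto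
    then obtain \<Lambda>' where "\<Lambda> \<subseteq> \<Lambda>' \<and> good k' \<Lambda>' \<and> (\<forall>\<xi>\<in>\<Lambda>'. norm (\<phi> k' (\<xi> / D 0 k')) \<ge> e)"
      using good_extend[OF k'(2) assms(2) gd] k0 R k'(1) by fastforce
    then show ?thesis using k'(1) by (intro exI[of _ k'] exI[of _ \<Lambda>']) (auto simp: P_def)
  qed
  have "\<exists>f. \<forall>n. P (f n) \<and> fst (f n) < fst (f (Suc n)) \<and> snd (f n) \<subseteq> snd (f (Suc n))"
  proof (rule dependent_nat_choice[where P = "\<lambda>_. P"
        and Q = "\<lambda>_ p q. fst p < fst q \<and> snd p \<subseteq> snd q"])
    show "\<exists>p. P p" using ext[OF good_0] by blast
    fix p n assume "P p"
    then have "good (fst p) (snd p)" by (simp add: P_def)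
    from ext[OF this] show "\<exists>q. P q \<and> fst p < fst q \<and> snd p \<subseteq> snd q" by fastforce
  qed
  then obtain f where f: "\<And>n. P (f n)" "\<And>n. fst (f n) < fst (f (Suc n))"
    "\<And>n. snd (f n) \<subseteq> snd (f (Suc n))" by blast
  show ?thesis
    by (rule that[of "fst \<circ> f" "snd \<circ> f"]) (use f in \<open>auto simp: strict_mono_Suc_iff P_def\<close>)
qed

text \<open>The two clauses are Bessel's inequality and completeness. For completeness, the tail
  bound \<open>e / 2\<close> dominates the mass \<open>a j\<close> of the partial convolution by a
  constant times the mass \<open>b\<close> of the limit. The sums of \<open>b\<close> converge, so
  frequencies outside a fixed \<Lambda> \<open>i\<close> carry little of the total mass 1 of
  \<open>a j\<close>.\<close>

lemma exists_spectrum_\<phi>: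
  assumes "0 < e" "e \<le> 1 / 2" and inf: "\<And>k0. \<exists>k\<ge>k0. nonvanishing e k"
  shows "\<exists>\<Lambda>. \<forall>x. (\<forall>F. finite F \<and> F \<subseteq> \<Lambda> \<longrightarrow> (\<Sum>\<xi>\<in>F. (norm (\<phi> 0 (x + \<xi>)))\<^sup>2) \<le> 1) \<and>
      (\<forall>\<eta>>0. \<exists>F. finite F \<and> F \<subseteq> \<Lambda> \<and> (\<Sum>\<xi>\<in>F. (norm (\<phi> 0 (x + \<xi>)))\<^sup>2) > 1 - \<eta>)"
proof -
  obtain k \<Lambda> where mono: "strict_mono k" and good: "\<And>j. good (k j) (\<Lambda> j)"
    and sub: "\<And>j. \<Lambda> j \<subseteq> \<Lambda> (Suc j)"
    and big: "\<And>j \<xi>. \<xi> \<in> \<Lambda> j \<Longrightarrow> norm (\<phi> (k j) (\<xi> / D 0 (k j))) \<ge> e"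
    using good_chain[OF assms] by blast
  have sub': "\<Lambda> i \<subseteq> \<Lambda> j" if "i \<le> j" for i j
    by (rule lift_Suc_mono_le[where f = \<Lambda>, OF sub that])
  have fin: "finite (\<Lambda> j)" for j using good by (simp add: good_def)
  have tot: "(\<Sum>\<xi>\<in>\<Lambda> j. (norm (pr 0 (k j) (x + \<xi>)))\<^sup>2) = 1" for j x
    using good by (simp add: good_def)
  define b where "b x \<xi> = (norm (\<phi> 0 (x + \<xi>)))\<^sup>2" for x \<xi>
  define a where "a j x \<xi> = (norm (pr 0 (k j) (x + \<xi>)))\<^sup>2" for j x \<xi>
  have b_le_a: "b x \<xi> \<le> a j x \<xi>" for j x \<xi>
  proof -
    have "norm (\<phi> 0 (x + \<xi>)) \<le> norm (pr 0 (k j) (x + \<xi>)) * 1"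
      unfolding \<phi>_split[of 0 "k j" "x + \<xi>", simplified] norm_mult
      by (intro mult_left_mono norm_\<phi>_le_1) auto
    then show ?thesis by (simp add: a_def b_def power_mono)
  qed
  have bessel: "(\<Sum>\<xi>\<in>F. b x \<xi>) \<le> 1" if F: "finite F" "F \<subseteq> (\<Union>j. \<Lambda> j)" for F x
  proof -
    have "\<exists>j. F \<subseteq> \<Lambda> j"
      using F
    proof (induction F rule: finite_induct)
      case (insert y F)
      then obtain i j where "F \<subseteq> \<Lambda> i" "y \<in> \<Lambda> j" by auto
      then show ?case using sub'[of i "max i j"] sub'[of j "max i j"]
        by (intro exI[of _ "max i j"]) auto
    qed auto
    then obtain j where j: "F \<subseteq> \<Lambda> j" by auto
    have "(\<Sum>\<xi>\<in>F. b x \<xi>) \<le> (\<Sum>\<xi>\<in>\<Lambda> j. b x \<xi>)"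
      by (rule sum_mono2[OF fin j]) (auto simp: b_def)
    also have "\<dots> \<le> (\<Sum>\<xi>\<in>\<Lambda> j. a j x \<xi>)" by (rule sum_mono[OF b_le_a])
    also have "\<dots> = 1" using tot by (simp add: a_def)
    finally show ?thesis .
  qed
  have complete: "\<exists>i. (\<Sum>\<xi>\<in>\<Lambda> i. b x \<xi>) > 1 - \<eta>" if "\<eta> > 0" for x \<eta>
  proof -
    \<comment> \<open>Passing from \<xi> to \<open>x + \<xi>\<close> moves the tail argument by
      \<open>x / D 0 k\<close>; from \<open>k0\<close> on this costs at most half of the bound
      \<open>e\<close>.\<close>
    obtain k0 where k0: "\<And>k y. k \<ge> k0 \<Longrightarrow> \<bar>y\<bar> \<le> \<bar>x\<bar> \<Longrightarrow> 2 * pi * C * \<bar>y / D 0 k\<bar> \<le> e / 2"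
      using exists_small_div_D[of "e / 2" "\<bar>x\<bar>"] assms(1) by auto
    have a_le_b: "(e / 2)\<^sup>2 * a j x \<xi> \<le> b x \<xi>" if "j \<ge> k0" "\<xi> \<in> \<Lambda> j" for j \<xi>
    proof -
      have "k j \<ge> k0" using seq_suble[OF mono, of j] that by simp
      then have "2 * pi * C * \<bar>x / D 0 (k j)\<bar> \<le> e / 2" by (rule k0) simp
      moreover have "norm (\<phi> (k j) ((x + \<xi>) / D 0 (k j)) - \<phi> (k j) (\<xi> / D 0 (k j)))
          \<le> 2 * pi * C * \<bar>(x + \<xi>) / D 0 (k j) - \<xi> / D 0 (k j)\<bar>" by (rule \<phi>_lipschitz)
      moreover have "(x + \<xi>) / D 0 (k j) - \<xi> / D 0 (k j) = x / D 0 (k j)"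
        by (simp add: add_divide_distrib)
      ultimately have "norm (\<phi> (k j) ((x + \<xi>) / D 0 (k j)) - \<phi> (k j) (\<xi> / D 0 (k j))) \<le> e / 2"
        by (simp only:)
      then have "norm (\<phi> (k j) ((x + \<xi>) / D 0 (k j))) \<ge> e / 2"
        using big[OF that(2)] norm_triangle_ineq3[of "\<phi> (k j) ((x + \<xi>) / D 0 (k j))" "\<phi> (k j) (\<xi> / D 0 (k j))"]
        by linarith
      then have "norm (pr 0 (k j) (x + \<xi>)) * (e / 2) \<le> norm (pr 0 (k j) (x + \<xi>)) * norm (\<phi> (k j) ((x + \<xi>) / D 0 (k j)))"
        by (intro mult_left_mono) auto
      also have "\<dots> = norm (\<phi> 0 (x + \<xi>))"
        using \<phi>_split[of 0 "k j" "x + \<xi>"] by (simp add: norm_mult)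
      finally have "(norm (pr 0 (k j) (x + \<xi>)) * (e / 2))\<^sup>2 \<le> (norm (\<phi> 0 (x + \<xi>)))\<^sup>2"
        using assms(1) by (intro power_mono) auto
      then show ?thesis by (simp only: a_def b_def power_mult_distrib mult.commute)
    qed
    define s where "s j = (\<Sum>\<xi>\<in>\<Lambda> j. b x \<xi>)" for j
    have "incseq s" unfolding s_def
      by (intro incseq_SucI sum_mono2[OF fin sub]) (auto simp: b_def)
    moreover have "s j \<le> 1" for j unfolding s_def by (rule bessel[OF fin]) auto
    ultimately obtain l where l: "s \<longlonglongrightarrow> l" "\<forall>i. s i \<le> l"
      using incseq_convergent[of s 1] by blast
    \<comment> \<open>The factor cancels the constant of \<open>a_le_b\<close>, leaving a loss of
      \<open>\<eta> / 2\<close>.\<close>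
    define \<eta>' where "\<eta>' = (e / 2)\<^sup>2 * (\<eta> / 2)"
    have "\<eta>' > 0" using that assms(1) by (simp add: \<eta>'_def)
    then have "\<forall>\<^sub>F i in sequentially. s i > l - \<eta>'"
      using l(1) by (intro order_tendstoD(1)) auto
    then obtain i where i: "s i > l - \<eta>'" by (auto simp: eventually_sequentially)
    have a_ge: "(\<Sum>\<xi>\<in>\<Lambda> i. a j x \<xi>) \<ge> 1 - \<eta> / 2" if j: "j \<ge> max i k0" for j
    proof -
      have split: "(\<Sum>\<xi>\<in>\<Lambda> j. h \<xi>) = (\<Sum>\<xi>\<in>\<Lambda> i. h \<xi>) + (\<Sum>\<xi>\<in>\<Lambda> j - \<Lambda> i. h \<xi>)" for h :: "real \<Rightarrow> real"
        using sum.subset_diff[OF sub'[of i j] fin, of h] j by simp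
      have "(e / 2)\<^sup>2 * (\<Sum>\<xi>\<in>\<Lambda> j - \<Lambda> i. a j x \<xi>) \<le> (\<Sum>\<xi>\<in>\<Lambda> j - \<Lambda> i. b x \<xi>)"
        unfolding sum_distrib_left using j by (intro sum_mono a_le_b) auto
      also have "\<dots> = s j - s i" using split[of "b x"] by (simp add: s_def)
      also have "\<dots> \<le> (e / 2)\<^sup>2 * (\<eta> / 2)" using i l(2)[rule_format, of j] by (simp add: \<eta>'_def)
      finally have "(\<Sum>\<xi>\<in>\<Lambda> j - \<Lambda> i. a j x \<xi>) \<le> \<eta> / 2"
        using assms(1) by (simp only: mult_le_cancel_left_pos zero_less_power half_gt_zero)
      then show ?thesis using split[of "a j x"] tot[of j x] by (simp add: a_def)
    qed
    \<comment> \<open>With \<open>i\<close> fixed the sum is finite, so \<open>j\<close> tends to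
      infinity term by term. The loss \<open>\<eta> / 2\<close> survives and is strictly below
      \<eta>.\<close>
    have "(\<lambda>j. \<Sum>\<xi>\<in>\<Lambda> i. a j x \<xi>) \<longlonglongrightarrow> (\<Sum>\<xi>\<in>\<Lambda> i. b x \<xi>)"
      unfolding a_def b_def
    proof (intro tendsto_intros)
      fix \<xi>
      show "(\<lambda>j. pr 0 (k j) (x + \<xi>)) \<longlonglongrightarrow> \<phi> 0 (x + \<xi>)"
        using LIMSEQ_subseq_LIMSEQ[OF pr_tendsto mono] by (simp add: o_def)
    qed
    then have "1 - \<eta> / 2 \<le> (\<Sum>\<xi>\<in>\<Lambda> i. b x \<xi>)"
      by (rule LIMSEQ_le_const) (use a_ge in blast)
    then show ?thesis using that by (intro exI[of _ i]) linarith
  qed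
  show ?thesis
  proof (rule exI[of _ "\<Union>j. \<Lambda> j"], intro allI conjI impI)
    show "(\<Sum>\<xi>\<in>F. (norm (\<phi> 0 (x + \<xi>)))\<^sup>2) \<le> 1" if "finite F \<and> F \<subseteq> (\<Union>j. \<Lambda> j)" for x F
      using bessel[of F x] that by (simp add: b_def)
    show "\<exists>F. finite F \<and> F \<subseteq> (\<Union>j. \<Lambda> j) \<and> (\<Sum>\<xi>\<in>F. (norm (\<phi> 0 (x + \<xi>)))\<^sup>2) > 1 - \<eta>"
      if "0 < \<eta>" for x \<eta>
      using complete[OF that, of x] fin unfolding b_def by blast
  qed
qed

end

section \<open>Density of trigonometric polynomials\<close>

lemma exponential_eq_cis: "exponential t x = cis (2 * pi * t * x)"
  by (simp add: exponential_def cis_conv_exp mult_ac)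

lemma norm_exponential [simp]: "norm (exponential t x) = 1"
  by (simp add: exponential_eq_cis)

lemma exponential_0 [simp]: "exponential 0 x = 1"
  by (simp add: exponential_eq_cis)

lemma exponential_add: "exponential (s + t) x = exponential s x * exponential t x"
  by (simp add: exponential_eq_cis cis_mult algebra_simps)

lemma cnj_exponential: "cnj (exponential t x) = exponential (- t) x"
  by (simp add: exponential_eq_cis cis_cnj)

lemma continuous_on_exponential: "continuous_on A (exponential t)"
  unfolding exponential_def by (intro continuous_intros)

lemma measurable_exponential [measurable]: "exponential t \<in> borel_measurable borel"
  by (rule borel_measurable_continuous_onI[OF continuous_on_exponential])

lemma norm_add_sq_le: "(norm (a + b))\<^sup>2 \<le> 2 * (norm a)\<^sup>2 + 2 * (norm b)\<^sup>2"
  for a b :: "'a :: real_normed_vector"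
proof -
  have "(norm (a + b))\<^sup>2 \<le> (norm a + norm b)\<^sup>2"
    by (intro power_mono norm_triangle_ineq) auto
  also have "\<dots> \<le> 2 * (norm a)\<^sup>2 + 2 * (norm b)\<^sup>2"
    using sum_squares_bound[of "norm a" "norm b"] by (simp add: power2_sum)
  finally show ?thesis .
qed

section \<open>Square-integrable functions and closures of subspaces\<close>

context real_distribution
begin

lemma measurable_real_distribution: "borel_measurable M = borel_measurable (borel :: real measure)"
  by (rule measurable_cong_sets) auto

lemma square_integrable_add:
  assumes "square_integrable M f" "square_integrable M g"
  shows "square_integrable M (\<lambda>x. f x + g x)"
  unfolding square_integrable_def
proof
  have m [measurable]: "f \<in> borel_measurable M" "g \<in> borel_measurable M"
    using assms by (auto simp: square_integrable_def)
  show "(\<lambda>x. f x + g x) \<in> borel_measurable M" by measurable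
  show "integrable M (\<lambda>x. (cmod (f x + g x))\<^sup>2)"
  proof (rule Bochner_Integration.integrable_bound)
    show "integrable M (\<lambda>x. 2 * (cmod (f x))\<^sup>2 + 2 * (cmod (g x))\<^sup>2)"
      using assms by (auto simp: square_integrable_def)
  qed (auto simp: norm_add_sq_le intro: order_trans[OF norm_add_sq_le])
qed

lemma square_integrable_scale:
  "square_integrable M f \<Longrightarrow> square_integrable M (\<lambda>x. c * f x)"
  by (auto simp: square_integrable_def norm_mult power_mult_distrib)

lemma square_integrable_diff:
  assumes "square_integrable M f" "square_integrable M g"
  shows "square_integrable M (\<lambda>x. f x - g x)"
  using square_integrable_add[OF assms(1) square_integrable_scale[OF assms(2), of "-1"]] by simp

lemma square_integrable_bounded:
  assumes "f \<in> borel_measurable borel" "AE x in M. norm (f x) \<le> K"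
  shows "square_integrable M f"
  unfolding square_integrable_def
proof
  show "f \<in> borel_measurable M" using assms(1) by (simp add: measurable_real_distribution)
  show "integrable M (\<lambda>x. (cmod (f x))\<^sup>2)"
  proof (rule integrable_const_bound)
    show "AE x in M. norm ((cmod (f x))\<^sup>2) \<le> K\<^sup>2"
      using assms(2) by eventually_elim (auto intro: power_mono)
    show "(\<lambda>x. (cmod (f x))\<^sup>2) \<in> borel_measurable M"
      using assms(1) by (simp add: measurable_real_distribution)
  qed
qed

lemma square_integrable_exponential: "square_integrable M (exponential t)"
  by (rule square_integrable_bounded[of _ 1]) auto

lemma integral_sq_triangle:
  assumes "square_integrable M f" "square_integrable M g" "square_integrable M h"
  shows "(\<integral>x. (cmod (f x - h x))\<^sup>2 \<partial>M)
      \<le> 2 * (\<integral>x. (cmod (f x - g x))\<^sup>2 \<partial>M) + 2 * (\<integral>x. (cmod (g x - h x))\<^sup>2 \<partial>M)"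
proof -
  have i: "integrable M (\<lambda>x. (cmod (f x - h x))\<^sup>2)" "integrable M (\<lambda>x. (cmod (f x - g x))\<^sup>2)"
    "integrable M (\<lambda>x. (cmod (g x - h x))\<^sup>2)"
    using assms[THEN square_integrable_diff] assms by (auto simp: square_integrable_def dest: square_integrable_diff)
  have "(\<integral>x. (cmod (f x - h x))\<^sup>2 \<partial>M)
      \<le> (\<integral>x. 2 * (cmod (f x - g x))\<^sup>2 + 2 * (cmod (g x - h x))\<^sup>2 \<partial>M)"
  proof (rule integral_mono)
    show "(cmod (f x - h x))\<^sup>2 \<le> 2 * (cmod (f x - g x))\<^sup>2 + 2 * (cmod (g x - h x))\<^sup>2" for x
      using norm_add_sq_le[of "f x - g x" "g x - h x"] by simp
  qed (use i in auto)
  also have "\<dots> = 2 * (\<integral>x. (cmod (f x - g x))\<^sup>2 \<partial>M) + 2 * (\<integral>x. (cmod (g x - h x))\<^sup>2 \<partial>M)"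
    using i by simp
  finally show ?thesis .
qed

end

locale L2_subspace = real_distribution +
  fixes V :: "(real \<Rightarrow> complex) set"
  assumes V_L2: "f \<in> V \<Longrightarrow> square_integrable M f"
    and V_add: "f \<in> V \<Longrightarrow> g \<in> V \<Longrightarrow> (\<lambda>x. f x + g x) \<in> V"
    and V_scale: "f \<in> V \<Longrightarrow> (\<lambda>x. c * f x) \<in> V"
begin

text \<open>Membership in the closure of \<open>V\<close>. Squared distances avoid roots; the
  triangle inequality then costs a factor 2, hence the choices \<open>e / 4\<close> below.\<close>

definition approximable :: "(real \<Rightarrow> complex) \<Rightarrow> bool" where
  "approximable f \<longleftrightarrow> square_integrable M f \<and>
     (\<forall>e>0. \<exists>g\<in>V. (\<integral>x. (cmod (f x - g x))\<^sup>2 \<partial>M) < e)"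

lemma approximable_L2: "approximable f \<Longrightarrow> square_integrable M f"
  by (simp add: approximable_def)

lemma approximable_limit:
  assumes "square_integrable M f"
    and "\<And>e. e > 0 \<Longrightarrow> \<exists>g. approximable g \<and> (\<integral>x. (cmod (f x - g x))\<^sup>2 \<partial>M) < e"
  shows "approximable f"
  unfolding approximable_def
proof (intro conjI allI impI)
  fix e :: real assume e: "e > 0"
  obtain g where g: "approximable g" "(\<integral>x. (cmod (f x - g x))\<^sup>2 \<partial>M) < e / 4"
    using assms(2)[of "e / 4"] e by auto
  obtain h where h: "h \<in> V" "(\<integral>x. (cmod (g x - h x))\<^sup>2 \<partial>M) < e / 4"
    using g(1) e by (auto simp: approximable_def dest: spec[of _ "e / 4"])
  have "(\<integral>x. (cmod (f x - h x))\<^sup>2 \<partial>M) < e"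
    using integral_sq_triangle[OF assms(1) approximable_L2[OF g(1)] V_L2[OF h(1)]] g h by simp
  then show "\<exists>g\<in>V. (\<integral>x. (cmod (f x - g x))\<^sup>2 \<partial>M) < e" using h by blast
qed fact

lemma approximable_scale:
  assumes "approximable f"
  shows "approximable (\<lambda>x. c * f x)"
  unfolding approximable_def
proof (intro conjI allI impI)
  show "square_integrable M (\<lambda>x. c * f x)"
    by (rule square_integrable_scale[OF approximable_L2[OF assms]])
  fix e :: real assume "e > 0"
  then obtain g where g: "g \<in> V" "(\<integral>x. (cmod (f x - g x))\<^sup>2 \<partial>M) < e / ((cmod c)\<^sup>2 + 1)"
    using assms unfolding approximable_def
    by (metis add_nonneg_pos zero_le_power2 zero_less_divide_iff zero_less_one)
  have "(\<integral>x. (cmod (c * f x - c * g x))\<^sup>2 \<partial>M) = (cmod c)\<^sup>2 * (\<integral>x. (cmod (f x - g x))\<^sup>2 \<partial>M)"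
    by (simp add: right_diff_distrib[symmetric] norm_mult power_mult_distrib)
  also have "\<dots> \<le> ((cmod c)\<^sup>2 + 1) * (\<integral>x. (cmod (f x - g x))\<^sup>2 \<partial>M)"
    by (intro mult_right_mono) auto
  also have "\<dots> < e" using g(2) by (simp add: field_simps add_pos_nonneg)
  finally show "\<exists>h\<in>V. (\<integral>x. (cmod (c * f x - h x))\<^sup>2 \<partial>M) < e"
    using V_scale[OF g(1), of c] by (intro bexI[of _ "\<lambda>x. c * g x"])
qed

lemma approximable_add:
  assumes "approximable f" "approximable g"
  shows "approximable (\<lambda>x. f x + g x)"
  unfolding approximable_def
proof (intro conjI allI impI)
  show "square_integrable M (\<lambda>x. f x + g x)"
    by (intro square_integrable_add approximable_L2 assms)
  fix e :: real assume e: "e > 0"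
  obtain f' where f: "f' \<in> V" "(\<integral>x. (cmod (f x - f' x))\<^sup>2 \<partial>M) < e / 4"
    using assms(1) e by (auto simp: approximable_def dest: spec[of _ "e / 4"])
  obtain g' where g: "g' \<in> V" "(\<integral>x. (cmod (g x - g' x))\<^sup>2 \<partial>M) < e / 4"
    using assms(2) e by (auto simp: approximable_def dest: spec[of _ "e / 4"])
  note L2 = approximable_L2[OF assms(1)] approximable_L2[OF assms(2)] V_L2[OF f(1)] V_L2[OF g(1)]
  have "(\<integral>x. (cmod (f x + g x - (f' x + g' x)))\<^sup>2 \<partial>M)
      \<le> 2 * (\<integral>x. (cmod (f x + g x - (f' x + g x)))\<^sup>2 \<partial>M)
        + 2 * (\<integral>x. (cmod (f' x + g x - (f' x + g' x)))\<^sup>2 \<partial>M)"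
    by (intro integral_sq_triangle square_integrable_add L2)
  also have "\<dots> < e" using f g by simp
  finally show "\<exists>h\<in>V. (\<integral>x. (cmod (f x + g x - h x))\<^sup>2 \<partial>M) < e"
    using V_add[OF f(1) g(1)] by (intro bexI[of _ "\<lambda>x. f' x + g' x"])
qed

lemma approximable_sum:
  assumes "finite I" "\<And>i. i \<in> I \<Longrightarrow> approximable (f i)" "approximable (\<lambda>_. 0)"
  shows "approximable (\<lambda>x. \<Sum>i\<in>I. f i x)"
  using assms by (induction I rule: finite_induct) (auto intro: approximable_add)

text \<open>The tool for every enlargement of the closure that follows, from trigonometric
  polynomials to arbitrary functions. The integrable majorant is \<open>4 * (h x)\<^sup>2\<close>
  because \<open>f\<close> and \<open>s n\<close> are both bounded by \<open>h\<close>.\<close>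

lemma approximable_dominated:
  assumes s: "\<And>n. approximable (s n)" and f: "f \<in> borel_measurable borel"
    and h: "integrable M (\<lambda>x. (h x :: real)\<^sup>2)"
    and bound: "\<And>n. AE x in M. cmod (s n x) \<le> h x"
    and lim: "AE x in M. (\<lambda>n. s n x) \<longlonglongrightarrow> f x"
  shows "approximable f"
proof (rule approximable_limit)
  have [measurable]: "s n \<in> borel_measurable M" for n
    using approximable_L2[OF s] by (simp add: square_integrable_def)
  have fm [measurable]: "f \<in> borel_measurable M" using f by (simp add: measurable_real_distribution)
  have "AE x in M. \<forall>n. cmod (s n x) \<le> h x" using bound by (simp add: AE_all_countable)
  then have fh: "AE x in M. cmod (f x) \<le> h x"
    using lim
  proof eventually_elim
    case (elim x)
    show ?case by (rule LIMSEQ_le_const2[OF tendsto_norm[OF elim(2)]]) (use elim(1) in blast)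
  qed
  show L2f: "square_integrable M f"
    unfolding square_integrable_def
  proof
    show "integrable M (\<lambda>x. (cmod (f x))\<^sup>2)"
    proof (rule Bochner_Integration.integrable_bound[OF h])
      show "AE x in M. norm ((cmod (f x))\<^sup>2) \<le> norm ((h x)\<^sup>2)"
        using fh by eventually_elim (auto intro: power_mono)
    qed measurable
  qed measurable
  have "(\<lambda>n. \<integral>x. (cmod (f x - s n x))\<^sup>2 \<partial>M) \<longlonglongrightarrow> (\<integral>x. 0 \<partial>M)"
  proof (rule integral_dominated_convergence)
    show "integrable M (\<lambda>x. 4 * (h x)\<^sup>2)" using h by simp
    show "AE x in M. (\<lambda>n. (cmod (f x - s n x))\<^sup>2) \<longlonglongrightarrow> 0"
      using lim
    proof eventually_elim
      case (elim x)
      have "(\<lambda>n. (cmod (f x - s n x))\<^sup>2) \<longlonglongrightarrow> (cmod (f x - f x))\<^sup>2"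
        by (intro tendsto_intros elim)
      then show ?case by simp
    qed
    show "AE x in M. norm ((cmod (f x - s n x))\<^sup>2) \<le> 4 * (h x)\<^sup>2" for n
      using fh bound[of n]
    proof eventually_elim
      case (elim x)
      have "cmod (f x - s n x) \<le> 2 * h x"
        using elim norm_triangle_ineq4[of "f x" "s n x"] by linarith
      then have "(cmod (f x - s n x))\<^sup>2 \<le> (2 * h x)\<^sup>2" by (intro power_mono) auto
      then show ?case by (simp add: power_mult_distrib)
    qed
  qed measurable
  then have lim0: "(\<lambda>n. \<integral>x. (cmod (f x - s n x))\<^sup>2 \<partial>M) \<longlonglongrightarrow> 0" by simp
  fix e :: real assume "e > 0"
  then have "\<forall>\<^sub>F n in sequentially. (\<integral>x. (cmod (f x - s n x))\<^sup>2 \<partial>M) < e"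
    by (rule order_tendstoD(2)[OF lim0])
  then show "\<exists>g. approximable g \<and> (\<integral>x. (cmod (f x - g x))\<^sup>2 \<partial>M) < e"
    using s by (auto simp: eventually_sequentially)
qed

end

section \<open>Trigonometric polynomials with arbitrary real frequencies\<close>

inductive_set trig_polys :: "(real \<Rightarrow> complex) set" where
  trig_exp: "exponential t \<in> trig_polys"
| trig_add: "f \<in> trig_polys \<Longrightarrow> g \<in> trig_polys \<Longrightarrow> (\<lambda>x. f x + g x) \<in> trig_polys"
| trig_scale: "f \<in> trig_polys \<Longrightarrow> (\<lambda>x. c * f x) \<in> trig_polys"

lemma trig_mult_exp: "g \<in> trig_polys \<Longrightarrow> (\<lambda>x. exponential t x * g x) \<in> trig_polys"
proof (induction rule: trig_polys.induct)
  case (trig_exp s)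
  then show ?case using trig_polys.trig_exp[of "t + s"] by (simp add: exponential_add[abs_def])
next
  case (trig_add f g)
  then show ?case using trig_polys.trig_add by (simp add: distrib_left)
next
  case (trig_scale f c)
  then show ?case using trig_polys.trig_scale[of _ c] by (simp add: mult.left_commute)
qed

lemma trig_mult: "f \<in> trig_polys \<Longrightarrow> g \<in> trig_polys \<Longrightarrow> (\<lambda>x. f x * g x) \<in> trig_polys"
proof (induction rule: trig_polys.induct)
  case (trig_exp s)
  then show ?case by (rule trig_mult_exp)
next
  case (trig_add f f')
  then show ?case using trig_polys.trig_add by (simp add: distrib_right)
next
  case (trig_scale f c)
  then show ?case using trig_polys.trig_scale[of _ c] by (simp add: mult.assoc)
qed

lemma trig_continuous: "f \<in> trig_polys \<Longrightarrow> continuous_on A f"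
  by (induction rule: trig_polys.induct) (auto intro!: continuous_intros continuous_on_exponential)

lemma trig_polys_approx:
  assumes f: "continuous_on {-R..R} (f :: real \<Rightarrow> real)" and "e > 0" "R \<ge> 0"
  shows "\<exists>g\<in>trig_polys. \<forall>x\<in>{-R..R}. cmod (of_real (f x) - g x) < e"
proof -
  \<comment> \<open>The Stone-Weierstrass theorem used here is about real functions, so the ring
    consists of the real functions that are trigonometric polynomials when viewed as complex
    ones.\<close>
  define A where "A = {u :: real \<Rightarrow> real. (\<lambda>x. complex_of_real (u x)) \<in> trig_polys}"
  interpret function_ring_on A "{-R..R}"
  proof
    show "continuous_on {-R..R} u" if "u \<in> A" for u
    proof -
      have "continuous_on {-R..R} (\<lambda>x. Re (complex_of_real (u x)))"
        using that by (intro continuous_on_Re trig_continuous) (simp add: A_def)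
      then show ?thesis by simp
    qed
    show "(\<lambda>x. u x + v x) \<in> A" if "u \<in> A" "v \<in> A" for u v
      using that trig_add by (simp add: A_def)
    show "(\<lambda>x. u x * v x) \<in> A" if "u \<in> A" "v \<in> A" for u v
      using that trig_mult by (simp add: A_def)
    show "(\<lambda>_. c) \<in> A" for c
      using trig_scale[OF trig_exp[of 0], of "of_real c"] by (simp add: A_def)
    show "\<exists>u\<in>A. u x \<noteq> u y" if xy: "x \<in> {-R..R}" "y \<in> {-R..R}" "x \<noteq> y" for x y
    proof -
      \<comment> \<open>This frequency keeps \<open>2 * pi * t * z\<close> within [-pi/2, pi/2] on
        the interval, where the sine is injective and hence separates points.\<close>
      define t where "t = 1 / (4 * (R + 1))"
      have t: "t > 0" using assms(3) by (simp add: t_def)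
      define u where "u z = sin (2 * pi * t * z)" for z
      have "(\<lambda>z. complex_of_real (u z)) = (\<lambda>z. (1 / (2 * \<i>)) * exponential t z + (- 1 / (2 * \<i>)) * exponential (- t) z)"
        by (rule ext) (simp add: u_def exponential_eq_cis complex_eq_iff Re_divide Im_divide)
      moreover have "\<dots> \<in> trig_polys" by (intro trig_add trig_scale trig_exp)
      ultimately have "u \<in> A" by (simp add: A_def)
      moreover have "u x \<noteq> u y"
      proof
        assume "u x = u y"
        have le: "\<bar>2 * pi * t * z\<bar> \<le> pi / 2" if "z \<in> {-R..R}" for z
        proof -
          have "\<bar>2 * pi * t * z\<bar> = 2 * pi * t * \<bar>z\<bar>" using t by (simp add: abs_mult)
          also have "\<dots> \<le> 2 * pi * t * (R + 1)" using that t by (intro mult_left_mono) auto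
          also have "\<dots> = pi / 2" using assms(3) by (simp add: t_def field_simps)
          finally show ?thesis .
        qed
        have b: "- (pi / 2) \<le> 2 * pi * t * z \<and> 2 * pi * t * z \<le> pi / 2" if "z \<in> {-R..R}" for z
          using abs_le_D1[OF le[OF that]] abs_le_D2[OF le[OF that]] minus_le_iff by blast
        have "2 * pi * t * x = 2 * pi * t * y"
          using b[OF xy(1)] b[OF xy(2)] \<open>u x = u y\<close> unfolding u_def by (blast intro: sin_inj_pi)
        then show False using t xy(3) by simp
      qed
      ultimately show ?thesis by blast
    qed
  qed simp
  obtain g where "g \<in> A" "\<forall>x\<in>{-R..R}. \<bar>f x - g x\<bar> < e"
    using Stone_Weierstrass_basic[OF f assms(2)] by blast
  then show ?thesis
    by (intro bexI[of _ "\<lambda>x. of_real (g x)"]) (auto simp: A_def simp flip: of_real_diff)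
qed

text \<open>In the application \<open>V\<close> is the span of the exponentials with frequencies in
  the spectrum, while \<open>approximable_exponential\<close> concerns every real frequency. Bounded
  support makes uniform approximation on one compact interval sufficient.\<close>

locale L2_subspace_exponentials = L2_subspace +
  fixes R :: real
  assumes supp: "AE x in M. \<bar>x\<bar> \<le> R"
    and approximable_exponential: "approximable (exponential t)"
begin

lemma approximable_trig: "f \<in> trig_polys \<Longrightarrow> approximable f"
  by (induction rule: trig_polys.induct)
     (auto intro: approximable_exponential approximable_add approximable_scale)

lemma approximable_continuous:
  assumes f: "continuous_on UNIV (f :: real \<Rightarrow> real)" and "\<And>x. \<bar>f x\<bar> \<le> 1"
  shows "approximable (\<lambda>x. of_real (f x))"
proof -
  define R' where "R' = max R 0"
  have "\<exists>g\<in>trig_polys. \<forall>x\<in>{-R'..R'}. cmod (of_real (f x) - g x) < inverse (Suc n)" for n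
    by (rule trig_polys_approx) (auto simp: R'_def intro: continuous_on_subset[OF f])
  then obtain g where g: "\<And>n. g n \<in> trig_polys"
    "\<And>n x. x \<in> {-R'..R'} \<Longrightarrow> cmod (of_real (f x) - g n x) < inverse (Suc n)" by metis
  have supp': "AE x in M. x \<in> {-R'..R'}" using supp by eventually_elim (auto simp: R'_def)
  show ?thesis
  proof (rule approximable_dominated[of g _ "\<lambda>_. 2"])
    show "approximable (g n)" for n by (rule approximable_trig[OF g(1)])
    have [measurable]: "f \<in> borel_measurable borel" by (rule borel_measurable_continuous_onI[OF f])
    show "(\<lambda>x. complex_of_real (f x)) \<in> borel_measurable borel" by measurable
    show "AE x in M. cmod (g n x) \<le> 2" for n
      using supp'
    proof eventually_elim
      case (elim x)
      have "cmod (of_real (f x) - g n x) \<le> 1"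
        using g(2)[OF elim, of n] inverse_le_1_iff[of "real (Suc n)"] by simp
      moreover have "cmod (of_real (f x)) \<le> 1" using assms(2) by simp
      ultimately show ?case
        using norm_triangle_ineq2[of "g n x" "of_real (f x)"] by (simp add: norm_minus_commute)
    qed
    show "AE x in M. (\<lambda>n. g n x) \<longlonglongrightarrow> complex_of_real (f x)"
      using supp'
    proof eventually_elim
      case (elim x)
      have "(\<lambda>n. norm (g n x - of_real (f x))) \<longlonglongrightarrow> 0"
      proof (rule tendsto_sandwich[OF _ _ tendsto_const LIMSEQ_inverse_real_of_nat])
        show "\<forall>\<^sub>F n in sequentially. norm (g n x - of_real (f x)) \<le> inverse (real (Suc n))"
          using g(2)[OF elim] by (auto simp: norm_minus_commute less_imp_le)
      qed auto
      then show ?case by (simp add: tendsto_norm_zero_iff LIM_zero_iff)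
    qed
  qed auto
qed

lemma approximable_0: "approximable (\<lambda>_. 0)"
  using approximable_scale[OF approximable_exponential, of 0] by simp

text \<open>The indicator is the limit of continuous ramps that equal 1 up to \<open>a\<close> and
  vanish from \<open>a + 1 / n\<close> on.\<close>

lemma approximable_indicator_atMost: "approximable (\<lambda>x. of_real (indicator {..a} x))"
proof (rule approximable_dominated[of "\<lambda>n x. of_real (max 0 (min 1 (1 - real n * (x - a))))" _ "\<lambda>_. 1"])
  show "approximable (\<lambda>x. of_real (max 0 (min 1 (1 - real n * (x - a)))))" for n
    by (rule approximable_continuous) (auto intro!: continuous_intros)
  show "AE x in M. (\<lambda>n. complex_of_real (max 0 (min 1 (1 - real n * (x - a))))) \<longlonglongrightarrow> of_real (indicator {..a} x)"
  proof (rule AE_I2)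
    fix x
    show "(\<lambda>n. complex_of_real (max 0 (min 1 (1 - real n * (x - a))))) \<longlonglongrightarrow> of_real (indicator {..a} x)"
    proof (cases "x \<le> a")
      case True
      then have "real n * (x - a) \<le> 0" for n by (simp add: mult_nonneg_nonpos)
      moreover have "max 0 (min 1 (1 - r)) = 1" if "r \<le> 0" for r :: real using that by simp
      ultimately have "max 0 (min 1 (1 - real n * (x - a))) = 1" for n by blast
      then show ?thesis using True by simp
    next
      case False
      have "\<forall>\<^sub>F n in sequentially. complex_of_real (max 0 (min 1 (1 - real n * (x - a)))) = 0"
        using eventually_ge_at_top[of "nat \<lceil>1 / (x - a)\<rceil>"]
      proof eventually_elim
        case (elim n)
        then have "1 / (x - a) \<le> real n" by linarith
        then have "real n * (x - a) \<ge> 1" using False by (simp add: field_simps)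
        then show ?case by simp
      qed
      then show ?thesis using False by (simp add: tendsto_eventually)
    qed
  qed
qed auto

text \<open>Dynkin's argument from the half-lines, which are stable under intersection. Complements
  use that \<open>exponential 0\<close> is the constant 1; disjoint unions are bounded limits of
  finite sums.\<close>

lemma approximable_indicator:
  assumes "S \<in> sets borel"
  shows "approximable (\<lambda>x. of_real (indicator S x))"
proof -
  have mem: "S \<in> sigma_sets UNIV (range (\<lambda>a::real. {..a}))"
    using assms by (subst (asm) borel_eq_atMost) simp
  have stable: "Int_stable (range (\<lambda>a::real. {..a}))"
    by (auto simp: Int_stable_def intro: exI[of _ "min _ _"])
  have "range (\<lambda>a::real. {..a}) \<subseteq> Pow UNIV" by simp
  from stable this mem show ?thesis
  proof (induction rule: sigma_sets_induct_disjoint)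
    case (basic A)
    then show ?case using approximable_indicator_atMost by auto
  next
    case empty
    then show ?case using approximable_0 by simp
  next
    case (compl A)
    have "approximable (\<lambda>x. exponential 0 x + (- 1) * of_real (indicator A x))"
      by (intro approximable_add approximable_exponential approximable_scale compl)
    moreover have "(\<lambda>x. exponential 0 x + (- 1) * of_real (indicator A x)) = (\<lambda>x. complex_of_real (indicator (UNIV - A) x))"
      by (auto simp: fun_eq_iff indicator_def)
    ultimately show ?case by simp
  next
    case (union A)
    have sets: "A i \<in> sets borel" for i
      using union(2) by (subst borel_eq_atMost) auto
    show ?case
    proof (rule approximable_dominated[of "\<lambda>n x. \<Sum>i<n. of_real (indicator (A i) x)" _ "\<lambda>_. 1"])
      show "approximable (\<lambda>x. \<Sum>i<n. complex_of_real (indicator (A i) x))" for n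
        by (intro approximable_sum union approximable_0) auto
      show "(\<lambda>x. complex_of_real (indicator (\<Union> (range A)) x)) \<in> borel_measurable borel"
        using sets by measurable
      have eq: "(\<Sum>i<n. indicator (A i) x) = (indicator (\<Union>i<n. A i) x :: real)" for n x
        using union(1) by (intro indicator_UN_disjoint[symmetric]) (auto simp: disjoint_family_on_def)
      show "AE x in M. cmod (\<Sum>i<n. of_real (indicator (A i) x)) \<le> 1" for n
        by (simp add: of_real_sum[symmetric] eq del: of_real_sum)
      show "AE x in M. (\<lambda>n. \<Sum>i<n. complex_of_real (indicator (A i) x)) \<longlonglongrightarrow> of_real (indicator (\<Union> (range A)) x)"
      proof (rule AE_I2)
        fix x
        show "(\<lambda>n. \<Sum>i<n. complex_of_real (indicator (A i) x)) \<longlonglongrightarrow> of_real (indicator (\<Union> (range A)) x)"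
          unfolding of_real_sum[symmetric] eq
          by (intro tendsto_of_real LIMSEQ_indicator_UN)
      qed
    qed auto
  qed
qed

theorem approximable_all:
  assumes f: "square_integrable M f"
  shows "approximable f"
proof -
  have fm: "f \<in> borel_measurable M" using f by (simp add: square_integrable_def)
  obtain s where s: "\<And>i. simple_function M (s i)" "\<And>x. (\<lambda>i. s i x) \<longlonglongrightarrow> f x"
    "\<And>i x. norm (s i x) \<le> 2 * norm (f x)"
    using borel_measurable_implies_sequence_metric[OF fm, of 0]
    unfolding space_eq_univ norm_conv_dist by (metis UNIV_I)
  show ?thesis
  proof (rule approximable_dominated[of s f "\<lambda>x. 2 * norm (f x)"])
    show "approximable (s i)" for i
    proof -
      have fin: "finite (range (s i))" using simple_functionD(1)[OF s(1)[of i]] by simp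
      have "s i -` {y} \<inter> space M \<in> sets M" for y by (rule simple_functionD(2)[OF s(1)])
      then have "s i -` {y} \<in> sets borel" for y by simp
      then have "approximable (\<lambda>x. \<Sum>y\<in>range (s i). y * of_real (indicator (s i -` {y}) x))"
        by (intro approximable_sum fin approximable_scale approximable_indicator approximable_0)
      moreover have "(\<Sum>y\<in>range (s i). y * of_real (indicator (s i -` {y}) x)) = s i x" for x
      proof -
        have "(\<Sum>y\<in>range (s i). y * of_real (indicator (s i -` {y}) x))
            = (\<Sum>y\<in>range (s i). if y = s i x then y else 0)"
          by (intro sum.cong) (auto simp: indicator_def)
        also have "\<dots> = s i x" using fin by simp
        finally show ?thesis .
      qed
      ultimately show ?thesis by simp
    qed
    show "f \<in> borel_measurable borel" using fm by (simp add: measurable_real_distribution)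
    show "integrable M (\<lambda>x. (2 * norm (f x))\<^sup>2)"
      using f by (simp add: square_integrable_def power_mult_distrib)
  qed (use s in auto)
qed

end

section \<open>Parseval criterion for spectra\<close>

definition fourier :: "real measure \<Rightarrow> real \<Rightarrow> complex" where
  "fourier \<mu> t = (\<integral>x. exponential t x \<partial>\<mu>)"

lemma fourier_eq_char: "fourier \<mu> t = char \<mu> (2 * pi * t)"
  by (simp add: fourier_def char_def exponential_eq_cis cis_conv_exp)

context real_distribution
begin

lemma integrable_exponential: "integrable M (exponential t)"
  by (rule integrable_const_bound[of _ 1]) (auto simp: measurable_real_distribution)

lemma fourier_0 [simp]: "fourier M 0 = 1"
  by (simp add: fourier_def prob_space[unfolded space_eq_univ])

lemma fourier_uminus: "fourier M (- t) = cnj (fourier M t)"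
proof -
  have "fourier M (- t) = (\<integral>x. cnj (exponential t x) \<partial>M)"
    unfolding fourier_def cnj_exponential ..
  then show ?thesis unfolding fourier_def by simp
qed

lemma L2_inner_exponential: "L2_inner M (exponential s) (exponential t) = fourier M (s - t)"
proof -
  have "exponential s x * cnj (exponential t x) = exponential (s - t) x" for x
    using exponential_add[of s "- t" x] by (simp add: cnj_exponential)
  then show ?thesis by (simp add: L2_inner_def fourier_def)
qed

text \<open>Expansion of the square followed by completing it around the coefficients
  \<open>fourier M (t - i)\<close>. Choosing these as \<open>c\<close> gives the Parseval defect;
  arbitrary \<open>c\<close> shows that no other combination does better.\<close>

lemma integral_exponential_residual:
  assumes F: "finite F" and orth: "\<And>i j. i \<in> F \<Longrightarrow> j \<in> F \<Longrightarrow> i \<noteq> j \<Longrightarrow> fourier M (i - j) = 0"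
  shows "(\<integral>x. (cmod (exponential t x - (\<Sum>i\<in>F. c i * exponential i x)))\<^sup>2 \<partial>M)
    = 1 - (\<Sum>i\<in>F. (cmod (fourier M (t - i)))\<^sup>2) + (\<Sum>i\<in>F. (cmod (c i - fourier M (t - i)))\<^sup>2)"
proof -
  have pointwise: "complex_of_real ((cmod (exponential t x - (\<Sum>i\<in>F. c i * exponential i x)))\<^sup>2)
      = 1 - (\<Sum>i\<in>F. cnj (c i) * exponential (t - i) x) - (\<Sum>i\<in>F. c i * exponential (i - t) x)
        + (\<Sum>i\<in>F. \<Sum>j\<in>F. c i * cnj (c j) * exponential (i - j) x)" for x
  proof -
    have "complex_of_real ((cmod (exponential t x - (\<Sum>i\<in>F. c i * exponential i x)))\<^sup>2)
        = (exponential t x - (\<Sum>i\<in>F. c i * exponential i x))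
          * (exponential (- t) x - (\<Sum>i\<in>F. cnj (c i) * exponential (- i) x))"
      unfolding complex_norm_square by (simp add: cnj_exponential)
    also have "\<dots> = exponential t x * exponential (- t) x
        - (\<Sum>i\<in>F. cnj (c i) * (exponential t x * exponential (- i) x))
        - (\<Sum>i\<in>F. c i * (exponential i x * exponential (- t) x))
        + (\<Sum>i\<in>F. \<Sum>j\<in>F. c i * cnj (c j) * (exponential i x * exponential (- j) x))"
    proof -
      let ?X = "\<Sum>i\<in>F. c i * exponential i x" and ?Y = "\<Sum>i\<in>F. cnj (c i) * exponential (- i) x"
      have "(exponential t x - ?X) * (exponential (- t) x - ?Y)
          = exponential t x * exponential (- t) x - exponential t x * ?Y - ?X * exponential (- t) x + ?X * ?Y"
        by (simp add: algebra_simps)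
      moreover have "exponential t x * ?Y = (\<Sum>i\<in>F. cnj (c i) * (exponential t x * exponential (- i) x))"
        by (simp add: sum_distrib_left mult_ac)
      moreover have "?X * exponential (- t) x = (\<Sum>i\<in>F. c i * (exponential i x * exponential (- t) x))"
        by (simp add: sum_distrib_right mult.assoc)
      moreover have "?X * ?Y = (\<Sum>i\<in>F. \<Sum>j\<in>F. c i * cnj (c j) * (exponential i x * exponential (- j) x))"
        by (simp add: sum_product mult_ac)
      ultimately show ?thesis by simp
    qed
    finally show ?thesis by (simp flip: exponential_add)
  qed
  define p where "p i = fourier M (t - i)" for i
  have p': "fourier M (i - t) = cnj (p i)" for i
    using fourier_uminus[of "t - i"] by (simp add: p_def)
  have "complex_of_real (\<integral>x. (cmod (exponential t x - (\<Sum>i\<in>F. c i * exponential i x)))\<^sup>2 \<partial>M)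
     = (\<integral>x. complex_of_real ((cmod (exponential t x - (\<Sum>i\<in>F. c i * exponential i x)))\<^sup>2) \<partial>M)"
    by (rule integral_complex_of_real[symmetric])
  also have "\<dots> = 1 - (\<Sum>i\<in>F. cnj (c i) * p i) - (\<Sum>i\<in>F. c i * cnj (p i))
        + (\<Sum>i\<in>F. \<Sum>j\<in>F. c i * cnj (c j) * fourier M (i - j))"
    unfolding pointwise p_def p'[unfolded p_def, symmetric] unfolding fourier_def
    using prob_space[unfolded space_eq_univ]
    by (simp add: integrable_exponential Bochner_Integration.integral_sum)
  also have "(\<Sum>i\<in>F. \<Sum>j\<in>F. c i * cnj (c j) * fourier M (i - j)) = (\<Sum>i\<in>F. c i * cnj (c i))"
  proof (rule sum.cong[OF refl])
    fix i assume i: "i \<in> F"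
    have "(\<Sum>j\<in>F. c i * cnj (c j) * fourier M (i - j)) = (\<Sum>j\<in>F. if j = i then c i * cnj (c i) else 0)"
      by (rule sum.cong) (use orth i in auto)
    then show "(\<Sum>j\<in>F. c i * cnj (c j) * fourier M (i - j)) = c i * cnj (c i)"
      using F i by simp
  qed
  also have "1 - (\<Sum>i\<in>F. cnj (c i) * p i) - (\<Sum>i\<in>F. c i * cnj (p i)) + (\<Sum>i\<in>F. c i * cnj (c i))
      = 1 - (\<Sum>i\<in>F. p i * cnj (p i)) + (\<Sum>i\<in>F. (c i - p i) * cnj (c i - p i))"
    by (simp add: algebra_simps sum.distrib sum_subtractf)
  also have "\<dots> = complex_of_real (1 - (\<Sum>i\<in>F. (cmod (p i))\<^sup>2) + (\<Sum>i\<in>F. (cmod (c i - p i))\<^sup>2))"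
    by (simp only: complex_norm_square[symmetric] of_real_add of_real_diff of_real_sum of_real_1)
  finally show ?thesis by (simp only: of_real_eq_iff p_def)
qed

text \<open>Completeness at \<open>x = - t\<close> says that \<open>exponential t\<close> lies in
  the closed span of the exponentials from \<Lambda>. Since \<open>t\<close> is arbitrary, that
  closure is all of L2.\<close>

lemma spectral_measure_of_parseval:
  assumes supp: "AE x in M. \<bar>x\<bar> \<le> R"
    and bessel: "\<And>x F. finite F \<Longrightarrow> F \<subseteq> \<Lambda> \<Longrightarrow> (\<Sum>\<xi>\<in>F. (cmod (fourier M (x + \<xi>)))\<^sup>2) \<le> 1"
    and complete: "\<And>x \<eta>. \<eta> > 0 \<Longrightarrow> \<exists>F. finite F \<and> F \<subseteq> \<Lambda> \<and> (\<Sum>\<xi>\<in>F. (cmod (fourier M (x + \<xi>)))\<^sup>2) > 1 - \<eta>"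
  shows "spectral_measure M"
proof -
  \<comment> \<open>At \<open>x = - j\<close> the term of \<open>j\<close> equals 1 and uses up the
    whole Bessel bound.\<close>
  have orth: "fourier M (i - j) = 0" if "i \<in> \<Lambda>" "j \<in> \<Lambda>" "i \<noteq> j" for i j
    using bessel[of "{i, j}" "- j"] that by simp
  define V where "V = {f. \<exists>F c. finite F \<and> F \<subseteq> \<Lambda> \<and> f = (\<lambda>x. \<Sum>i\<in>F. c i * exponential i x)}"
  have V_I: "(\<lambda>x. \<Sum>i\<in>F. c i * exponential i x) \<in> V" if "finite F" "F \<subseteq> \<Lambda>" for F c
    unfolding V_def mem_Collect_eq by (intro exI conjI) (use that in auto)
  interpret L2_subspace M V
  proof
    fix f assume "f \<in> V"
    then obtain F c where f: "finite F" "F \<subseteq> \<Lambda>" "f = (\<lambda>x. \<Sum>i\<in>F. c i * exponential i x)"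
      unfolding V_def by blast
    have "square_integrable M (\<lambda>x. \<Sum>i\<in>F. c i * exponential i x)"
      using f(1) by (induction F rule: finite_induct)
        (simp_all add: square_integrable_add square_integrable_scale square_integrable_exponential
          square_integrable_bounded[of _ 0])
    then show "square_integrable M f" using f by simp
    show "(\<lambda>x. a * f x) \<in> V" for a
      using V_I[OF f(1,2), of "\<lambda>i. a * c i"] by (simp add: f(3) sum_distrib_left mult.assoc)
    fix g assume "g \<in> V"
    then obtain F' c' where g: "finite F'" "F' \<subseteq> \<Lambda>" "g = (\<lambda>x. \<Sum>i\<in>F'. c' i * exponential i x)"
      unfolding V_def by blast
    define d where "d i = (if i \<in> F then c i else 0) + (if i \<in> F' then c' i else 0)" for i
    have "f x + g x = (\<Sum>i\<in>F \<union> F'. d i * exponential i x)" for x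
    proof -
      have "(\<Sum>i\<in>F. c i * exponential i x) = (\<Sum>i\<in>F \<union> F'. (if i \<in> F then c i else 0) * exponential i x)"
        using f(1) g(1) by (intro sum.mono_neutral_cong_left) auto
      moreover have "(\<Sum>i\<in>F'. c' i * exponential i x) = (\<Sum>i\<in>F \<union> F'. (if i \<in> F' then c' i else 0) * exponential i x)"
        using f(1) g(1) by (intro sum.mono_neutral_cong_left) auto
      ultimately show ?thesis by (simp add: f(3) g(3) d_def distrib_right sum.distrib)
    qed
    then have "(\<lambda>x. f x + g x) = (\<lambda>x. \<Sum>i\<in>F \<union> F'. d i * exponential i x)" by (rule ext)
    moreover have "finite (F \<union> F')" "F \<union> F' \<subseteq> \<Lambda>" using f g by auto
    ultimately show "(\<lambda>x. f x + g x) \<in> V" using V_I by simp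
  qed
  interpret L2_subspace_exponentials M V R
  proof
    show "AE x in M. \<bar>x\<bar> \<le> R" by fact
    fix t
    show "approximable (exponential t)"
      unfolding approximable_def
    proof (intro conjI allI impI square_integrable_exponential)
      fix e :: real assume "e > 0"
      then obtain F where F: "finite F" "F \<subseteq> \<Lambda>" "(\<Sum>\<xi>\<in>F. (cmod (fourier M (- t + \<xi>)))\<^sup>2) > 1 - e"
        using complete[of e "- t"] by blast
      have "cmod (fourier M (t - \<xi>)) = cmod (fourier M (- t + \<xi>))" for \<xi>
        using fourier_uminus[of "t - \<xi>"] by (simp add: algebra_simps)
      then have "(\<Sum>\<xi>\<in>F. (cmod (fourier M (t - \<xi>)))\<^sup>2) > 1 - e" using F(3) by simp
      moreover have "(\<integral>x. (cmod (exponential t x - (\<Sum>i\<in>F. fourier M (t - i) * exponential i x)))\<^sup>2 \<partial>M)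
          = 1 - (\<Sum>i\<in>F. (cmod (fourier M (t - i)))\<^sup>2)"
        by (subst integral_exponential_residual) (use F orth in auto)
      moreover have "(\<lambda>x. \<Sum>i\<in>F. fourier M (t - i) * exponential i x) \<in> V"
        by (rule V_I[OF F(1,2)])
      ultimately show "\<exists>g\<in>V. (\<integral>x. (cmod (exponential t x - g x))\<^sup>2 \<partial>M) < e"
        by (intro bexI[of _ "\<lambda>x. \<Sum>i\<in>F. fourier M (t - i) * exponential i x"]) auto
    qed
  qed
  have "is_spectrum M \<Lambda>"
    unfolding is_spectrum_def orthonormal_basis_L2_def
  proof (intro conjI ballI allI impI square_integrable_exponential)
    show "L2_inner M (exponential i) (exponential j) = (if i = j then 1 else 0)"
      if "i \<in> \<Lambda>" "j \<in> \<Lambda>" for i j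
      using orth[OF that] by (simp add: L2_inner_exponential)
    fix f and e :: real assume "square_integrable M f" "e > 0"
    then have "approximable f" "e\<^sup>2 > 0" using approximable_all by auto
    then obtain g where g: "g \<in> V" "(\<integral>x. (cmod (f x - g x))\<^sup>2 \<partial>M) < e\<^sup>2"
      unfolding approximable_def by blast
    have "L2_dist M f g < e"
      unfolding L2_dist_def using g(2) \<open>e > 0\<close> by (simp add: real_less_lsqrt)
    then show "\<exists>F c. finite F \<and> F \<subseteq> \<Lambda> \<and> L2_dist M f (\<lambda>x. \<Sum>i\<in>F. c i * exponential i x) < e"
      using g(1) unfolding V_def by blast
  qed
  then show ?thesis unfolding spectral_measure_def using real_distribution_axioms by blast
qed

end

section \<open>Fourier transforms of uniform measures on finite sets\<close>

lemma real_distribution_uniform_dirac: "real_distribution (uniform_dirac A)"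
  unfolding uniform_dirac_def by (rule prob_space.real_distribution_distr) (auto simp: prob_space_measure_pmf)

lemma fourier_uniform_dirac:
  assumes "finite A" "A \<noteq> {}"
  shows "fourier (uniform_dirac A) t = (\<Sum>a\<in>A. exponential t a) / card A"
proof -
  have "fourier (uniform_dirac A) t = (\<integral>x. exponential t x \<partial>measure_pmf (pmf_of_set A))"
    unfolding fourier_def uniform_dirac_def by (rule integral_distr) auto
  also have "\<dots> = (\<Sum>a\<in>A. pmf (pmf_of_set A) a *\<^sub>R exponential t a)"
    by (rule integral_measure_pmf) (use assms in auto)
  also have "\<dots> = (\<Sum>a\<in>A. exponential t a / card A)"
    using assms by (intro sum.cong) (auto simp: scaleR_conv_of_real)
  finally show ?thesis by (simp add: sum_divide_distrib)
qed

lemma fourier_uniform_dirac_scaled: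
  assumes "finite B" "B \<noteq> {}" "c \<noteq> 0"
  shows "fourier (uniform_dirac ((*) c ` real_of_int ` B)) t = digit_mask B (c * t)"
proof -
  have inj: "inj_on (\<lambda>b. c * real_of_int b) B" using assms(3) by (auto simp: inj_on_def)
  have img: "(*) c ` real_of_int ` B = (\<lambda>b. c * real_of_int b) ` B" by auto
  have "(\<Sum>b\<in>B. exponential t (c * real_of_int b)) = (\<Sum>b\<in>B. cis (2 * pi * b * (c * t)))"
    by (rule sum.cong) (auto simp: exponential_eq_cis mult_ac)
  then show ?thesis using assms
    by (simp add: img fourier_uniform_dirac sum.reindex[OF inj] card_image[OF inj] digit_mask_def o_def)
qed

section \<open>Admissible pairs\<close>

text \<open>The definition provides a spectrum as an abstract set of integers. It is shown to be
  finite, the residual formula and density turn it into a Parseval identity, and a reflection with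
  translation brings that into the form of \<open>hadamard\<close>.\<close>

lemma admissible_pair_hadamard:
  assumes "admissible_pair N B"
  shows "\<exists>L. hadamard N B L"
proof -
  have N: "\<bar>N\<bar> \<ge> 2" and B: "finite B" "card B \<ge> 2" using assms by (auto simp: admissible_pair_def)
  have B_ne: "B \<noteq> {}" using B(2) by auto
  have N0: "real_of_int N \<noteq> 0" using N by auto
  define \<mu> where "\<mu> = uniform_dirac ((*) (inverse (real_of_int N)) ` real_of_int ` B)"
  interpret real_distribution \<mu> unfolding \<mu>_def by (rule real_distribution_uniform_dirac)
  have four: "fourier \<mu> t = digit_mask B (t / N)" for t
    unfolding \<mu>_def using N0 by (subst fourier_uniform_dirac_scaled[OF B(1) B_ne]) (auto simp: field_simps)
  obtain L0 where L0: "L0 \<subseteq> \<int>" "is_spectrum \<mu> L0"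
    using assms unfolding admissible_pair_def \<mu>_def by blast
  have orth: "fourier \<mu> (i - j) = 0" if "i \<in> L0" "j \<in> L0" "i \<noteq> j" for i j
    using L0(2) that unfolding is_spectrum_def orthonormal_basis_L2_def
    by (simp add: L2_inner_exponential)
  define L where "L = {l. real_of_int l \<in> L0}"
  have L0_eq: "L0 = real_of_int ` L" using L0(1) by (auto simp: L_def elim!: Ints_cases)
  \<comment> \<open>Exponentials with frequencies congruent modulo \<open>N\<close> agree on the
    support up to a unimodular constant, so they cannot be orthogonal. Finiteness of the spectrum
    follows by counting residues.\<close>
  have "inj_on (\<lambda>l. l mod N) L"
  proof (rule inj_onI, rule ccontr)
    fix l l' assume l: "l \<in> L" "l' \<in> L" "l mod N = l' mod N" "l \<noteq> l'"
    then obtain k where "l - l' = N * k" by (metis mod_eq_dvd_iff dvdE)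
    then have "(real_of_int l - real_of_int l') / N = real_of_int k"
      using N0 by (simp add: field_simps flip: of_int_diff of_int_mult)
    then have "fourier \<mu> (real_of_int l - real_of_int l') = digit_mask B (0 + real_of_int k)"
      by (simp add: four)
    moreover have "norm (digit_mask B (0 + real_of_int k)) = norm (digit_mask B 0)"
      by (rule norm_digit_mask_periodic) (simp only: Ints_mult Ints_of_int)
    ultimately show False
      using orth[of l l'] l B(1) B_ne by (simp add: L_def digit_mask_0)
  qed
  \<comment> \<open>\<open>mod\<close> takes the sign of \<open>N\<close>, hence the symmetric
    interval.\<close>
  moreover have "(\<lambda>l. l mod N) ` L \<subseteq> {-\<bar>N\<bar>..\<bar>N\<bar>}"
  proof clarify
    fix l
    have "\<bar>l mod N\<bar> < \<bar>N\<bar>" using N by (intro abs_mod_less) auto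
    then show "l mod N \<in> {-\<bar>N\<bar>..\<bar>N\<bar>}" by (simp only: atLeastAtMost_iff) linarith
  qed
  ultimately have finL: "finite L" by (meson finite_atLeastAtMost_int finite_imageD finite_subset)
  then have finL0: "finite L0" by (simp add: L0_eq)
  have parseval: "(\<Sum>i\<in>L0. (cmod (fourier \<mu> (t - i)))\<^sup>2) = 1" for t
  proof (rule antisym)
    have "0 \<le> (\<integral>x. (cmod (exponential t x - (\<Sum>i\<in>L0. fourier \<mu> (t - i) * exponential i x)))\<^sup>2 \<partial>\<mu>)"
      by simp
    also have "\<dots> = 1 - (\<Sum>i\<in>L0. (cmod (fourier \<mu> (t - i)))\<^sup>2)"
      by (subst integral_exponential_residual) (use finL0 orth in auto)
    finally show "(\<Sum>i\<in>L0. (cmod (fourier \<mu> (t - i)))\<^sup>2) \<le> 1" by simp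
    show "1 \<le> (\<Sum>i\<in>L0. (cmod (fourier \<mu> (t - i)))\<^sup>2)"
    proof (rule field_le_epsilon)
      fix e :: real assume e: "e > 0"
      then have "sqrt e > 0" by simp
      then obtain F c where F: "finite F" "F \<subseteq> L0"
        "L2_dist \<mu> (exponential t) (\<lambda>x. \<Sum>i\<in>F. c i * exponential i x) < sqrt e"
        using L0(2) square_integrable_exponential[of t]
        unfolding is_spectrum_def orthonormal_basis_L2_def by blast
      have "1 - (\<Sum>i\<in>F. (cmod (fourier \<mu> (t - i)))\<^sup>2)
          \<le> 1 - (\<Sum>i\<in>F. (cmod (fourier \<mu> (t - i)))\<^sup>2) + (\<Sum>i\<in>F. (cmod (c i - fourier \<mu> (t - i)))\<^sup>2)"
        by (simp add: sum_nonneg)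
      also have "\<dots> = (\<integral>x. (cmod (exponential t x - (\<Sum>i\<in>F. c i * exponential i x)))\<^sup>2 \<partial>\<mu>)"
        by (rule integral_exponential_residual[symmetric]) (use F orth in auto)
      also have "\<dots> < e" using F(3) by (simp add: L2_dist_def)
      finally have "1 - (\<Sum>i\<in>F. (cmod (fourier \<mu> (t - i)))\<^sup>2) < e" .
      moreover have "(\<Sum>i\<in>F. (cmod (fourier \<mu> (t - i)))\<^sup>2) \<le> (\<Sum>i\<in>L0. (cmod (fourier \<mu> (t - i)))\<^sup>2)"
        using F finL0 by (intro sum_mono2) auto
      ultimately show "1 \<le> (\<Sum>i\<in>L0. (cmod (fourier \<mu> (t - i)))\<^sup>2) + e" by simp
    qed
  qed
  have "L0 \<noteq> {}" using parseval[of 0] by auto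
  then obtain l0 where l0: "l0 \<in> L" by (auto simp: L0_eq)
  \<comment> \<open>The reflection changes \<open>t - i\<close> into a translate by a sum, and the
    offset \<open>l0\<close> brings 0 into the set.\<close>
  have inj: "inj_on (\<lambda>l. l0 - l) L" by (auto simp: inj_on_def)
  have "(\<Sum>l\<in>(\<lambda>l. l0 - l) ` L. (norm (digit_mask B ((x + real_of_int l) / N)))\<^sup>2) = 1" for x
  proof -
    have "(\<Sum>l\<in>(\<lambda>l. l0 - l) ` L. (norm (digit_mask B ((x + real_of_int l) / N)))\<^sup>2)
        = (\<Sum>l\<in>L. (cmod (fourier \<mu> (x + real_of_int l0 - real_of_int l)))\<^sup>2)"
      by (simp add: sum.reindex[OF inj] four algebra_simps)
    also have "\<dots> = (\<Sum>i\<in>L0. (cmod (fourier \<mu> (x + real_of_int l0 - i)))\<^sup>2)"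
      unfolding L0_eq by (subst sum.reindex) (auto simp: inj_on_def)
    finally show ?thesis using parseval by simp
  qed
  moreover have "0 \<in> (\<lambda>l. l0 - l) ` L" using l0 by (intro image_eqI[of _ _ l0]) auto
  ultimately have "hadamard N B ((\<lambda>l. l0 - l) ` L)" using finL by (simp add: hadamard_def)
  then show ?thesis by blast
qed

section \<open>Existence of infinite convolutions\<close>

text \<open>The limit is realised as the law of the random series \<open>\<Sum>k. \<omega> k\<close> under the product measure.\<close>

lemma infinite_convolution_exists:
  assumes \<nu>: "\<And>k. real_distribution (\<nu> k)" and supp: "\<And>k. AE x in \<nu> k. \<bar>x\<bar> \<le> r k" and r: "summable r"
  shows "\<exists>\<mu>. infinite_convolution \<nu> \<mu> \<and> (AE x in \<mu>. \<bar>x\<bar> \<le> suminf r) \<and>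
    (\<forall>t. (\<lambda>k. \<Prod>i<k. char (\<nu> i) t) \<longlonglongrightarrow> char \<mu> t)"
proof -
  have pv: "prob_space (\<nu> k)" for k using \<nu> by (simp add: real_distribution_def)
  have sets\<nu> [measurable_cong, simp]: "sets (\<nu> k) = sets borel" for k
    using \<nu> by (simp add: real_distribution.events_eq_borel)
  define P where "P = PiM UNIV \<nu>"
  interpret P: prob_space P unfolding P_def by (rule prob_space_PiM) (rule pv)
  have coord [measurable]: "(\<lambda>\<omega>. \<omega> i) \<in> borel_measurable P" for i
  proof -
    have "(\<lambda>\<omega>. \<omega> i) \<in> measurable P (\<nu> i)" unfolding P_def by measurable
    then show ?thesis by (simp cong: measurable_cong_sets)
  qed
  have dist_coord: "distr P borel (\<lambda>\<omega>. \<omega> i) = \<nu> i" for i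
  proof -
    have "distr P borel (\<lambda>\<omega>. \<omega> i) = distr P (\<nu> i) (\<lambda>\<omega>. \<omega> i)" by (rule distr_cong) auto
    then show ?thesis using distr_PiM_component[of UNIV \<nu> i] pv by (simp add: P_def)
  qed
  \<comment> \<open>The joint law of the coordinates is \<open>P\<close> itself, and the marginals
    are the \<nu> \<open>i\<close>; the rest adjusts sigma-algebras.\<close>
  have indep: "P.indep_vars (\<lambda>_. borel) (\<lambda>i \<omega>. \<omega> i) UNIV"
  proof (subst P.indep_vars_iff_distr_eq_PiM)
    have sets_eq: "sets (PiM UNIV (\<lambda>_. borel)) = sets P"
      unfolding P_def by (rule sets_PiM_cong) auto
    have "distr P (PiM UNIV (\<lambda>_. borel)) (\<lambda>x. \<lambda>i\<in>UNIV. x i) = distr P P (\<lambda>x. x)"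
      by (rule distr_cong) (auto simp: sets_eq)
    also have "\<dots> = P" by (rule distr_id)
    also have "\<dots> = PiM UNIV (\<lambda>i. distr P borel (\<lambda>\<omega>. \<omega> i))" by (simp only: dist_coord) (simp add: P_def)
    finally show "distr P (PiM UNIV (\<lambda>_. borel)) (\<lambda>x. \<lambda>i\<in>UNIV. x i)
        = PiM UNIV (\<lambda>i. distr P borel (\<lambda>\<omega>. \<omega> i))" .
  qed auto
  define S where "S k \<omega> = (\<Sum>i<k. \<omega> i)" for k and \<omega> :: "nat \<Rightarrow> real"
  \<comment> \<open>\<open>T\<close> is defined everywhere, but its value carries meaning only where
    the series converges, which is almost everywhere.\<close>
  define T where "T \<omega> = suminf \<omega>" for \<omega> :: "nat \<Rightarrow> real"
  have [measurable]: "S k \<in> borel_measurable P" for k unfolding S_def by measurable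
  have [measurable]: "T \<in> borel_measurable P" unfolding T_def by measurable
  have pc: "partial_convolution \<nu> k = distr P borel (S k)" for k
  proof (induction k)
    case 0
    then show ?case by (simp add: S_def)
  next
    case (Suc k)
    have "P.indep_var borel (\<lambda>\<omega>. \<omega> k) borel (\<lambda>\<omega>. \<Sum>i<k. \<omega> i)"
      by (rule P.indep_vars_sum) (auto intro: P.indep_vars_subset[OF indep])
    then have "distr P borel (\<lambda>\<omega>. \<omega> k + (\<Sum>i<k. \<omega> i))
        = (distr P borel (\<lambda>\<omega>. \<omega> k) \<star> distr P borel (\<lambda>\<omega>. \<Sum>i<k. \<omega> i))"
      by (rule P.sum_indep_random_variable) auto
    also have "\<dots> = (\<nu> k \<star> distr P borel (S k))" by (simp add: dist_coord S_def[abs_def])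
    also have "\<dots> = (distr P borel (S k) \<star> \<nu> k)"
      by (rule convolution_commutative)
         (auto intro!: prob_space.finite_measure pv P.prob_space_distr)
    finally show ?case using Suc by (simp add: S_def[abs_def] add.commute)
  qed
  have "AE \<omega> in P. \<forall>i. \<bar>\<omega> i\<bar> \<le> r i"
    unfolding AE_all_countable P_def
    by (intro allI AE_PiM_component[where P = "\<lambda>x. \<bar>x\<bar> \<le> r _"] pv supp) auto
  then have conv: "AE \<omega> in P. (\<lambda>k. S k \<omega>) \<longlonglongrightarrow> T \<omega> \<and> \<bar>T \<omega>\<bar> \<le> suminf r"
  proof eventually_elim
    case (elim \<omega>)
    have sm: "summable (\<lambda>i. \<bar>\<omega> i\<bar>)"
      by (rule summable_comparison_test[OF _ r]) (use elim in auto)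
    then have "summable \<omega>" by (rule summable_rabs_cancel)
    then have "(\<lambda>k. S k \<omega>) \<longlonglongrightarrow> T \<omega>" unfolding S_def T_def by (rule summable_LIMSEQ)
    moreover have "\<bar>T \<omega>\<bar> \<le> (\<Sum>i. \<bar>\<omega> i\<bar>)" unfolding T_def by (rule summable_rabs[OF sm])
    moreover have "\<dots> \<le> suminf r" by (rule suminf_le) (use elim sm r in auto)
    ultimately show ?case by linarith
  qed
  define \<mu> where "\<mu> = distr P borel T"
  have \<mu>: "real_distribution \<mu>" unfolding \<mu>_def by (rule P.real_distribution_distr) measurable
  \<comment> \<open>General in the range of \<open>f\<close>: real test functions give the weak
    limit, and \<open>iexp\<close> gives convergence of characteristic functions.\<close>
  have lim: "(\<lambda>k. \<integral>x. f x \<partial>partial_convolution \<nu> k) \<longlonglongrightarrow> (\<integral>x. f x \<partial>\<mu>)"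
    if f: "continuous_on UNIV f" "\<And>x. norm (f x) \<le> K"
    for f :: "real \<Rightarrow> 'c :: {banach, second_countable_topology}" and K
  proof -
    have [measurable]: "f \<in> borel_measurable borel" by (rule borel_measurable_continuous_onI[OF f(1)])
    have "(\<lambda>k. \<integral>\<omega>. f (S k \<omega>) \<partial>P) \<longlonglongrightarrow> (\<integral>\<omega>. f (T \<omega>) \<partial>P)"
    proof (rule integral_dominated_convergence)
      show "integrable P (\<lambda>_. K)" by simp
      show "AE \<omega> in P. (\<lambda>k. f (S k \<omega>)) \<longlonglongrightarrow> f (T \<omega>)"
        using conv
      proof eventually_elim
        case (elim \<omega>)
        have "isCont f (T \<omega>)" using f(1) by (simp add: continuous_on_eq_continuous_at)
        then show ?case by (rule isCont_tendsto_compose) (use elim in auto)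
      qed
    qed (use f in auto)
    then show ?thesis by (simp add: pc \<mu>_def integral_distr)
  qed
  have "infinite_convolution \<nu> \<mu>"
    unfolding infinite_convolution_def weak_limit_def
  proof (intro conjI allI impI \<mu>)
    fix f :: "real \<Rightarrow> real" assume f: "continuous_on UNIV f \<and> bounded (range f)"
    then obtain K where "\<And>x. norm (f x) \<le> K" by (auto simp: bounded_iff)
    then show "(\<lambda>k. \<integral>x. f x \<partial>partial_convolution \<nu> k) \<longlonglongrightarrow> (\<integral>x. f x \<partial>\<mu>)"
      using lim f by blast
  qed
  moreover have "AE x in \<mu>. \<bar>x\<bar> \<le> suminf r"
    unfolding \<mu>_def by (subst AE_distr_iff) (use conv in auto)
  moreover have "(\<lambda>k. \<Prod>i<k. char (\<nu> i) t) \<longlonglongrightarrow> char \<mu> t" for t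
  proof -
    have "char (partial_convolution \<nu> k) t = (\<Prod>i<k. char (\<nu> i) t)" for k
    proof -
      have "P.indep_vars (\<lambda>_. borel) (\<lambda>i \<omega>. \<omega> i) {..<k}"
        by (rule P.indep_vars_subset[OF indep]) auto
      from P.char_distr_sum[OF this, of t] show ?thesis
        by (simp add: pc S_def[abs_def] dist_coord)
    qed
    then have "(\<Prod>i<k. char (\<nu> i) t) = (\<integral>x. iexp (t * x) \<partial>partial_convolution \<nu> k)" for k
      by (simp add: char_def)
    moreover have "(\<lambda>k. \<integral>x. iexp (t * x) \<partial>partial_convolution \<nu> k) \<longlonglongrightarrow> (\<integral>x. iexp (t * x) \<partial>\<mu>)"
      by (rule lim[of _ 1]) (auto intro!: continuous_intros)
    ultimately show ?thesis by (simp add: char_def)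
  qed
  ultimately show ?thesis by blast
qed

section \<open>Tails along a digit sequence\<close>

lemma AE_uniform_dirac:
  assumes "finite A" "A \<noteq> {}" "\<And>x. x \<in> A \<Longrightarrow> Q x" "Measurable.pred borel Q"
  shows "AE x in uniform_dirac A. Q x"
  unfolding uniform_dirac_def using assms by (subst AE_distr_iff) (auto simp: AE_measure_pmf_iff)

text \<open>The first mask and the remaining tail are both evaluated at \<open>x / M k\<close>, and
  each deviates from 1 by at most \<open>2 * pi * C * \<bar>x / M k\<bar>\<close>. Unlike
  \<open>\<phi>_near_0\<close>, this gains from a large \<open>M k\<close>.\<close>

lemma (in digits) norm_\<phi>_ge: "norm (\<phi> k x) \<ge> 1 - 4 * pi * C * \<bar>x / M k\<bar>"
proof -
  define z where "z = x / M k"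
  have "1 - digit_mask (B k) z * \<phi> (Suc k) z = (digit_mask (B k) 0 - digit_mask (B k) z) * \<phi> (Suc k) z + (1 - \<phi> (Suc k) z)"
    by (simp add: algebra_simps digit_mask_0 B_fin B_ne)
  then have "norm (1 - digit_mask (B k) z * \<phi> (Suc k) z)
      \<le> norm (digit_mask (B k) 0 - digit_mask (B k) z) * norm (\<phi> (Suc k) z) + norm (1 - \<phi> (Suc k) z)"
    by (metis norm_mult norm_triangle_ineq)
  also have "\<dots> \<le> (2 * pi * C * \<bar>0 - z\<bar>) * 1 + 2 * pi * C * \<bar>0 - z\<bar>"
  proof (intro add_mono mult_mono norm_\<phi>_le_1)
    show "norm (digit_mask (B k) 0 - digit_mask (B k) z) \<le> 2 * pi * C * \<bar>0 - z\<bar>"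
      by (rule digit_mask_lipschitz) (auto simp: B_fin B_ne B_bound)
    show "norm (1 - \<phi> (Suc k) z) \<le> 2 * pi * C * \<bar>0 - z\<bar>"
      using \<phi>_lipschitz[of "Suc k" 0 z] by simp
  qed (use C_nonneg in auto)
  also have "\<dots> = 4 * pi * C * \<bar>z\<bar>" by simp
  finally have "norm (1 - digit_mask (B k) z * \<phi> (Suc k) z) \<le> 4 * pi * C * \<bar>z\<bar>" .
  then have "norm (1 - \<phi> k x) \<le> 4 * pi * C * \<bar>z\<bar>" by (simp only: \<phi>_step[of k x] z_def)
  then show ?thesis using norm_triangle_ineq2[of 1 "\<phi> k x"] by (simp add: z_def)
qed

lemma digits_pr_cong:
  assumes "digits M B C" "digits M' B' C"
    and eq: "\<And>i. i < l \<Longrightarrow> M (k + i) = M' i \<and> B (k + i) = B' i"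
  shows "digits.pr M B k (k + l) x = digits.pr M' B' 0 l x"
proof -
  interpret a: digits M B C by fact
  interpret b: digits M' B' C by fact
  have D: "a.D k (Suc (i + k)) = b.D 0 (Suc i)" if "i < l" for i
  proof -
    have "a.D k (Suc (i + k)) = (\<Prod>j\<in>{0 + k..<Suc i + k}. M j)" by (simp add: a.D_def)
    also have "\<dots> = (\<Prod>j\<in>{0..<Suc i}. M (j + k))" by (rule prod.shift_bounds_nat_ivl)
    also have "\<dots> = b.D 0 (Suc i)"
      unfolding b.D_def using that eq by (intro prod.cong refl) (auto simp: add.commute)
    finally show ?thesis .
  qed
  have "a.pr k (k + l) x = (\<Prod>i\<in>{0 + k..<l + k}. digit_mask (B i) (x / a.D k (Suc i)))"
    by (simp add: a.pr_def add.commute)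
  also have "\<dots> = (\<Prod>i\<in>{0..<l}. digit_mask (B (i + k)) (x / a.D k (Suc (i + k))))"
    by (rule prod.shift_bounds_nat_ivl)
  also have "\<dots> = b.pr 0 l x"
    unfolding b.pr_def using eq D by (intro prod.cong refl) (auto simp: add.commute)
  finally show ?thesis .
qed

context hadamard_digits
begin

section \<open>Criteria for nonvanishing tails and the deterministic theorem\<close>

lemma nonvanishing_of_shifts:
  assumes "\<And>x. x \<in> {0..1} \<Longrightarrow> \<exists>g\<in>G. norm (\<phi> k (x + g)) \<ge> e"
  shows "nonvanishing e k"
  unfolding nonvanishing_def
proof
  fix x :: real
  have "frac x \<in> {0..1}" by (simp add: less_imp_le[OF frac_lt_1])
  then obtain g where g: "g \<in> G" "norm (\<phi> k (frac x + g)) \<ge> e" using assms by blast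
  have "frac x + g = x + (g - real_of_int \<lfloor>x\<rfloor>)" by (simp add: frac_def)
  then show "\<exists>g\<in>G. norm (\<phi> k (x + g)) \<ge> e"
    using g G_diff[OF g(1) of_int_in_G] by metis
qed

text \<open>The threshold makes \<open>4 * pi * C * \<bar>x / M k\<bar>\<close> at most 1/2 on the
  unit interval, so the zero shift already works.\<close>

lemma nonvanishing_of_large:
  assumes "\<bar>real_of_int (M k)\<bar> \<ge> 8 * pi * C"
  shows "nonvanishing (1 / 2) k"
proof (rule nonvanishing_of_shifts)
  fix x :: real assume x: "x \<in> {0..1}"
  have "4 * pi * C * \<bar>x / M k\<bar> = 4 * pi * C * \<bar>x\<bar> / \<bar>real_of_int (M k)\<bar>" by (simp add: abs_divide)
  also have "\<dots> \<le> 4 * pi * C * 1 / \<bar>real_of_int (M k)\<bar>"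
    using x C_nonneg by (intro divide_right_mono mult_left_mono) auto
  also have "\<dots> \<le> 1 / 2" using assms M_nonzero[of k] by (simp add: field_simps)
  finally have "norm (\<phi> k x) \<ge> 1 / 2" using norm_\<phi>_ge[where k = k and x = x] by linarith
  then show "\<exists>g\<in>G. 1 / 2 \<le> norm (\<phi> k (x + g))"
    using of_int_in_G[of 0] by (intro bexI[of _ 0]) auto
qed

text \<open>The \<open>k\<close>-th factor is supported within \<open>C / 2 ^ Suc k\<close> of 0.
  Summability gives existence, bounded support and the Fourier transform \<open>\<phi> 0\<close>,
  which are the data for the Parseval criterion.\<close>

theorem spectral_infinite_convolution:
  assumes "0 < e" "e \<le> 1 / 2" and inf: "\<And>k0. \<exists>k\<ge>k0. nonvanishing e k"
    and \<nu>: "\<And>k. \<nu> k = uniform_dirac ((*) (inverse (real_of_int (D 0 (Suc k)))) ` real_of_int ` B k)"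
  shows "\<exists>\<mu>. infinite_convolution \<nu> \<mu> \<and> spectral_measure \<mu>"
proof -
  have "\<exists>\<mu>. infinite_convolution \<nu> \<mu> \<and> (AE x in \<mu>. \<bar>x\<bar> \<le> suminf (\<lambda>k. C * (1 / 2) ^ Suc k)) \<and>
    (\<forall>t. (\<lambda>k. \<Prod>i<k. char (\<nu> i) t) \<longlonglongrightarrow> char \<mu> t)"
  proof (rule infinite_convolution_exists)
    show "real_distribution (\<nu> k)" for k unfolding \<nu> by (rule real_distribution_uniform_dirac)
    show "summable (\<lambda>k. C * (1 / 2) ^ Suc k)"
      by (intro summable_mult summable_Suc_iff[THEN iffD2] summable_geometric) simp
    show "AE x in \<nu> k. \<bar>x\<bar> \<le> C * (1 / 2) ^ Suc k" for k
      unfolding \<nu>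
    proof (rule AE_uniform_dirac)
      fix x assume "x \<in> (*) (inverse (real_of_int (D 0 (Suc k)))) ` real_of_int ` B k"
      then obtain b where b: "b \<in> B k" "x = real_of_int b / D 0 (Suc k)" by (auto simp: field_simps)
      have "\<bar>x\<bar> \<le> \<bar>real_of_int b\<bar> / 2 ^ Suc k"
        unfolding b(2) using abs_div_D_le[of 0 "Suc k"] by simp
      also have "\<dots> \<le> C / 2 ^ Suc k" using B_bound[OF b(1)] by (intro divide_right_mono) auto
      finally show "\<bar>x\<bar> \<le> C * (1 / 2) ^ Suc k" by (simp add: power_divide)
    qed (auto simp: B_fin B_ne)
  qed
  then obtain \<mu> where \<mu>: "infinite_convolution \<nu> \<mu>" "AE x in \<mu>. \<bar>x\<bar> \<le> suminf (\<lambda>k. C * (1 / 2) ^ Suc k)"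
    "\<And>t. (\<lambda>k. \<Prod>i<k. char (\<nu> i) t) \<longlonglongrightarrow> char \<mu> t" by blast
  interpret \<mu>: real_distribution \<mu>
    using \<mu>(1) by (simp add: infinite_convolution_def weak_limit_def)
  have four: "fourier \<mu> t = \<phi> 0 t" for t
  proof (rule LIMSEQ_unique)
    have "(\<Prod>i<k. char (\<nu> i) (2 * pi * t)) = pr 0 k t" for k
    proof -
      have "char (\<nu> i) (2 * pi * t) = digit_mask (B i) (t / D 0 (Suc i))" for i
        unfolding fourier_eq_char[symmetric] \<nu>
        by (subst fourier_uniform_dirac_scaled) (auto simp: B_fin B_ne D_nonzero field_simps)
      then show ?thesis by (simp add: pr_def lessThan_atLeast0)
    qed
    then show "(\<lambda>k. pr 0 k t) \<longlonglongrightarrow> fourier \<mu> t" using \<mu>(3)[of "2 * pi * t"] by (simp add: fourier_eq_char)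
    show "(\<lambda>k. pr 0 k t) \<longlonglongrightarrow> \<phi> 0 t" by (rule pr_tendsto)
  qed
  from exists_spectrum_\<phi>[OF assms(1-3)]
  obtain \<Lambda> where \<Lambda>: "\<forall>x. (\<forall>F. finite F \<and> F \<subseteq> \<Lambda> \<longrightarrow> (\<Sum>\<xi>\<in>F. (norm (\<phi> 0 (x + \<xi>)))\<^sup>2) \<le> 1) \<and>
      (\<forall>\<eta>>0. \<exists>F. finite F \<and> F \<subseteq> \<Lambda> \<and> (\<Sum>\<xi>\<in>F. (norm (\<phi> 0 (x + \<xi>)))\<^sup>2) > 1 - \<eta>)"
    by (elim exE) (rule that)
  have "spectral_measure \<mu>"
  proof (rule \<mu>.spectral_measure_of_parseval[OF \<mu>(2), of \<Lambda>])
    show "(\<Sum>\<xi>\<in>F. (cmod (fourier \<mu> (x + \<xi>)))\<^sup>2) \<le> 1" if "finite F" "F \<subseteq> \<Lambda>" for x F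
      unfolding four by (rule \<Lambda>[THEN spec, THEN conjunct1, THEN spec, THEN mp]) (use that in blast)
    show "\<exists>F. finite F \<and> F \<subseteq> \<Lambda> \<and> (\<Sum>\<xi>\<in>F. (cmod (fourier \<mu> (x + \<xi>)))\<^sup>2) > 1 - \<eta>" if "\<eta> > 0" for x \<eta>
      unfolding four by (rule \<Lambda>[THEN spec, THEN conjunct2, THEN spec, THEN mp, OF that])
  qed
  then show ?thesis using \<mu>(1) by blast
qed

end

text \<open>The tail of the given sequence at \<open>k\<close> and the model product share their
  first \<open>l\<close> masks, and each is within \<open>2 * pi * C * (R + 1) / 2 ^ l\<close> of
  that common finite product. The two errors together cost at most half of \<open>e\<close>.
  \<open>sub\<close> makes the shifts of the model legitimate for the given sequence.\<close>

lemma nonvanishing_of_matching_block: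
  assumes "hadamard_digits M B C" "hadamard_digits M' B' C"
    and eq: "\<And>i. i < l \<Longrightarrow> M (k + i) = M' i \<and> B (k + i) = B' i"
    and sub: "digits.G B' \<subseteq> digits.G B"
    and shift: "\<And>x. x \<in> {0..1} \<Longrightarrow> \<exists>g\<in>digits.G B'. \<bar>g\<bar> \<le> R \<and> norm (digits.\<phi> M' B' 0 (x + g)) \<ge> e"
    and l: "2 * (2 * pi * C * (R + 1) / 2 ^ l) \<le> e / 2"
  shows "hadamard_digits.nonvanishing M B (e / 2) k"
proof -
  interpret a: hadamard_digits M B C by fact
  interpret b: hadamard_digits M' B' C by fact
  show ?thesis
  proof (rule a.nonvanishing_of_shifts)
    fix x :: real assume x: "x \<in> {0..1}"
    then obtain g where g: "g \<in> b.G" "\<bar>g\<bar> \<le> R" "norm (b.\<phi> 0 (x + g)) \<ge> e" using shift by blast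
    have arith: "d \<ge> e / 2" if "w \<le> v + u + d" "u \<le> a" "v \<le> a" "a \<le> b" "w \<ge> e" "2 * b \<le> e / 2"
      for a b d u v w :: real
      using that by linarith
    have pr_eq: "a.pr k (k + l) (x + g) = b.pr 0 l (x + g)"
      by (rule digits_pr_cong[OF a.digits_axioms b.digits_axioms eq])
    have "norm (a.\<phi> k (x + g)) \<ge> e / 2"
    proof (rule arith)
      show "norm (b.\<phi> 0 (x + g)) \<le> norm (b.\<phi> 0 (x + g) - b.pr 0 l (x + g))
          + norm (a.\<phi> k (x + g) - a.pr k (k + l) (x + g)) + norm (a.\<phi> k (x + g))"
        using norm_triangle_ineq[of "b.\<phi> 0 (x + g) - b.pr 0 l (x + g)" "b.pr 0 l (x + g) - a.\<phi> k (x + g)"]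
          norm_triangle_ineq[of "b.\<phi> 0 (x + g) - a.\<phi> k (x + g)" "a.\<phi> k (x + g)"]
        by (simp add: pr_eq norm_minus_commute)
      show "norm (a.\<phi> k (x + g) - a.pr k (k + l) (x + g)) \<le> 2 * pi * C * \<bar>x + g\<bar> / 2 ^ l"
        using a.\<phi>_tail[of k "k + l" "x + g"] by simp
      show "norm (b.\<phi> 0 (x + g) - b.pr 0 l (x + g)) \<le> 2 * pi * C * \<bar>x + g\<bar> / 2 ^ l"
        using b.\<phi>_tail[of 0 l "x + g"] by simp
      show "2 * pi * C * \<bar>x + g\<bar> / 2 ^ l \<le> 2 * pi * C * (R + 1) / 2 ^ l"
        using x g a.C_nonneg by (intro divide_right_mono mult_left_mono) auto
    qed (use g l in auto)
    then show "\<exists>g\<in>a.G. norm (a.\<phi> k (x + g)) \<ge> e / 2" using g(1) sub by blast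
  qed
qed

text \<open>The limit sequence is grown letter by letter, keeping each prefix a word that occurs infinitely
  often in \<open>n\<close>.\<close>

lemma recurrent_limit_sequence:
  fixes n :: "nat \<Rightarrow> nat"
  assumes "\<And>k. n k \<le> K"
  shows "\<exists>n'. \<forall>l. infinite {k. \<forall>i<l. n (k + i) = n' i}"
proof -
  define inf where "inf w \<longleftrightarrow> infinite {k. \<forall>i<length w. n (k + i) = w ! i}" for w :: "nat list"
  have ext: "\<exists>a. inf (w @ [a])" if "inf w" for w
  proof (rule ccontr)
    assume neg: "\<nexists>a. inf (w @ [a])"
    \<comment> \<open>Pigeonhole: each occurrence of \<open>w\<close> is followed by one of the
      finitely many letters up to \<open>K\<close>.\<close>
    have "{k. \<forall>i<length w. n (k + i) = w ! i}
        \<subseteq> (\<Union>a\<in>{..K}. {k. \<forall>i<length (w @ [a]). n (k + i) = (w @ [a]) ! i})"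
    proof
      fix k assume k: "k \<in> {k. \<forall>i<length w. n (k + i) = w ! i}"
      then have "k \<in> {k'. \<forall>i<length (w @ [n (k + length w)]). n (k' + i) = (w @ [n (k + length w)]) ! i}"
        by (auto simp: nth_append less_Suc_eq)
      then show "k \<in> (\<Union>a\<in>{..K}. {k. \<forall>i<length (w @ [a]). n (k + i) = (w @ [a]) ! i})"
        using assms by blast
    qed
    moreover have "finite (\<Union>a\<in>{..K}. {k. \<forall>i<length (w @ [a]). n (k + i) = (w @ [a]) ! i})"
      using neg by (auto simp: inf_def)
    ultimately show False using that finite_subset unfolding inf_def by blast
  qed
  have "\<exists>f. \<forall>j. (inf (f j) \<and> length (f j) = j) \<and> (\<exists>a. f (Suc j) = f j @ [a])"
  proof (rule dependent_nat_choice[where P = "\<lambda>j w. inf w \<and> length w = j" and Q = "\<lambda>_ w w'. \<exists>a. w' = w @ [a]"])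
    show "\<exists>w. inf w \<and> length w = 0" by (auto simp: inf_def)
  qed (use ext in fastforce)
  then obtain f where f: "\<And>j. inf (f j)" "\<And>j. length (f j) = j" "\<And>j. \<exists>a. f (Suc j) = f j @ [a]"
    by blast
  have nth: "f j ! i = f (Suc i) ! i" if "i < j" for i j
    using that
  proof (induction j)
    case (Suc j)
    obtain a where a: "f (Suc j) = f j @ [a]" using f(3) by blast
    show ?case
    proof (cases "i = j")
      case False
      then show ?thesis using Suc a f(2) by (simp add: nth_append)
    qed simp
  qed simp
  have "infinite {k. \<forall>i<l. n (k + i) = f (Suc i) ! i}" for l
  proof -
    have "{k. \<forall>i<l. n (k + i) = f (Suc i) ! i} = {k. \<forall>i<length (f l). n (k + i) = f l ! i}"
      using nth[of _ l] f(2) by auto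
    then show ?thesis using f(1)[of l] by (simp add: inf_def)
  qed
  then show ?thesis by (intro exI[of _ "\<lambda>i. f (Suc i) ! i"] allI)
qed

section \<open>Bernoulli measures\<close>

locale bernoulli = prob_space P for P :: "(nat \<Rightarrow> nat) measure" +
  fixes m :: nat and p :: "nat \<Rightarrow> real"
  assumes sets_P: "sets P = sets (restrict_space borel (symbol_space m))"
    and p_nonneg: "j \<in> {1..m} \<Longrightarrow> p j \<ge> 0" and p_sum: "(\<Sum>j\<in>{1..m}. p j) = 1"
    and prob_cylinder: "(\<And>j. j < l \<Longrightarrow> i j \<in> {1..m}) \<Longrightarrow> prob (cylinder m l i) = (\<Prod>j<l. p (i j))"
begin

lemma space_P: "space P = symbol_space m"
  using sets_eq_imp_space_eq[OF sets_P] by (simp add: space_restrict_space)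

lemma symbol_in_range: "\<omega> \<in> space P \<Longrightarrow> \<omega> k \<in> {1..m}"
  by (simp add: space_P symbol_space_def)

lemma measurable_coordinate: "{\<omega> \<in> space P. \<omega> j = a} \<in> events"
proof -
  have "(\<lambda>\<omega> :: nat \<Rightarrow> nat. \<omega> j) \<in> borel_measurable borel"
    by (intro borel_measurable_continuous_onI continuous_on_product_coordinates)
  then have "(\<lambda>\<omega>. \<omega> j) \<in> borel_measurable P"
    by (subst measurable_cong_sets[OF sets_P refl]) (rule measurable_restrict_space1)
  then have "(\<lambda>\<omega>. \<omega> j) -` {a} \<inter> space P \<in> events"
    by (rule measurable_sets) simp
  moreover have "(\<lambda>\<omega>. \<omega> j) -` {a} \<inter> space P = {\<omega> \<in> space P. \<omega> j = a}" by auto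
  ultimately show ?thesis by simp
qed

definition match :: "(nat \<Rightarrow> nat) \<Rightarrow> nat \<Rightarrow> nat \<Rightarrow> (nat \<Rightarrow> nat) set" where
  "match \<eta> l k = {\<omega> \<in> space P. \<forall>i<l. \<omega> (k + i) = \<eta> i}"

lemma match_events [measurable]: "match \<eta> l k \<in> events"
proof -
  have "match \<eta> l k = {\<omega> \<in> space P. \<forall>i\<in>{..<l}. \<omega> (k + i) = \<eta> i}" by (auto simp: match_def)
  also have "\<dots> \<in> events" by (rule sets.sets_Collect_finite_All) (auto intro: measurable_coordinate)
  finally show ?thesis .
qed

lemma cylinder_eq_match: "cylinder m l i = match i l 0"
  by (auto simp: cylinder_def match_def space_P)

text \<open>Independence of a block at position \<open>n\<close> from an event decided by the first
  \<open>n\<close> symbols, derived from cylinder probabilities alone: \<open>E\<close> is a finite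
  disjoint union of cylinders, and appending the block to a word \<open>w\<close> gives the longer
  cylinder of \<open>ap w\<close>.\<close>

lemma prob_inter_match:
  assumes "E \<subseteq> space P"
    and dep: "\<And>\<omega> \<omega>'. \<omega> \<in> E \<Longrightarrow> \<omega>' \<in> space P \<Longrightarrow> (\<And>j. j < n \<Longrightarrow> \<omega>' j = \<omega> j) \<Longrightarrow> \<omega>' \<in> E"
    and \<eta>: "\<And>i. i < l \<Longrightarrow> \<eta> i \<in> {1..m}"
  shows "prob (E \<inter> match \<eta> l n) = prob E * (\<Prod>i<l. p (\<eta> i))"
proof -
  define words where "words = (\<lambda>\<omega>. restrict \<omega> {..<n}) ` E"
  have words_sub: "words \<subseteq> PiE {..<n} (\<lambda>_. {1..m})"
  proof
    fix w assume "w \<in> words"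
    then obtain \<omega> where "\<omega> \<in> E" "w = restrict \<omega> {..<n}" by (auto simp: words_def)
    then show "w \<in> PiE {..<n} (\<lambda>_. {1..m})"
      using symbol_in_range[of \<omega>] assms(1) by auto
  qed
  have fin: "finite words" by (rule finite_subset[OF words_sub finite_PiE]) auto
  have word_range: "w j \<in> {1..m}" if "w \<in> words" "j < n" for w j
    using words_sub that by (auto simp: PiE_def Pi_def)
  define ap where "ap w j = (if j < n then w j else \<eta> (j - n))" for w :: "nat \<Rightarrow> nat" and j
  have E_Un: "E = (\<Union>w\<in>words. cylinder m n w)"
  proof (intro equalityI subsetI)
    fix \<omega> assume "\<omega> \<in> E"
    then show "\<omega> \<in> (\<Union>w\<in>words. cylinder m n w)"
      using assms(1) by (auto simp: words_def cylinder_eq_match match_def)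
  next
    fix \<omega> assume "\<omega> \<in> (\<Union>w\<in>words. cylinder m n w)"
    then obtain \<omega>0 where "\<omega>0 \<in> E" "\<omega> \<in> space P" "\<forall>j<n. \<omega> j = \<omega>0 j"
      by (auto simp: words_def cylinder_eq_match match_def)
    then show "\<omega> \<in> E" using dep by blast
  qed
  have ap_cyl: "cylinder m (n + l) (ap w) = cylinder m n w \<inter> match \<eta> l n" for w
  proof (intro equalityI subsetI)
    fix \<omega> assume \<omega>: "\<omega> \<in> cylinder m (n + l) (ap w)"
    have "\<omega> (n + i) = \<eta> i" if "i < l" for i
      using \<omega> that by (auto simp: cylinder_def ap_def dest: spec[of _ "n + i"])
    then show "\<omega> \<in> cylinder m n w \<inter> match \<eta> l n"
      using \<omega> by (auto simp: cylinder_def match_def space_P ap_def)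
  next
    fix \<omega> assume \<omega>: "\<omega> \<in> cylinder m n w \<inter> match \<eta> l n"
    have "\<omega> j = ap w j" if "j < n + l" for j
    proof (cases "j < n")
      case False
      then have "j - n < l" using that by simp
      then have "\<omega> (n + (j - n)) = \<eta> (j - n)" using \<omega> unfolding match_def by blast
      then show ?thesis using False by (simp add: ap_def)
    qed (use \<omega> in \<open>auto simp: cylinder_def ap_def\<close>)
    then show "\<omega> \<in> cylinder m (n + l) (ap w)" using \<omega> by (auto simp: cylinder_def)
  qed
  have disj: "disjoint_family_on (cylinder m n) words"
    unfolding disjoint_family_on_def
  proof (intro ballI impI, rule ccontr)
    fix w w' assume w: "w \<in> words" "w' \<in> words" "w \<noteq> w'" "cylinder m n w \<inter> cylinder m n w' \<noteq> {}"
    then have "w j = w' j" if "j \<in> {..<n}" for j using that by (auto simp: cylinder_def)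
    moreover have "w \<in> PiE {..<n} (\<lambda>_. {1..m})" "w' \<in> PiE {..<n} (\<lambda>_. {1..m})"
      using w words_sub by auto
    ultimately have "w = w'" by (intro PiE_ext)
    then show False using w by simp
  qed
  have prob_ap: "(\<Prod>j<n + l. p (ap w j)) = (\<Prod>j<n. p (w j)) * (\<Prod>i<l. p (\<eta> i))" for w
    by (induction l) (simp_all add: ap_def mult.assoc)
  have "prob E = (\<Sum>w\<in>words. prob (cylinder m n w))"
    by (subst E_Un, rule finite_measure_finite_Union[OF fin _ disj]) (auto simp: cylinder_eq_match)
  also have "\<dots> = (\<Sum>w\<in>words. \<Prod>j<n. p (w j))"
    by (intro sum.cong refl prob_cylinder word_range)
  finally have 1: "prob E = (\<Sum>w\<in>words. \<Prod>j<n. p (w j))" .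
  have "prob (E \<inter> match \<eta> l n) = prob (\<Union>w\<in>words. cylinder m (n + l) (ap w))"
    by (subst E_Un) (simp add: ap_cyl Int_UN_distrib2)
  also have "\<dots> = (\<Sum>w\<in>words. prob (cylinder m (n + l) (ap w)))"
    by (rule finite_measure_finite_Union[OF fin])
       (use disj in \<open>auto simp: cylinder_eq_match disjoint_family_on_def ap_cyl[unfolded cylinder_eq_match]\<close>)
  also have "\<dots> = (\<Sum>w\<in>words. \<Prod>j<n + l. p (ap w j))"
    by (intro sum.cong refl prob_cylinder) (auto simp: ap_def word_range \<eta> simp del: atLeastAtMost_iff One_nat_def)
  also have "\<dots> = prob E * (\<Prod>i<l. p (\<eta> i))" by (simp add: prob_ap 1 sum_distrib_right)
  finally show ?thesis .
qed

text \<open>Allows symbols of probability 0 to be discarded, so that every remaining finite word has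
  positive probability.\<close>

lemma AE_positive_symbols: "AE \<omega> in P. \<forall>k. \<omega> k \<in> {j \<in> {1..m}. p j > 0}"
  unfolding AE_all_countable
proof
  fix k
  have "AE \<omega> in P. \<forall>j\<in>{j \<in> {1..m}. p j = 0}. \<omega> \<notin> match (\<lambda>_. j) 1 k"
  proof (rule AE_finite_allI)
    fix j assume j: "j \<in> {j \<in> {1..m}. p j = 0}"
    have "prob (space P \<inter> match (\<lambda>_. j) 1 k) = 0"
      by (subst prob_inter_match) (use j in auto)
    then have "prob (match (\<lambda>_. j) 1 k) = 0"
      by (simp add: match_def Int_def)
    then show "AE \<omega> in P. \<omega> \<notin> match (\<lambda>_. j) 1 k" using prob_eq_0[OF match_events] by blast
  qed simp
  then show "AE \<omega> in P. \<omega> k \<in> {j \<in> {1..m}. p j > 0}"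
    using AE_space
  proof eventually_elim
    case (elim \<omega>)
    have "\<omega> k \<in> {1..m}" using symbol_in_range elim by blast
    moreover have "p (\<omega> k) \<noteq> 0"
    proof
      assume "p (\<omega> k) = 0"
      then have "\<omega> \<notin> match (\<lambda>_. \<omega> k) 1 k" using elim(1) \<open>\<omega> k \<in> {1..m}\<close> by blast
      then show False using elim(2) by (simp add: match_def)
    qed
    ultimately show ?case using p_nonneg[of "\<omega> k"] by auto
  qed
qed

text \<open>Positions at least \<open>l\<close> apart give disjoint, hence independent, blocks. Each
  matches with the same probability \<open>q > 0\<close>, so \<open>r\<close> successive failures
  have probability \<open>(1 - q) ^ r\<close>.\<close>

lemma AE_exists_match:
  assumes \<eta>: "\<And>i. \<eta> i \<in> {j \<in> {1..m}. p j > 0}" and k: "\<And>s. k s + l \<le> k (Suc s)"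
  shows "AE \<omega> in P. \<exists>s. \<omega> \<in> match \<eta> l (k s)"
proof -
  define q where "q = (\<Prod>i<l. p (\<eta> i))"
  have q0: "q > 0" unfolding q_def using \<eta> by (intro prod_pos) auto
  define E where "E r = space P - (\<Union>s<r. match \<eta> l (k s))" for r
  have E_events [measurable]: "E r \<in> events" for r unfolding E_def by measurable
  have k_mono: "k s + l \<le> k r" if "s < r" for s r
    using that
  proof (induction r)
    case (Suc r)
    then show ?case using k[of r] k[of s] by (cases "s = r") auto
  qed simp
  have prob_E: "prob (E r) = (1 - q) ^ r" for r
  proof (induction r)
    case 0
    then show ?case by (simp add: E_def prob_space)
  next
    case (Suc r)
    have "prob (E r \<inter> match \<eta> l (k r)) = prob (E r) * q"
      unfolding q_def
    proof (rule prob_inter_match)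
      fix \<omega> \<omega>' assume \<omega>: "\<omega> \<in> E r" "\<omega>' \<in> space P" "\<And>j. j < k r \<Longrightarrow> \<omega>' j = \<omega> j"
      have "\<omega>' \<notin> match \<eta> l (k s)" if "s < r" for s
      proof
        assume "\<omega>' \<in> match \<eta> l (k s)"
        moreover have "\<omega>' (k s + i) = \<omega> (k s + i)" if "i < l" for i
          using k_mono[OF \<open>s < r\<close>] that by (intro \<omega>(3)) simp
        ultimately have "\<omega> \<in> match \<eta> l (k s)" using \<omega>(1) by (auto simp: match_def E_def)
        then show False using \<omega>(1) that by (auto simp: E_def)
      qed
      then show "\<omega>' \<in> E r" using \<omega>(2) by (auto simp: E_def)
    qed (use \<eta> in \<open>auto simp: E_def\<close>)
    moreover have "E (Suc r) = E r - match \<eta> l (k r)" by (auto simp: E_def lessThan_Suc)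
    moreover have "prob (E r - match \<eta> l (k r)) = prob (E r) - prob (E r \<inter> match \<eta> l (k r))"
      by (rule finite_measure_Diff') auto
    ultimately show ?case using Suc by (simp add: algebra_simps)
  qed
  define U where "U = space P - (\<Union>s. match \<eta> l (k s))"
  have U_events: "U \<in> events" unfolding U_def by measurable
  \<comment> \<open>\<open>q \<le> 1\<close> is read off from the event \<open>E 1\<close>, whose
    probability is \<open>1 - q\<close>.\<close>
  have "1 - q \<ge> 0" using prob_E[of 1] measure_nonneg[of P "E 1"] by simp
  have "(\<lambda>r. (1 - q) ^ r) \<longlonglongrightarrow> 0" using \<open>1 - q \<ge> 0\<close> q0 by (intro LIMSEQ_realpow_zero) auto
  moreover have "prob U \<le> (1 - q) ^ r" for r
    unfolding prob_E[symmetric] by (rule finite_measure_mono) (auto simp: U_def E_def)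
  ultimately have "prob U \<le> 0" by (intro LIMSEQ_le_const) auto
  then have "prob U = 0" using measure_nonneg[of P U] by simp
  then have "AE \<omega> in P. \<omega> \<notin> U" using prob_eq_0[OF U_events] by blast
  then show ?thesis using AE_space by eventually_elim (auto simp: U_def)
qed

text \<open>For each of the countably many \<open>k0\<close>, a sequence in \<open>S\<close> beyond
  \<open>k0\<close> with gaps at least \<open>l\<close> is extracted.\<close>

lemma AE_infinitely_many_matches:
  assumes \<eta>: "\<And>i. \<eta> i \<in> {j \<in> {1..m}. p j > 0}" and S: "infinite S"
  shows "AE \<omega> in P. \<forall>k0. \<exists>k\<ge>k0. k \<in> S \<and> (\<forall>i<l. \<omega> (k + i) = \<eta> i)"
  unfolding AE_all_countable
proof
  fix k0
  have S': "\<exists>k\<in>S. k \<ge> b" for b using S unfolding infinite_nat_iff_unbounded_le by blast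
  have "\<exists>k. \<forall>s. (k s \<in> S \<and> k s \<ge> k0) \<and> k s + l \<le> k (Suc s)"
  proof (rule dependent_nat_choice[where P = "\<lambda>_ a. a \<in> S \<and> a \<ge> k0" and Q = "\<lambda>_ a b. a + l \<le> b"])
    show "\<exists>a. a \<in> S \<and> a \<ge> k0" using S' by blast
    fix a assume "a \<in> S \<and> a \<ge> k0"
    then show "\<exists>b. (b \<in> S \<and> b \<ge> k0) \<and> a + l \<le> b" using S'[of "a + l"] by fastforce
  qed
  then obtain k where k: "\<And>s. k s \<in> S" "\<And>s. k s \<ge> k0" "\<And>s. k s + l \<le> k (Suc s)" by blast
  from AE_exists_match[where \<eta> = \<eta> and k = k and l = l, OF \<eta> k(3)]
  show "AE \<omega> in P. \<exists>k\<ge>k0. k \<in> S \<and> (\<forall>i<l. \<omega> (k + i) = \<eta> i)"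
    by eventually_elim (use k in \<open>auto simp: match_def\<close>)
qed

end

section \<open>Random digit sequences\<close>

locale admissible_family =
  fixes N :: "nat \<Rightarrow> int" and B :: "nat \<Rightarrow> int set" and n :: "nat \<Rightarrow> nat" and J :: "nat set"
  assumes J_fin: "finite J" and J_ne: "J \<noteq> {}"
    and adm: "j \<in> J \<Longrightarrow> admissible_pair (N j) (B j)"
    and n_pos: "n k \<ge> 1"
begin

text \<open>One digit bound for all symbols, since comparing \<omega> with the model sequence
  requires the same constant for both.\<close>

definition C :: real where
  "C = Max ((\<lambda>b. \<bar>real_of_int b\<bar>) ` (\<Union>j\<in>J. B j))"

lemma hadamard_digits_of_symbols:
  assumes "\<And>k. \<omega> k \<in> J" "\<And>k. n' k \<ge> 1"
  shows "hadamard_digits (\<lambda>k. N (\<omega> k) ^ n' k) (\<lambda>k. B (\<omega> k)) C"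
proof
  have adm': "\<bar>N (\<omega> k)\<bar> \<ge> 2" "finite (B (\<omega> k))" "card (B (\<omega> k)) \<ge> 2" for k
    using adm[OF assms(1)[of k]] by (auto simp: admissible_pair_def)
  fix k
  have "\<bar>N (\<omega> k)\<bar> ^ 1 \<le> \<bar>N (\<omega> k)\<bar> ^ n' k"
    using adm'(1)[of k] assms(2)[of k] by (intro power_increasing) auto
  then show "\<bar>N (\<omega> k) ^ n' k\<bar> \<ge> 2" using adm'(1)[of k] by (simp add: power_abs)
  show "finite (B (\<omega> k))" by (rule adm')
  show "B (\<omega> k) \<noteq> {}" using adm'(3)[of k] by auto
  show "\<bar>real_of_int b\<bar> \<le> C" if "b \<in> B (\<omega> k)" for b
  proof -
    have "finite (\<Union>j\<in>J. B j)" using J_fin adm by (auto simp: admissible_pair_def)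
    then show ?thesis unfolding C_def using that assms(1)[of k] by (intro Max_ge) auto
  qed
  obtain L where "hadamard (N (\<omega> k)) (B (\<omega> k)) L"
    using admissible_pair_hadamard[OF adm[OF assms(1)]] by blast
  then show "\<exists>L. hadamard (N (\<omega> k) ^ n' k) (B (\<omega> k)) L"
    by (rule hadamard_power) (use assms(2)[of k] adm'(1)[of k] in auto)
qed

lemma spectral_of_nonvanishing:
  assumes \<omega>: "\<And>k. \<omega> k \<in> J" and e: "0 < e" "e \<le> 1 / 2"
    and inf: "\<And>k0. \<exists>k\<ge>k0. hadamard_digits.nonvanishing (\<lambda>k. N (\<omega> k) ^ n k) (\<lambda>k. B (\<omega> k)) e k"
  shows "\<exists>\<mu>. infinite_convolution (factor_measure N B n \<omega>) \<mu> \<and> spectral_measure \<mu>"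
proof -
  interpret hadamard_digits "\<lambda>k. N (\<omega> k) ^ n k" "\<lambda>k. B (\<omega> k)" C
    by (rule hadamard_digits_of_symbols) (use \<omega> n_pos in auto)
  show ?thesis
  proof (rule spectral_infinite_convolution[OF e inf])
    fix k
    have "(\<Prod>i\<le>k. real_of_int (N (\<omega> i)) powi (- int (n i))) = inverse (real_of_int (D 0 (Suc k)))"
      by (simp add: D_def power_int_minus prod_inversef[symmetric] o_def atLeast0LessThan lessThan_Suc_atMost)
    then show "factor_measure N B n \<omega> k
        = uniform_dirac ((*) (inverse (real_of_int (D 0 (Suc k)))) ` real_of_int ` B (\<omega> k))"
      by (simp only: factor_measure_def)
  qed
qed

lemma spectral_of_unbounded:
  assumes \<omega>: "\<And>k. \<omega> k \<in> J" and unb: "\<nexists>K. \<forall>k. n k \<le> K"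
  shows "\<exists>\<mu>. infinite_convolution (factor_measure N B n \<omega>) \<mu> \<and> spectral_measure \<mu>"
proof (rule spectral_of_nonvanishing[OF \<omega>, of "1 / 2"])
  interpret hadamard_digits "\<lambda>k. N (\<omega> k) ^ n k" "\<lambda>k. B (\<omega> k)" C
    by (rule hadamard_digits_of_symbols) (use \<omega> n_pos in auto)
  fix k0
  have "\<exists>k\<ge>k0. n k \<ge> K" for K
  proof (rule ccontr)
    assume neg: "\<not> (\<exists>k\<ge>k0. K \<le> n k)"
    have "n k \<le> max K (Max (n ` {..k0}))" for k
    proof (cases "k \<ge> k0")
      case True
      then have "n k < K" using neg by (meson not_le)
      then show ?thesis by simp
    qed (auto intro: max.coboundedI2)
    then show False using unb by blast
  qed
  then obtain k where k: "k \<ge> k0" "n k \<ge> nat \<lceil>8 * pi * C\<rceil>" by blast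
  have "8 * pi * C \<le> real (n k)" using k(2) by linarith
  also have "\<dots> \<le> 2 ^ n k" using of_nat_less_two_power[of "n k", where 'a = real] by linarith
  also have "\<dots> \<le> \<bar>real_of_int (N (\<omega> k))\<bar> ^ n k"
  proof (rule power_mono)
    have "\<bar>N (\<omega> k)\<bar> \<ge> 2" using adm[OF \<omega>[of k]] by (simp add: admissible_pair_def)
    then show "2 \<le> \<bar>real_of_int (N (\<omega> k))\<bar>" by linarith
  qed simp
  finally have "nonvanishing (1 / 2) k" by (intro nonvanishing_of_large) (simp add: power_abs)
  then show "\<exists>k\<ge>k0. nonvanishing (1 / 2) k" using k(1) by blast
qed auto

text \<open>\<eta>, \<open>l\<close> and \<open>S\<close> are produced before \<omega>, so the
  probabilistic part only has to treat one word and one set of positions.\<close>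

lemma spectral_of_bounded:
  assumes bdd: "\<And>k. n k \<le> K"
  obtains \<eta> l S where "\<And>i. \<eta> i \<in> J" "infinite S"
    "\<And>\<omega>. (\<And>k. \<omega> k \<in> J) \<Longrightarrow> (\<And>k0. \<exists>k\<ge>k0. k \<in> S \<and> (\<forall>i<l. \<omega> (k + i) = \<eta> i)) \<Longrightarrow>
      \<exists>\<mu>. infinite_convolution (factor_measure N B n \<omega>) \<mu> \<and> spectral_measure \<mu>"
proof -
  obtain n' where n': "\<And>l. infinite {k. \<forall>i<l. n (k + i) = n' i}"
    using recurrent_limit_sequence[of n, OF bdd] by blast
  have n'_pos: "n' i \<ge> 1" for i
  proof -
    obtain k where "\<forall>j<Suc i. n (k + j) = n' j" using n'[of "Suc i"] not_finite_existsD by blast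
    then show ?thesis using n_pos[of "k + i"] by (metis lessI)
  qed
  obtain js where js: "set js = J" using finite_list[OF J_fin] by blast
  then have len: "length js > 0" using J_ne by auto
  \<comment> \<open>Cycling through an enumeration of \<open>J\<close> makes every symbol
    recur.\<close>
  define \<eta> where "\<eta> i = js ! (i mod length js)" for i
  have \<eta>: "\<eta> i \<in> J" for i unfolding \<eta>_def js[symmetric] by (rule nth_mem[OF mod_less_divisor[OF len]])
  have recur: "\<exists>i\<ge>k. \<eta> i = j" if j: "j \<in> J" for j k
  proof -
    obtain a where a: "a < length js" "js ! a = j" using j unfolding js[symmetric] in_set_conv_nth by blast
    then have "\<eta> (a + k * length js) = j" by (simp add: \<eta>_def)
    moreover have "a + k * length js \<ge> k"
      using mult_le_mono2[OF Suc_leI[OF len], of k] by linarith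
    ultimately show ?thesis by blast
  qed
  interpret b: hadamard_digits "\<lambda>k. N (\<eta> k) ^ n' k" "\<lambda>k. B (\<eta> k)" C
    by (rule hadamard_digits_of_symbols) (use \<eta> n'_pos in auto)
  have "\<exists>i'\<ge>k. B (\<eta> i') = B (\<eta> i)" for i k using recur[OF \<eta>[of i], of k] by metis
  then obtain e R where e: "e > 0" and eR: "\<And>x. x \<in> {0..1} \<Longrightarrow>
      \<exists>g\<in>b.G. \<bar>g\<bar> \<le> R \<and> norm (b.\<phi> 0 (x + g)) \<ge> e"
    using b.exists_uniform_nonzero_shift by blast
  \<comment> \<open>\<open>spectral_of_nonvanishing\<close> is applied with \<open>e / 2\<close>,
    which must not exceed 1/2.\<close>
  have e1: "e \<le> 1"
  proof -
    obtain g where "norm (b.\<phi> 0 (0 + g)) \<ge> e" using eR[of 0] by auto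
    then show ?thesis using b.norm_\<phi>_le_1 order_trans by blast
  qed
  have "(\<lambda>l. 2 * (2 * pi * C * (R + 1)) * (1 / 2) ^ l) \<longlonglongrightarrow> 2 * (2 * pi * C * (R + 1)) * 0"
    by (intro tendsto_intros LIMSEQ_power_zero) auto
  then have "\<forall>\<^sub>F l in sequentially. 2 * (2 * pi * C * (R + 1)) * (1 / 2) ^ l < e / 2"
    using e by (intro order_tendstoD(2)[where y = "2 * (2 * pi * C * (R + 1)) * 0"]) auto
  then obtain l where "2 * (2 * pi * C * (R + 1)) * (1 / 2) ^ l < e / 2"
    by (auto simp: eventually_sequentially)
  then have l: "2 * (2 * pi * C * (R + 1) / 2 ^ l) \<le> e / 2" by (simp add: power_divide)
  define S where "S = {k. \<forall>i<l. n (k + i) = n' i}"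
  show ?thesis
  proof (rule that[of \<eta> S l])
    show "infinite S" unfolding S_def by (rule n')
    fix \<omega> assume \<omega>: "\<And>k. \<omega> k \<in> J" and io: "\<And>k0. \<exists>k\<ge>k0. k \<in> S \<and> (\<forall>i<l. \<omega> (k + i) = \<eta> i)"
    interpret a: hadamard_digits "\<lambda>k. N (\<omega> k) ^ n k" "\<lambda>k. B (\<omega> k)" C
      by (rule hadamard_digits_of_symbols) (use \<omega> n_pos in auto)
    \<comment> \<open>Every symbol of \<omega> occurs in \<eta>, so a common period of the model's
      masks is one for the masks along \<omega>.\<close>
    have "b.G \<subseteq> a.G"
    proof
      fix g assume g: "g \<in> b.G"
      show "g \<in> a.G" unfolding a.G_def
      proof safe
        fix i c c' assume c: "c \<in> B (\<omega> i)" "c' \<in> B (\<omega> i)"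
        obtain i' where "\<eta> i' = \<omega> i" using recur[OF \<omega>[of i]] by blast
        then have "c \<in> B (\<eta> i')" "c' \<in> B (\<eta> i')" using c by simp_all
        then show "real_of_int (c - c') * g \<in> \<int>" using g unfolding b.G_def by blast
      qed
    qed
    then have nv: "a.nonvanishing (e / 2) k" if "k \<in> S" "\<forall>i<l. \<omega> (k + i) = \<eta> i" for k
      using that l eR
      by (intro nonvanishing_of_matching_block[OF a.hadamard_digits_axioms b.hadamard_digits_axioms, of l k R])
         (auto simp: S_def)
    show "\<exists>\<mu>. infinite_convolution (factor_measure N B n \<omega>) \<mu> \<and> spectral_measure \<mu>"
      by (rule spectral_of_nonvanishing[OF \<omega>, of "e / 2"]) (use e e1 io nv in \<open>auto, blast\<close>)
  qed (rule \<eta>)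
qed

end

lemma AE_spectral:
  assumes "\<And>j. j \<in> {1..m} \<Longrightarrow> admissible_pair (N j) (B j)"
    and "\<And>k. n k \<ge> 1" and "bernoulli_measure m P"
  shows "AE \<omega> in P. \<exists>\<mu>. infinite_convolution (factor_measure N B n \<omega>) \<mu> \<and> spectral_measure \<mu>"
proof -
  obtain p where p: "\<forall>j\<in>{1..m}. p j \<ge> 0" "(\<Sum>j\<in>{1..m}. p j) = (1::real)"
    "\<forall>l i. (\<forall>j<l. i j \<in> {1..m}) \<longrightarrow> measure P (cylinder m l i) = (\<Prod>j<l. p (i j))"
    using assms(3) unfolding bernoulli_measure_def by blast
  interpret bernoulli P m p
    using assms(3) p by (intro bernoulli.intro bernoulli_axioms.intro) (auto simp: bernoulli_measure_def)
  \<comment> \<open>Exactly the symbols that \<omega> uses almost surely and from which \<eta> may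
    be built with every prefix of positive probability.\<close>
  define J where "J = {j \<in> {1..m}. p j > 0}"
  have "J \<noteq> {}"
  proof
    assume "J = {}"
    then have "(\<Sum>j\<in>{1..m}. p j) \<le> 0" by (intro sum_nonpos) (auto simp: J_def not_less)
    then show False using p_sum by simp
  qed
  then interpret admissible_family N B n J
    by unfold_locales (use assms in \<open>auto simp: J_def\<close>)
  show ?thesis
  proof (cases "\<exists>K. \<forall>k. n k \<le> K")
    case False
    show ?thesis
      using AE_positive_symbols
      by eventually_elim (rule spectral_of_unbounded[OF _ False], simp add: J_def)
  next
    case True
    then obtain K where "\<And>k. n k \<le> K" by blast
    then obtain \<eta> l S where \<eta>: "\<And>i. \<eta> i \<in> J" and S: "infinite S"
      and spectral: "\<And>\<omega>. (\<And>k. \<omega> k \<in> J) \<Longrightarrow> (\<And>k0. \<exists>k\<ge>k0. k \<in> S \<and> (\<forall>i<l. \<omega> (k + i) = \<eta> i)) \<Longrightarrow>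
        \<exists>\<mu>. infinite_convolution (factor_measure N B n \<omega>) \<mu> \<and> spectral_measure \<mu>"
      using spectral_of_bounded by metis
    show ?thesis
      using AE_positive_symbols AE_infinitely_many_matches[where \<eta> = \<eta> and l = l, OF \<eta>[unfolded J_def] S]
      by eventually_elim (rule spectral, auto simp: J_def)
  qed
qed

theorem theorem1p5:
  fixes m :: nat
    and N :: "nat \<Rightarrow> int"
    and B :: "nat \<Rightarrow> int set"
    and n :: "nat \<Rightarrow> nat"
    and P :: "(nat \<Rightarrow> nat) measure"
  assumes "\<And>j. j \<in> {1..m} \<Longrightarrow> admissible_pair (N j) (B j)"
    and "\<And>k. n k \<ge> 1"
    and "bernoulli_measure m P"
  shows "(AE \<omega> in P. \<exists>\<mu>. infinite_convolution (factor_measure N B n \<omega>) \<mu> \<and> spectral_measure \<mu>) \<and>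
         (AE \<omega> in P. \<exists>\<mu>. infinite_convolution (factor_measure N B (\<lambda>_. 1) \<omega>) \<mu> \<and> spectral_measure \<mu>)"
  using AE_spectral[OF assms] AE_spectral[OF assms(1) order_refl assms(3)] by (rule conjI)

end
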